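(* Let $\Omega\subset\mathbb{R}^3$ be a bounded convex domain with $C^1$ boundary, $0\le\alpha<1/2$, $-3<\gamma\le1$, $\beta>(3+\gamma)/2$ and $0<s<1$. For $h_1,h_2\in X^s_{\alpha,\beta,\gamma}$, we have $\Gamma(h_1,h_2)\in Y^s_{\alpha,\beta,\gamma}$. Moreover, there exists a constant $C_4>0$ such that $$\|\Gamma(h_1,h_2)\|_{Y^s_{\alpha,\beta,\gamma}}\le C_4\|h_1\|_{X^s_{\alpha,\beta,\gamma}}\|h_2\|_{X^s_{\alpha,\beta,\gamma}}$$ for all $h_1,h_2\in X^s_{\alpha,\beta,\gamma}$.
   Context: Fix a measurable function $b$ with $0<b(\cos\theta)\le C_b\cos\theta$ for $0<\theta<\pi/2$ and some $C_b>0$, and put $B(|v-v_*|,\theta)=|v-v_*|^\gamma b(\cos\theta)\sin\theta$. Let $$Q(F,G)(v)=\int_{\mathbb{R}^3}\int_0^{2\pi}\int_0^{\pi/2}[F(v')G(v_*')-F(v)G(v_* )]B(|v-v_*|,\theta)\,d\theta\,d\phi\,dv_*,$$ $v'=v+((v_*-v)\cdot\omega)\omega$, $v_*'=v_*-((v_*-v)\cdot\omega)\omega$, $\omega=\cos\theta\frac{v_*-v}{|v_*-v|}+\sin\theta\cos\phi\,e_2+\sin\theta\sin\phi\,e_3$, where $\{(v_*-v)/|v_*-v|,e_2,e_3\}$ is an orthonormal basis of $\mathbb{R}^3$. Let $M(v)=\pi^{-3/2}e^{-|v|^2}$ and $\Gamma(h_1,h_2)=M^{-1/2}Q(M^{1/2}h_1,M^{1/2}h_2)$,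 acting in the variable $v$ with $x\in\Omega$ as a parameter. Spaces. $\|f\|_{L^\infty_{\alpha,\beta}(\Omega\times\mathbb{R}^3)}=\operatorname{ess\,sup}_{\Omega\times\mathbb{R}^3}|f(x,v)|e^{\alpha|v|^2}(1+|v|)^\beta$. $\|u\|_{H^s(\Omega)}^2=\|u\|_{L^2(\Omega)}^2+\int_\Omega\int_\Omega\frac{|u(x)-u(y)|^2}{|x-y|^{3+2s}}dxdy$, and $\|f\|_{L^2_{\alpha,\beta}(\mathbb{R}^3;H^s(\Omega))}^2=\int_{\mathbb{R}^3}\|f(\cdot,v)\|_{H^s(\Omega)}^2e^{2\alpha|v|^2}(1+|v|)^{2\beta}dv$. $X^s_{\alpha,\beta,\gamma}=L^\infty_{\alpha,\beta}(\Omega\times\mathbb{R}^3)\cap L^2_{\alpha,\gamma/2}(\mathbb{R}^3;H^s(\Omega))$ and $Y^s_{\alpha,\beta,\gamma}=L^\infty_{\alpha,\beta-\gamma}(\Omega\times\mathbb{R}^3)\cap L^2_{\alpha,-\gamma/2}(\mathbb{R}^3;H^s(\Omega))$, each normed by the sum of the two norms. *)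

theory Defs
  imports "HOL-Analysis.Analysis" "HOL-Probability.Essential_Supremum"
begin

type_synonym R3 = "real ^ 3"

section \<open>Bounded convex domains with continuously differentiable boundary\<close>

text \<open>Near every boundary point, and after a rotation or reflection \<open>T\<close> of the coordinate axes,
  \<open>\<Omega>\<close> is the region strictly above the graph of a continuously differentiable function \<open>g\<close>
  of the first two coordinates; \<open>Dg\<close> is the gradient of \<open>g\<close>.\<close>

definition C1_boundary :: "R3 set \<Rightarrow> bool" where
  "C1_boundary \<Omega> \<longleftrightarrow>
     (\<forall>p \<in> frontier \<Omega>. \<exists>r > 0. \<exists>(T :: R3 \<Rightarrow> R3) (g :: real \<times> real \<Rightarrow> real) (Dg :: real \<times> real \<Rightarrow> real \<times> real).
        orthogonal_transformation T \<and>
        (\<forall>z. (g has_derivative (\<lambda>h. Dg z \<bullet> h)) (at z)) \<and>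
        continuous_on UNIV Dg \<and>
        (\<forall>x \<in> ball p r. x \<in> \<Omega> \<longleftrightarrow> g (T x $ 1, T x $ 2) < T x $ 3))"

definition bounded_convex_C1_domain :: "R3 set \<Rightarrow> bool" where
  "bounded_convex_C1_domain \<Omega> \<longleftrightarrow>
     open \<Omega> \<and> connected \<Omega> \<and> \<Omega> \<noteq> {} \<and> bounded \<Omega> \<and> convex \<Omega> \<and> C1_boundary \<Omega>"

section \<open>The collision operator\<close>

text \<open>A measurable choice, for every relative velocity \<open>u = v\<^sub>* - v \<noteq> 0\<close>, of two vectors that
  complete \<open>u / |u|\<close> to an orthonormal basis. Measurability makes the collision integral
  meaningful as an integral over the product space of all \<open>(v\<^sub>*, \<phi>, \<theta>)\<close>; there is no continuous
  choice.\<close>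

definition collision_frame :: "(R3 \<Rightarrow> R3) \<Rightarrow> (R3 \<Rightarrow> R3) \<Rightarrow> bool" where
  "collision_frame e2 e3 \<longleftrightarrow>
     e2 \<in> borel_measurable borel \<and> e3 \<in> borel_measurable borel \<and>
     (\<forall>u. u \<noteq> 0 \<longrightarrow>
        norm (e2 u) = 1 \<and> norm (e3 u) = 1 \<and>
        (u /\<^sub>R norm u) \<bullet> e2 u = 0 \<and> (u /\<^sub>R norm u) \<bullet> e3 u = 0 \<and> e2 u \<bullet> e3 u = 0)"

lemma collision_frame_exists: "\<exists>e2 e3. collision_frame e2 e3"
proof -
  define e2 :: "R3 \<Rightarrow> R3" where "e2 = (\<lambda>u. if u$1 = 0 \<and> u$2 = 0 then vector [1,0,0]
     else (1 / sqrt ((u$1)\<^sup>2 + (u$2)\<^sup>2)) *\<^sub>R (vector [- u$2, u$1, 0]))"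
  define e3 where "e3 = (\<lambda>u. cross3 (u /\<^sub>R norm u) (e2 u))"
  have v: "(\<lambda>u::R3. (vector [- u$2, u$1, 0] :: R3)) = (\<lambda>u. (-u$2) *\<^sub>R axis 1 1 + (u$1) *\<^sub>R axis 2 1)"
    by (auto simp: vec_eq_iff vector_def axis_def forall_3)
  have c: "continuous_on UNIV (\<lambda>u::R3. (vector [- u$2, u$1, 0] :: R3))"
    unfolding v by (intro continuous_intros)
  have m1[measurable]: "(\<lambda>u::R3. u$i) \<in> borel_measurable borel" for i
    by (intro borel_measurable_continuous_onI continuous_intros)
  have m2[measurable]: "(\<lambda>u::R3. (vector [- u$2, u$1, 0] :: R3)) \<in> borel_measurable borel"
    by (intro borel_measurable_continuous_onI c)
  have m3[measurable]: "e2 \<in> borel_measurable borel"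
    unfolding e2_def by measurable
  have m4: "(\<lambda>p. cross3 (fst p) (snd p)) \<in> borel_measurable borel"
    by (intro borel_measurable_continuous_onI continuous_on_cross continuous_intros)
  have "(\<lambda>u. (\<lambda>p. cross3 (fst p) (snd p)) (u /\<^sub>R norm u, e2 u)) \<in> borel_measurable borel"
    by (rule measurable_compose[OF _ m4]) measurable
  then have m5: "e3 \<in> borel_measurable borel" by (simp add: e3_def)
  have n2: "norm (e2 u) = 1" for u
  proof (cases "u$1 = 0 \<and> u$2 = 0")
    case False
    then have "(u$1)\<^sup>2 + (u$2)\<^sup>2 > 0" by (simp add: sum_power2_gt_zero_iff)
    then show ?thesis using False
      by (simp add: e2_def norm_eq_sqrt_inner inner_vec_def sum_3 vector_def power2_eq_square add.commute
            flip: add_divide_distrib)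
  qed (simp add: e2_def norm_eq_sqrt_inner inner_vec_def sum_3 vector_def)
  have o: "u \<bullet> e2 u = 0" for u
    by (auto simp: e2_def inner_vec_def sum_3 vector_def algebra_simps)
  have n3: "norm (e3 u) = 1" if "u \<noteq> 0" for u
  proof -
    have "(norm (e3 u))\<^sup>2 = (norm (u /\<^sub>R norm u))\<^sup>2 * (norm (e2 u))\<^sup>2 - ((u /\<^sub>R norm u) \<bullet> e2 u)\<^sup>2"
      using norm_cross_dot[of "u /\<^sub>R norm u" "e2 u"] by (simp add: e3_def power_mult_distrib)
    also have "\<dots> = 1" using that n2 o by simp
    finally have "(norm (e3 u))\<^sup>2 = 1\<^sup>2" by simp
    then show ?thesis by (metis norm_ge_zero power2_eq_imp_eq zero_le_one)
  qed
  show ?thesis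
    unfolding collision_frame_def
    using m3 m5 n2 n3 o by (intro exI[of _ e2] exI[of _ e3]) (auto simp: e3_def dot_cross_self)
qed

definition collision_dir :: "(R3 \<Rightarrow> R3) \<Rightarrow> (R3 \<Rightarrow> R3) \<Rightarrow> R3 \<Rightarrow> real \<Rightarrow> real \<Rightarrow> R3" where
  "collision_dir e2 e3 u \<phi> \<theta> =
     cos \<theta> *\<^sub>R (u /\<^sub>R norm u) + (sin \<theta> * cos \<phi>) *\<^sub>R e2 u + (sin \<theta> * sin \<phi>) *\<^sub>R e3 u"

definition post_v :: "R3 \<Rightarrow> R3 \<Rightarrow> R3 \<Rightarrow> R3" where
  "post_v \<omega> v vs = v + ((vs - v) \<bullet> \<omega>) *\<^sub>R \<omega>"

definition post_vs :: "R3 \<Rightarrow> R3 \<Rightarrow> R3 \<Rightarrow> R3" where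
  "post_vs \<omega> v vs = vs - ((vs - v) \<bullet> \<omega>) *\<^sub>R \<omega>"

definition collision_kernel :: "real \<Rightarrow> (real \<Rightarrow> real) \<Rightarrow> real \<Rightarrow> real \<Rightarrow> real" where
  "collision_kernel \<gamma> b r \<theta> = r powr \<gamma> * b (cos \<theta>) * sin \<theta>"

definition collision_integrand ::
  "real \<Rightarrow> (real \<Rightarrow> real) \<Rightarrow> (R3 \<Rightarrow> R3) \<Rightarrow> (R3 \<Rightarrow> R3) \<Rightarrow> (R3 \<Rightarrow> real) \<Rightarrow> (R3 \<Rightarrow> real) \<Rightarrow> R3
     \<Rightarrow> R3 \<times> real \<times> real \<Rightarrow> real" where
  "collision_integrand \<gamma> b e2 e3 F G v = (\<lambda>(vs, \<phi>, \<theta>).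
     let \<omega> = collision_dir e2 e3 (vs - v) \<phi> \<theta> in
       (F (post_v \<omega> v vs) * G (post_vs \<omega> v vs) - F v * G vs) * collision_kernel \<gamma> b (norm (v - vs)) \<theta>)"

definition collision_domain :: "(R3 \<times> real \<times> real) set" where
  "collision_domain = UNIV \<times> {0<..<2 * pi} \<times> {0<..<pi / 2}"

text \<open>The Bochner integral is \<open>0\<close> for a non-integrable integrand, so convergence of the collision
  integral is a separate predicate.\<close>

definition Q_converges ::
  "real \<Rightarrow> (real \<Rightarrow> real) \<Rightarrow> (R3 \<Rightarrow> R3) \<Rightarrow> (R3 \<Rightarrow> R3) \<Rightarrow> (R3 \<Rightarrow> real) \<Rightarrow> (R3 \<Rightarrow> real) \<Rightarrow> R3 \<Rightarrow> bool" where
  "Q_converges \<gamma> b e2 e3 F G v \<longleftrightarrow>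
     set_integrable lebesgue collision_domain (collision_integrand \<gamma> b e2 e3 F G v)"

definition Q ::
  "real \<Rightarrow> (real \<Rightarrow> real) \<Rightarrow> (R3 \<Rightarrow> R3) \<Rightarrow> (R3 \<Rightarrow> R3) \<Rightarrow> (R3 \<Rightarrow> real) \<Rightarrow> (R3 \<Rightarrow> real) \<Rightarrow> R3 \<Rightarrow> real" where
  "Q \<gamma> b e2 e3 F G v =
     set_lebesgue_integral lebesgue collision_domain (collision_integrand \<gamma> b e2 e3 F G v)"

definition Maxwellian :: "R3 \<Rightarrow> real" where
  "Maxwellian v = pi powr (-3/2) * exp (- (norm v)\<^sup>2)"

definition \<Gamma> ::
  "real \<Rightarrow> (real \<Rightarrow> real) \<Rightarrow> (R3 \<Rightarrow> R3) \<Rightarrow> (R3 \<Rightarrow> R3) \<Rightarrow> (R3 \<Rightarrow> R3 \<Rightarrow> real) \<Rightarrow> (R3 \<Rightarrow> R3 \<Rightarrow> real)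
     \<Rightarrow> R3 \<Rightarrow> R3 \<Rightarrow> real" where
  "\<Gamma> \<gamma> b e2 e3 h1 h2 x v =
     Maxwellian v powr (-1/2) *
     Q \<gamma> b e2 e3 (\<lambda>w. Maxwellian w powr (1/2) * h1 x w) (\<lambda>w. Maxwellian w powr (1/2) * h2 x w) v"

definition \<Gamma>_converges ::
  "real \<Rightarrow> (real \<Rightarrow> real) \<Rightarrow> (R3 \<Rightarrow> R3) \<Rightarrow> (R3 \<Rightarrow> R3) \<Rightarrow> (R3 \<Rightarrow> R3 \<Rightarrow> real) \<Rightarrow> (R3 \<Rightarrow> R3 \<Rightarrow> real)
     \<Rightarrow> R3 \<Rightarrow> R3 \<Rightarrow> bool" where
  "\<Gamma>_converges \<gamma> b e2 e3 h1 h2 x v \<longleftrightarrow>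
     Q_converges \<gamma> b e2 e3 (\<lambda>w. Maxwellian w powr (1/2) * h1 x w) (\<lambda>w. Maxwellian w powr (1/2) * h2 x w) v"

section \<open>Function spaces\<close>

text \<open>Elements of the spaces are represented by functions \<open>f x v\<close>, Lebesgue measurable on
  \<open>\<Omega> \<times> \<real>\<^sup>3\<close>; values for \<open>x \<notin> \<Omega>\<close> are irrelevant. The extended norms are \<open>\<infinity>\<close> when the
  corresponding quantity is infinite, and the real norms are only meaningful on the spaces.\<close>

definition phase_measurable :: "R3 set \<Rightarrow> (R3 \<Rightarrow> R3 \<Rightarrow> real) \<Rightarrow> bool" where
  "phase_measurable \<Omega> f \<longleftrightarrow> (\<lambda>(x, v). f x v) \<in> borel_measurable (lebesgue_on (\<Omega> \<times> UNIV))"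

definition Linf_ext_norm :: "R3 set \<Rightarrow> real \<Rightarrow> real \<Rightarrow> (R3 \<Rightarrow> R3 \<Rightarrow> real) \<Rightarrow> ennreal" where
  "Linf_ext_norm \<Omega> \<alpha> \<beta> f =
     esssup (lebesgue_on (\<Omega> \<times> UNIV))
       (\<lambda>(x, v). ennreal (\<bar>f x v\<bar> * exp (\<alpha> * (norm v)\<^sup>2) * (1 + norm v) powr \<beta>))"

definition Hs_ext_norm_sq :: "R3 set \<Rightarrow> real \<Rightarrow> (R3 \<Rightarrow> real) \<Rightarrow> ennreal" where
  "Hs_ext_norm_sq \<Omega> s u =
     (\<integral>\<^sup>+x\<in>\<Omega>. ennreal (\<bar>u x\<bar>\<^sup>2) \<partial>lebesgue) +
     (\<integral>\<^sup>+x\<in>\<Omega>. (\<integral>\<^sup>+y\<in>\<Omega>. ennreal (\<bar>u x - u y\<bar>\<^sup>2 / norm (x - y) powr (3 + 2 * s)) \<partial>lebesgue) \<partial>lebesgue)"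

definition L2Hs_ext_norm_sq :: "R3 set \<Rightarrow> real \<Rightarrow> real \<Rightarrow> real \<Rightarrow> (R3 \<Rightarrow> R3 \<Rightarrow> real) \<Rightarrow> ennreal" where
  "L2Hs_ext_norm_sq \<Omega> s \<alpha> \<beta> f =
     (\<integral>\<^sup>+v. Hs_ext_norm_sq \<Omega> s (\<lambda>x. f x v)
           * ennreal (exp (2 * \<alpha> * (norm v)\<^sup>2) * (1 + norm v) powr (2 * \<beta>)) \<partial>lebesgue)"

definition Linf_space :: "R3 set \<Rightarrow> real \<Rightarrow> real \<Rightarrow> (R3 \<Rightarrow> R3 \<Rightarrow> real) set" where
  "Linf_space \<Omega> \<alpha> \<beta> = {f. phase_measurable \<Omega> f \<and> Linf_ext_norm \<Omega> \<alpha> \<beta> f < \<infinity>}"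

definition L2Hs_space :: "R3 set \<Rightarrow> real \<Rightarrow> real \<Rightarrow> real \<Rightarrow> (R3 \<Rightarrow> R3 \<Rightarrow> real) set" where
  "L2Hs_space \<Omega> s \<alpha> \<beta> = {f. phase_measurable \<Omega> f \<and> L2Hs_ext_norm_sq \<Omega> s \<alpha> \<beta> f < \<infinity>}"

definition Linf_norm :: "R3 set \<Rightarrow> real \<Rightarrow> real \<Rightarrow> (R3 \<Rightarrow> R3 \<Rightarrow> real) \<Rightarrow> real" where
  "Linf_norm \<Omega> \<alpha> \<beta> f = enn2real (Linf_ext_norm \<Omega> \<alpha> \<beta> f)"

definition L2Hs_norm :: "R3 set \<Rightarrow> real \<Rightarrow> real \<Rightarrow> real \<Rightarrow> (R3 \<Rightarrow> R3 \<Rightarrow> real) \<Rightarrow> real" where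
  "L2Hs_norm \<Omega> s \<alpha> \<beta> f = sqrt (enn2real (L2Hs_ext_norm_sq \<Omega> s \<alpha> \<beta> f))"

definition X_space :: "R3 set \<Rightarrow> real \<Rightarrow> real \<Rightarrow> real \<Rightarrow> real \<Rightarrow> (R3 \<Rightarrow> R3 \<Rightarrow> real) set" where
  "X_space \<Omega> s \<alpha> \<beta> \<gamma> = Linf_space \<Omega> \<alpha> \<beta> \<inter> L2Hs_space \<Omega> s \<alpha> (\<gamma> / 2)"

definition X_norm :: "R3 set \<Rightarrow> real \<Rightarrow> real \<Rightarrow> real \<Rightarrow> real \<Rightarrow> (R3 \<Rightarrow> R3 \<Rightarrow> real) \<Rightarrow> real" where
  "X_norm \<Omega> s \<alpha> \<beta> \<gamma> f = Linf_norm \<Omega> \<alpha> \<beta> f + L2Hs_norm \<Omega> s \<alpha> (\<gamma> / 2) f"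

definition Y_space :: "R3 set \<Rightarrow> real \<Rightarrow> real \<Rightarrow> real \<Rightarrow> real \<Rightarrow> (R3 \<Rightarrow> R3 \<Rightarrow> real) set" where
  "Y_space \<Omega> s \<alpha> \<beta> \<gamma> = Linf_space \<Omega> \<alpha> (\<beta> - \<gamma>) \<inter> L2Hs_space \<Omega> s \<alpha> (- \<gamma> / 2)"

definition Y_norm :: "R3 set \<Rightarrow> real \<Rightarrow> real \<Rightarrow> real \<Rightarrow> real \<Rightarrow> (R3 \<Rightarrow> R3 \<Rightarrow> real) \<Rightarrow> real" where
  "Y_norm \<Omega> s \<alpha> \<beta> \<gamma> f = Linf_norm \<Omega> \<alpha> (\<beta> - \<gamma>) f + L2Hs_norm \<Omega> s \<alpha> (- \<gamma> / 2) f"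

end

theory Submission
  imports Defs
begin

text \<open>
  Conservation of energy turns \<open>\<Gamma>\<close> into an integral with the weight \<open>exp (- |v\<^sub>*|\<^sup>2 / 2)\<close>, and it absorbs the
  factor \<open>exp (\<alpha> |v|\<^sup>2)\<close>; the pointwise bound then follows from \<open>(1 + |v'|) (1 + |v\<^sub>*'|) \<ge> 1 + |v|\<close>.
  For the \<open>L\<^sup>2\<close> bounds, Cauchy--Schwarz leaves \<open>\<integral> K F(v')\<^sup>2 G(v\<^sub>*')\<^sup>2\<close>. For a fixed relative velocity and fixed
  angles the map \<open>v \<mapsto> v'\<close> is a translation, so everything reduces to the bound
  \<open>J(p) \<le> C (1 + |p|)\<^sup>\<gamma>\<close> for an explicit collision integral \<open>J\<close>. There, the deflection \<open>c\<close> of length \<open>\<lambda> |u|\<close> is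
  equidistributed over directions: \<open>J\<close> is rotation invariant, so it may be averaged over a shell
  \<open>|p| \<le> |q| \<le> |p| + 1\<close>, and inside the average \<open>c\<close> can be rotated to \<open>\<lambda> u\<close>.
  Sobolev differences are handled by bilinearity and Tonelli.
\<close>

text \<open>Three obstacles shape the argument. The frame \<open>e2\<close>, \<open>e3\<close> is
  merely measurable and not equivariant, so rotation invariance appears only after integration over
  \<phi>: by then the frame enters only through the length of the part of \<open>p\<close>
  orthogonal to \<open>u\<close>. Next, rescaling a deflection of length \<lambda> |u| costs
  \<lambda> to the power -(3 + \<gamma>), which the angular weight cos \<theta> sin \<theta> does
  not pay for uniformly in \<theta> once \<gamma> > -2. The missing power is bought with the decay
  of the bounded factor. That decay also gives integrability at infinity in the loss term, where 2
  \<beta> > 3 + \<gamma> is exactly the condition. Finally \<open>h1\<close>, \<open>h2\<close> and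
  \<open>b\<close> are only Lebesgue measurable, while the Tonelli arguments need jointly Borel
  integrands. The estimates are therefore proved for Borel versions that obey their bounds
  everywhere. That \<Gamma> does not see the exchange again rests on the fact that, for fixed
  relative velocity and angles, every velocity involved is a translate of \<open>v\<close>.\<close>

section \<open>Lebesgue integrals under isometries and dilations\<close>

text \<open>\<open>lborel\<close> is determined by its values on boxes, and the preimage of a box
  under \<open>T\<close> is its image under \<open>inv T\<close>, which has the same volume.\<close>

lemma nn_integral_lborel_orthogonal:
  fixes f :: "real^'n::{finite,wellorder} \<Rightarrow> ennreal"
    and T :: "real^'n::{finite,wellorder} \<Rightarrow> real^'n::{finite,wellorder}"
  assumes T: "orthogonal_transformation T" and [measurable]: "f \<in> borel_measurable borel"
  shows "(\<integral>\<^sup>+x. f (T x) \<partial>lborel) = (\<integral>\<^sup>+x. f x \<partial>lborel)"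
proof -
  have "continuous_on UNIV T"
    using orthogonal_transformation_linear[OF T]
    by (simp add: linear_continuous_on linear_conv_bounded_linear)
  then have [measurable]: "T \<in> borel_measurable borel"
    by (rule borel_measurable_continuous_onI)
  have "lborel = distr lborel borel T"
  proof (rule lborel_eqI)
    fix l u :: "real^'n::{finite,wellorder}" assume "\<And>b. b \<in> Basis \<Longrightarrow> l \<bullet> b \<le> u \<bullet> b"
    have bij: "bij T" by (rule orthogonal_transformation_bij[OF T])
    have eq: "T -` box l u = inv T ` box l u" using bij by (simp add: bij_vimage_eq_inv_image)
    have lm: "inv T ` box l u \<in> lmeasurable"
      by (rule measurable_orthogonal_image[OF orthogonal_transformation_inv[OF T]]) simp
    have [measurable]: "inv T ` box l u \<in> sets borel"
      unfolding eq[symmetric] by (rule measurable_sets_borel[of T borel]) simp_all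
    have "emeasure (distr lborel borel T) (box l u) = emeasure lborel (T -` box l u)"
      by (simp add: emeasure_distr)
    also have "\<dots> = emeasure lebesgue (inv T ` box l u)" by (simp add: eq)
    also have "\<dots> = ennreal (measure lebesgue (inv T ` box l u))"
      using lm by (simp add: emeasure_eq_measure2)
    also have "\<dots> = ennreal (measure lebesgue (box l u))"
      by (subst measure_orthogonal_image[OF orthogonal_transformation_inv[OF T]]) simp_all
    finally show "emeasure (distr lborel borel T) (box l u) = ennreal (\<Prod>b\<in>Basis. (u - l) \<bullet> b)"
      using \<open>\<And>b. b \<in> Basis \<Longrightarrow> l \<bullet> b \<le> u \<bullet> b\<close>
      by (simp add: measure_lborel_box_eq)
  qed simp
  then have "(\<integral>\<^sup>+x. f x \<partial>lborel) = (\<integral>\<^sup>+x. f x \<partial>distr lborel borel T)" by simp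
  then show ?thesis by (simp add: nn_integral_distr)
qed

lemma nn_integral_lborel_translate:
  fixes f :: "'a::euclidean_space \<Rightarrow> ennreal"
  assumes [measurable]: "f \<in> borel_measurable borel"
  shows "(\<integral>\<^sup>+x. f (t + x) \<partial>lborel) = (\<integral>\<^sup>+x. f x \<partial>lborel)"
  by (subst (2) lborel_distr_plus[of t, symmetric]) (simp add: nn_integral_distr)

lemma nn_integral_lborel_reflect:
  fixes f :: "'a::euclidean_space \<Rightarrow> ennreal"
  assumes [measurable]: "f \<in> borel_measurable borel"
  shows "(\<integral>\<^sup>+x. f (t - x) \<partial>lborel) = (\<integral>\<^sup>+x. f x \<partial>lborel)"
proof -
  have "(\<integral>\<^sup>+x. f x \<partial>lborel) = (\<integral>\<^sup>+x. f x \<partial>density (distr lborel borel (\<lambda>x. t + (-1) *\<^sub>R x)) (\<lambda>_. ennreal (\<bar>-1::real\<bar>^DIM('a))))"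
    by (subst lborel_affine[of "-1" t]) simp_all
  also have "\<dots> = (\<integral>\<^sup>+x. f (t - x) \<partial>lborel)" by (simp add: density_1 nn_integral_distr)
  finally show ?thesis by simp
qed

lemma nn_integral_lborel_scale:
  fixes f :: "'a::euclidean_space \<Rightarrow> ennreal"
  assumes [measurable]: "f \<in> borel_measurable borel" and c: "c > 0"
  shows "ennreal (c ^ DIM('a)) * (\<integral>\<^sup>+x. f (c *\<^sub>R x) \<partial>lborel) = (\<integral>\<^sup>+x. f x \<partial>lborel)"
proof -
  have "(\<integral>\<^sup>+x. f x \<partial>lborel) = (\<integral>\<^sup>+x. f x \<partial>density (distr lborel borel (\<lambda>x. 0 + c *\<^sub>R x)) (\<lambda>_. \<bar>c\<bar>^DIM('a)))"
    using c by (subst lborel_affine[of c 0]) simp_all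
  also have "\<dots> = ennreal (c ^ DIM('a)) * (\<integral>\<^sup>+x. f (c *\<^sub>R x) \<partial>lborel)" using c 
    by (simp add: nn_integral_density nn_integral_distr nn_integral_cmult)
  finally show ?thesis by simp
qed

section \<open>Power weights and Gaussians\<close>

text \<open>Singularity and tail are separated at 1: below it the decaying factor is dropped, above
  it both factors merge into the power a - \<rho> < -1. Reflection handles negative t.\<close>

lemma nn_integral_power_weight_real_finite:
  fixes a \<rho> :: real
  assumes "-1 < a" "a \<le> 0" "\<rho> - a > 1" "\<rho> \<ge> 0"
  shows "(\<integral>\<^sup>+t. ennreal (\<bar>t\<bar> powr a * (1 + \<bar>t\<bar>) powr (- \<rho>)) \<partial>lborel) < \<infinity>"
proof -
  define g where "g = (\<lambda>t::real. ennreal (\<bar>t\<bar> powr a * (1 + \<bar>t\<bar>) powr (- \<rho>)))"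
  have [measurable]: "g \<in> borel_measurable borel" unfolding g_def by measurable
  define g1 where "g1 = (\<lambda>t::real. t powr a * indicator {0..1} t)"
  define g2 where "g2 = (\<lambda>t::real. t powr (a - \<rho>) * indicator {1..} t)"
  have h1: "((\<lambda>x. x powr a) has_integral (1 / (a + 1))) {0..1}"
    using has_integral_powr_from_0[of a 1] assms by simp
  have h2: "((\<lambda>x. x powr (a - \<rho>)) has_integral (- (1 powr (a - \<rho> + 1)) / (a - \<rho> + 1))) {1..}"
    using has_integral_powr_to_inf[of "a - \<rho>" 1] assms by simp
  have f1: "(\<integral>\<^sup>+t. ennreal (g1 t) \<partial>lborel) < \<infinity>"
    using nn_integral_has_integral_lebesgue[OF _ h1] unfolding nn_integral_completion
    by (simp add: g1_def mult.commute)
  have f2: "(\<integral>\<^sup>+t. ennreal (g2 t) \<partial>lborel) < \<infinity>"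
    using nn_integral_has_integral_lebesgue[OF _ h2] unfolding nn_integral_completion
    by (simp add: g2_def mult.commute)
  have [measurable]: "g1 \<in> borel_measurable borel" "g2 \<in> borel_measurable borel"
    unfolding g1_def g2_def by measurable
  have le: "g t * indicator {0..} t \<le> ennreal (g1 t) + ennreal (g2 t)" for t
  proof (cases "t \<ge> 0")
    case True
    show ?thesis
    proof (cases "t \<le> 1")
      case True
      have "(1 + t) powr (-\<rho>) \<le> 1" using \<open>t \<ge> 0\<close> assms
        by (simp add: powr_minus inverse_le_1_iff ge_one_powr_ge_zero)
      then have "g t \<le> ennreal (g1 t)" using True \<open>t \<ge> 0\<close>
        by (auto simp: g_def g1_def intro!: ennreal_leI mult_left_le)
      then show ?thesis using \<open>t \<ge> 0\<close> by (simp add: add_increasing2)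
    next
      case False
      have "(1 + t) powr (-\<rho>) \<le> t powr (-\<rho>)" using False assms by (intro powr_mono2') auto
      then have "t powr a * (1 + t) powr (-\<rho>) \<le> t powr (a - \<rho>)"
        by (simp add: powr_diff powr_minus divide_inverse mult_left_mono)
      then have "g t \<le> ennreal (g2 t)" using False
        by (auto simp: g_def g2_def intro!: ennreal_leI)
      then show ?thesis using \<open>t \<ge> 0\<close> by (simp add: add_increasing)
    qed
  qed simp
  have half: "(\<integral>\<^sup>+t. g t * indicator {0..} t \<partial>lborel) < \<infinity>"
  proof -
    have "(\<integral>\<^sup>+t. g t * indicator {0..} t \<partial>lborel) \<le> (\<integral>\<^sup>+t. ennreal (g1 t) + ennreal (g2 t) \<partial>lborel)"
      by (rule nn_integral_mono) (rule le)
    also have "\<dots> < \<infinity>" using f1 f2 by (simp add: nn_integral_add)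
    finally show ?thesis .
  qed
  have "(\<integral>\<^sup>+t. g t \<partial>lborel) \<le> (\<integral>\<^sup>+t. g t * indicator {0..} t + g (0 - t) * indicator {0..} (0 - t) \<partial>lborel)"
    by (rule nn_integral_mono) (auto simp: g_def indicator_def)
  also have "\<dots> = (\<integral>\<^sup>+t. g t * indicator {0..} t \<partial>lborel) + (\<integral>\<^sup>+t. g (0 - t) * indicator {0..} (0 - t) \<partial>lborel)"
    by (simp add: nn_integral_add)
  also have "(\<integral>\<^sup>+t. g (0 - t) * indicator {0..} (0 - t) \<partial>lborel) = (\<integral>\<^sup>+t. g t * indicator {0..} t \<partial>lborel)"
    by (rule nn_integral_lborel_reflect[of "\<lambda>t. g t * indicator {0..} t"]) simp
  also have "(\<integral>\<^sup>+t. g t * indicator {0..} t \<partial>lborel) + (\<integral>\<^sup>+t. g t * indicator {0..} t \<partial>lborel) < \<infinity>"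
    using half by simp
  finally show ?thesis by (simp add: g_def)
qed

text \<open>Both factors decrease in the norm. Writing each as a product of n equal roots, n the
  dimension, and replacing the norm by a different coordinate in each root only enlarges them. The
  integral is then at most an n-fold product of one-dimensional integrals with exponents
  \<open>m/n\<close> and \<open>\<rho>/n\<close>.\<close>

lemma nn_integral_power_weight_finite:
  fixes m \<rho> :: real
  assumes "- real DIM('a::euclidean_space) < m" "m \<le> 0" "\<rho> - m > real DIM('a)" "\<rho> \<ge> 0"
  shows "(\<integral>\<^sup>+x. ennreal (norm x powr m * (1 + norm x) powr (- \<rho>)) \<partial>(lborel :: 'a measure)) < \<infinity>"
proof -
  define n where "n = real DIM('a)"
  have n: "n > 0" by (simp add: n_def)
  define g where "g = (\<lambda>t::real. \<bar>t\<bar> powr (m/n) * (1 + \<bar>t\<bar>) powr (- (\<rho>/n)))"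
  have fin: "(\<integral>\<^sup>+t. ennreal (g t) \<partial>lborel) < \<infinity>"
    unfolding g_def using assms n
    by (intro nn_integral_power_weight_real_finite) (auto simp: n_def field_simps)
  \<comment> \<open>Zero coordinates must be excluded: \<open>0 powr a\<close> is 0, so such a
    factor would vanish instead of dominating.\<close>
  have ae: "AE x in (lborel :: 'a measure). \<forall>b\<in>Basis. x \<bullet> b \<noteq> 0"
    by (intro AE_finite_allI finite_Basis AE_lborel_inner_neq)
  have "(\<integral>\<^sup>+x. ennreal (norm x powr m * (1 + norm x) powr (- \<rho>)) \<partial>(lborel :: 'a measure))
      \<le> (\<integral>\<^sup>+x. ennreal (\<Prod>b\<in>Basis. g (x \<bullet> b)) \<partial>(lborel :: 'a measure))"
  proof (rule nn_integral_mono_AE, use ae in eventually_elim)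
    fix x :: 'a assume nz: "\<forall>b\<in>Basis. x \<bullet> b \<noteq> 0"
    have x: "norm x > 0" using nz SOME_Basis by fastforce
    have 1: "norm x powr m = (\<Prod>b\<in>(Basis::'a set). norm x powr (m/n))"
      using x by (simp add: powr_power n_def)
    have nz1: "1 + norm x \<noteq> 0" using norm_ge_zero[of x] by linarith
    have 2: "(1 + norm x) powr (-\<rho>) = (\<Prod>b\<in>(Basis::'a set). (1 + norm x) powr (-(\<rho>/n)))"
      using nz1 powr_power[of "1 + norm x" "-(\<rho>/n)" "DIM('a)"] by (simp add: n_def)
    have "norm x powr m * (1 + norm x) powr (- \<rho>) =
        (\<Prod>b\<in>(Basis::'a set). norm x powr (m/n) * (1 + norm x) powr (-(\<rho>/n)))"
      by (simp only: 1 2 prod.distrib)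
    also have "\<dots> \<le> (\<Prod>b\<in>Basis. g (x \<bullet> b))"
      unfolding g_def using nz assms n Basis_le_norm
      by (intro prod_mono conjI mult_mono powr_mono2') (auto simp: divide_nonpos_pos)
    finally show "ennreal (norm x powr m * (1 + norm x) powr (- \<rho>)) \<le> ennreal (\<Prod>b\<in>Basis. g (x \<bullet> b))"
      by (rule ennreal_leI)
  qed
  also have "\<dots> = (\<integral>\<^sup>+x. (\<Prod>b\<in>Basis. ennreal (g (x \<bullet> b))) \<partial>(lborel :: 'a measure))"
    by (intro nn_integral_cong) (simp add: prod_ennreal g_def)
  also have "\<dots> = (\<Prod>b\<in>(Basis::'a set). (\<integral>\<^sup>+x. ennreal (g x) \<partial>lborel))"
    by (rule nn_integral_lborel_prod) (auto simp: g_def)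
  also have "\<dots> < \<infinity>" using fin by (simp add: power_less_top_ennreal)
  finally show ?thesis .
qed

text \<open>Since ln (1 + t) \<le> t, the exponent is at most |n| t - k t^2, and the constant comes
  from the maximum n^2 / (4 k) of this parabola.\<close>

lemma powr_mult_gauss_le:
  fixes k n t :: real
  assumes "k > 0" "t \<ge> 0"
  shows "(1 + t) powr n * exp (- k * t\<^sup>2) \<le> exp (n\<^sup>2 / (4 * k))"
proof -
  have "ln (1 + t) \<le> t" "ln (1 + t) \<ge> 0" using assms by (auto intro: ln_add_one_self_le_self)
  then have "n * ln (1 + t) \<le> \<bar>n\<bar> * t"
    by (meson abs_ge_self abs_ge_zero mult_mono order_trans mult_right_mono)
  moreover have "\<bar>n\<bar> * t - k * t\<^sup>2 \<le> n\<^sup>2 / (4 * k)"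
  proof -
    have "0 \<le> (2 * k * t - \<bar>n\<bar>)\<^sup>2" by simp
    then have "4 * k * (\<bar>n\<bar> * t - k * t\<^sup>2) \<le> n\<^sup>2" by (simp add: power2_eq_square algebra_simps)
    then show ?thesis using assms by (simp add: field_simps)
  qed
  ultimately show ?thesis
    using assms by (simp add: powr_def flip: exp_add)
qed

text \<open>Peetre's inequality. Its powers trade a weight at \<open>q\<close> for weights at
  \<open>y\<close> and \<open>q + y\<close>.\<close>

lemma norm_add_peetre:
  fixes q y :: "'a::real_normed_vector"
  shows "1 + norm q \<le> (1 + norm y) * (1 + norm (q + y))"
proof -
  have "norm q \<le> norm (q + y) + norm y" using norm_triangle_ineq4[of "q + y" y] by simp
  moreover have "0 \<le> norm y * norm (q + y)" by simp
  ultimately show ?thesis unfolding distrib_left distrib_right by linarith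
qed

lemma one_plus_norm_powr_le:
  fixes q y :: "'a::real_normed_vector"
  assumes "s \<ge> 0"
  shows "(1 + norm q) powr s \<le> (1 + norm y) powr s * (1 + norm (q + y)) powr s"
  using assms norm_add_peetre[of q y] norm_ge_zero[of q] norm_ge_zero[of y] norm_ge_zero[of "q + y"]
  by (subst powr_mult[symmetric]) (auto intro!: powr_mono2)

text \<open>Peetre's inequality extracts the factor (1 + |q|)^m at the price of |m| powers of 1 + |q
  + y|, which the Gaussian absorbs. What remains is dominated by two integrable functions: one
  carries the singularity at y = 0, the other the decay away from y = -q.\<close>

lemma nn_integral_powr_gauss_le:
  fixes m k :: real
  assumes m: "- real DIM('a::euclidean_space) < m" and k: "k > 0"
  shows "\<exists>C>0. \<forall>q::'a. (\<integral>\<^sup>+y. ennreal (norm y powr m * exp (- k * (norm (q + y))\<^sup>2)) \<partial>lborel)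
           \<le> ennreal (C * (1 + norm q) powr m)"
proof -
  define d where "d = real DIM('a) + 1"
  \<comment> \<open>A positive exponent causes no singularity and is handled by the Gaussian, so
    only the negative part enters the dominating weight.\<close>
  define m0 where "m0 = min m 0"
  define w where "w = (\<lambda>e (y::'a). norm y powr e * (1 + norm y) powr (-d))"
  have [measurable]: "w e \<in> borel_measurable borel" for e unfolding w_def by measurable
  have fin: "(\<integral>\<^sup>+y. ennreal (w m0 y) \<partial>lborel) < \<infinity>" "(\<integral>\<^sup>+y. ennreal (w 0 y) \<partial>lborel) < \<infinity>"
    unfolding w_def by (rule nn_integral_power_weight_finite; use m in \<open>auto simp: m0_def d_def\<close>)+
  define I where "I = enn2real ((\<integral>\<^sup>+y. ennreal (w m0 y) \<partial>lborel) + (\<integral>\<^sup>+y. ennreal (w 0 y) \<partial>lborel))"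
  have I: "(\<integral>\<^sup>+y. ennreal (w m0 y) \<partial>lborel) + (\<integral>\<^sup>+y. ennreal (w 0 y) \<partial>lborel) = ennreal I"
    using fin by (simp add: I_def)
  have I0: "I \<ge> 0" by (simp add: I_def)
  define G where "G = exp ((\<bar>m\<bar> + d)\<^sup>2 / (4 * k))"
  define C where "C = 2 powr \<bar>m\<bar> * 2 powr d * G"
  have C0: "C > 0" by (simp add: C_def G_def)
  have d0: "d > 0" by (simp add: d_def add_pos_nonneg)
  have g1: "(1 + z) powr \<bar>m\<bar> * exp (- k * z\<^sup>2) \<le> G * (1 + z) powr (-d)" if "z \<ge> 0" for z
  proof -
    have "(1 + z) powr (\<bar>m\<bar> + d) * exp (- k * z\<^sup>2) \<le> G"
      unfolding G_def by (rule powr_mult_gauss_le) (use k that in auto)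
    then have "(1 + z) powr \<bar>m\<bar> * exp (- k * z\<^sup>2) * (1 + z) powr d \<le> G"
      by (simp add: powr_add mult_ac)
    then show ?thesis using that by (simp add: powr_minus field_simps)
  qed
  have g2: "(1 + z) powr \<bar>m\<bar> * exp (- k * z\<^sup>2) \<le> G" if "z \<ge> 0" for z
  proof -
    have "G * (1 + z) powr (-d) \<le> G * 1" using that d0
      by (intro mult_left_mono) (auto simp: powr_minus inverse_le_1_iff ge_one_powr_ge_zero G_def)
    then show ?thesis using g1[OF that] by simp
  qed
  have tm: "2 powr \<bar>m\<bar> \<ge> (1::real)" "2 powr d \<ge> (1::real)" using d0 by (auto intro: ge_one_powr_ge_zero)
  have "1 * G \<le> (2 powr \<bar>m\<bar> * 2 powr d) * G"
    using tm mult_mono[OF tm] by (intro mult_right_mono) (auto simp: G_def)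
  then have GC: "G \<le> C" by (simp add: C_def)
  \<comment> \<open>The two exceptional points are excluded because \<open>0 powr e\<close> is 0
    even for \<open>e = 0\<close>, so \<open>w\<close> vanishes at the origin instead of being
    positive there.\<close>
  have pt: "norm y powr m * exp (- k * (norm (q + y))\<^sup>2)
      \<le> C * (1 + norm q) powr m * (w m0 y + w 0 (q + y))" if nz: "y \<noteq> 0" "q + y \<noteq> 0" for q y :: 'a
  proof -
    define z where "z = norm (q + y)"
    have z: "z > 0" using nz by (simp add: z_def)
    have w0: "w m0 y \<ge> 0" "w 0 (q + y) = (1 + z) powr (-d)" using nz by (auto simp: w_def z_def)
    show ?thesis
    proof (cases "m \<ge> 0")
      case True
      have "norm y \<le> (1 + norm q) * (1 + z)"
        using norm_add_peetre[of y q] by (simp add: z_def add.commute)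
      then have "norm y powr m \<le> ((1 + norm q) * (1 + z)) powr m" using True
        by (intro powr_mono2) auto
      then have "norm y powr m * exp (- k * z\<^sup>2) \<le> (1 + norm q) powr m * ((1 + z) powr \<bar>m\<bar> * exp (- k * z\<^sup>2))"
        using True z by (simp add: powr_mult mult_ac)
      also have "\<dots> \<le> (1 + norm q) powr m * (G * (1 + z) powr (-d))"
        using g1[of z] z by (intro mult_left_mono) auto
      also have "\<dots> \<le> C * (1 + norm q) powr m * (1 + z) powr (-d)"
        using mult_right_mono[OF GC, of "(1 + norm q) powr m * (1 + z) powr (-d)"] by (simp add: mult_ac)
      also have "\<dots> \<le> C * (1 + norm q) powr m * (w m0 y + w 0 (q + y))"
        using w0 C0 by (intro mult_left_mono) auto
      finally show ?thesis by (simp add: z_def)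
    next
      case False
      have "(1 + norm q) powr (-m) \<le> (1 + norm y) powr (-m) * (1 + z) powr (-m)"
        unfolding z_def using False by (intro one_plus_norm_powr_le) auto
      then have "1 \<le> (1 + norm q) powr m * ((1 + norm y) powr (-m) * (1 + z) powr (-m))"
        by (metis add_pos_nonneg mult_left_mono norm_ge_zero powr_ge_zero powr_add powr_zero_eq_one
             add.right_inverse less_irrefl zero_less_one)
      then have "norm y powr m * exp (- k * z\<^sup>2) * 1 \<le>
          norm y powr m * exp (- k * z\<^sup>2) * ((1 + norm q) powr m * ((1 + norm y) powr (-m) * (1 + z) powr (-m)))"
        by (intro mult_left_mono) auto
      also have "\<dots> = (1 + norm q) powr m * ((norm y powr m * (1 + norm y) powr (-m)) * ((1 + z) powr \<bar>m\<bar> * exp (- k * z\<^sup>2)))"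
        using False by (simp add: mult_ac)
      also have "\<dots> \<le> (1 + norm q) powr m * (C * (w m0 y + w 0 (q + y)))"
      proof (rule mult_left_mono)
        show "(norm y powr m * (1 + norm y) powr (-m)) * ((1 + z) powr \<bar>m\<bar> * exp (- k * z\<^sup>2)) \<le> C * (w m0 y + w 0 (q + y))"
        \<comment> \<open>Outside the unit ball |y|^m (1 + |y|)^(-m) is bounded and the Gaussian
          supplies the decay. Inside it the singular power is kept, and 2^d makes up for the factor
          (1 + |y|)^(-d) of \<open>w m0\<close>.\<close>
        proof (cases "norm y \<ge> 1")
          case True
          have "(1 + norm y) powr (-m) \<le> (2 * norm y) powr (-m)" using True False by (intro powr_mono2) auto
          also have "\<dots> = 2 powr \<bar>m\<bar> * norm y powr (-m)" using False by (simp add: powr_mult)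
          finally have "norm y powr m * (1 + norm y) powr (-m) \<le> norm y powr m * (2 powr \<bar>m\<bar> * norm y powr (-m))"
            by (intro mult_left_mono) auto
          also have "\<dots> = 2 powr \<bar>m\<bar>" using nz by (simp add: powr_minus field_simps)
          finally have f1: "norm y powr m * (1 + norm y) powr (-m) \<le> 2 powr \<bar>m\<bar>" .
          have "(norm y powr m * (1 + norm y) powr (-m)) * ((1 + z) powr \<bar>m\<bar> * exp (- k * z\<^sup>2))
             \<le> 2 powr \<bar>m\<bar> * (G * (1 + z) powr (-d))"
            by (rule mult_mono[OF f1 g1]) (use z in auto)
          also have "\<dots> \<le> (2 powr \<bar>m\<bar> * 2 powr d) * (G * (1 + z) powr (-d))"
            using tm by (intro mult_right_mono) (auto simp: G_def)
          also have "\<dots> = C * (1 + z) powr (-d)" by (simp add: C_def)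
          also have "\<dots> \<le> C * (w m0 y + w 0 (q + y))" using w0 C0 by (intro mult_left_mono) auto
          finally show ?thesis .
        next
          case y1: False
          have "(1 + norm y) powr (-m) \<le> 2 powr \<bar>m\<bar>" using y1 False by (auto intro: powr_mono2)
          moreover have "1 \<le> 2 powr d * (1 + norm y) powr (-d)"
          proof -
            have "2 powr (-d) \<le> (1 + norm y) powr (-d)" using y1 d0 
              by (intro powr_mono2') (auto intro: add_pos_nonneg)
            then show ?thesis by (simp add: powr_minus field_simps)
          qed
          ultimately have "(1 + norm y) powr (-m) * 1 \<le> 2 powr \<bar>m\<bar> * (2 powr d * (1 + norm y) powr (-d))"
            by (intro mult_mono) auto
          then have "norm y powr m * (1 + norm y) powr (-m) \<le> norm y powr m * (2 powr \<bar>m\<bar> * (2 powr d * (1 + norm y) powr (-d)))"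
            by (intro mult_left_mono) auto
          also have "\<dots> = (2 powr \<bar>m\<bar> * 2 powr d) * w m0 y" using False by (simp add: w_def m0_def)
          finally have f2: "norm y powr m * (1 + norm y) powr (-m) \<le> (2 powr \<bar>m\<bar> * 2 powr d) * w m0 y" .
          have "(norm y powr m * (1 + norm y) powr (-m)) * ((1 + z) powr \<bar>m\<bar> * exp (- k * z\<^sup>2))
              \<le> ((2 powr \<bar>m\<bar> * 2 powr d) * w m0 y) * G"
            by (rule mult_mono[OF f2 g2]) (use z w0 in auto)
          also have "\<dots> = C * w m0 y" by (simp add: C_def)
          also have "\<dots> \<le> C * (w m0 y + w 0 (q + y))" using w0 C0 by (intro mult_left_mono) auto
          finally show ?thesis .
        qed
      qed simp
      finally show ?thesis by (simp add: z_def mult_ac)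
    qed
  qed
  have "(\<integral>\<^sup>+y. ennreal (norm y powr m * exp (- k * (norm (q + y))\<^sup>2)) \<partial>lborel)
           \<le> ennreal ((C * (I + 1)) * (1 + norm q) powr m)" for q :: 'a
  proof -
    have "(\<integral>\<^sup>+y. ennreal (norm y powr m * exp (- k * (norm (q + y))\<^sup>2)) \<partial>lborel)
      \<le> (\<integral>\<^sup>+y. ennreal (C * (1 + norm q) powr m) * (ennreal (w m0 y) + ennreal (w 0 (q + y))) \<partial>lborel)"
    proof (rule nn_integral_mono_AE)
      show "AE y in lborel. ennreal (norm y powr m * exp (- k * (norm (q + y))\<^sup>2))
         \<le> ennreal (C * (1 + norm q) powr m) * (ennreal (w m0 y) + ennreal (w 0 (q + y)))"
        using AE_lborel_singleton[of 0] AE_lborel_singleton[of "-q"]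
      proof eventually_elim
        case (elim y)
        then have "q + y \<noteq> 0" by (metis add.commute add_eq_0_iff)
        then show ?case using pt[of y q] elim C0
          by (subst ennreal_plus[symmetric], simp add: w_def, simp add: w_def, subst ennreal_mult[symmetric])
             (auto simp: w_def intro!: ennreal_leI)
      qed
    qed
    also have "\<dots> = ennreal (C * (1 + norm q) powr m) * ennreal I"
      using nn_integral_lborel_translate[of "\<lambda>y. ennreal (w 0 y)" q]
      by (simp add: nn_integral_cmult nn_integral_add I[symmetric])
    also have "\<dots> \<le> ennreal ((C * (I + 1)) * (1 + norm q) powr m)"
      using C0 I0 by (subst ennreal_mult[symmetric]) (auto intro!: ennreal_leI simp: algebra_simps)
    finally show ?thesis .
  qed
  then show ?thesis using C0 I0 by (intro exI[of _ "C * (I + 1)"]) auto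
qed

section \<open>Averages over the azimuthal angle\<close>

text \<open>The shifted interval is cut at 0 and its left piece is moved by one period. The two
  pieces then miss only the single point 2 pi - s.\<close>

lemma nn_integral_periodic_shift:
  fixes h :: "real \<Rightarrow> ennreal"
  assumes [measurable]: "h \<in> borel_measurable borel" and per: "\<And>t. h (t + 2 * pi) = h t"
    and s: "0 \<le> s" "s < 2 * pi"
  shows "(\<integral>\<^sup>+t\<in>{0<..<2*pi}. h (t - s) \<partial>lborel) = (\<integral>\<^sup>+t\<in>{0<..<2*pi}. h t \<partial>lborel)"
proof -
  have "(\<integral>\<^sup>+t. h (t - s) * indicator {0<..<2*pi} t \<partial>lborel) =
      (\<integral>\<^sup>+t. h t * indicator {-s<..<2*pi-s} t \<partial>lborel)"
    using nn_integral_lborel_translate[of "\<lambda>t. h t * indicator {-s<..<2*pi-s} t" "-s"]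
    by (auto simp: indicator_def intro!: nn_integral_cong elim!: trans[rotated])
  also have "\<dots> = (\<integral>\<^sup>+t. h t * indicator {-s<..<0} t + h t * indicator {0<..<2*pi-s} t \<partial>lborel)"
    using AE_lborel_singleton[of "0::real"] s
    by (intro nn_integral_cong_AE) (auto elim!: eventually_mono simp: indicator_def)
  also have "\<dots> = (\<integral>\<^sup>+t. h t * indicator {-s<..<0} t \<partial>lborel) + (\<integral>\<^sup>+t. h t * indicator {0<..<2*pi-s} t \<partial>lborel)"
    by (simp add: nn_integral_add)
  also have "(\<integral>\<^sup>+t. h t * indicator {-s<..<0} t \<partial>lborel) = (\<integral>\<^sup>+t. h t * indicator {2*pi-s<..<2*pi} t \<partial>lborel)"
    using nn_integral_lborel_translate[of "\<lambda>t. h t * indicator {2*pi-s<..<2*pi} t" "2*pi"] per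
    by (auto simp: indicator_def add.commute intro!: nn_integral_cong elim!: trans[rotated])
  also have "\<dots> + (\<integral>\<^sup>+t. h t * indicator {0<..<2*pi-s} t \<partial>lborel) =
      (\<integral>\<^sup>+t. h t * indicator {2*pi-s<..<2*pi} t + h t * indicator {0<..<2*pi-s} t \<partial>lborel)"
    by (simp add: nn_integral_add)
  also have "\<dots> = (\<integral>\<^sup>+t. h t * indicator {0<..<2*pi} t \<partial>lborel)"
    using AE_lborel_singleton[of "2*pi-s"] s
    by (intro nn_integral_cong_AE) (auto elim!: eventually_mono simp: indicator_def)
  finally show ?thesis .
qed

text \<open>In amplitude-phase form the combination is r cos (t - s), and an integral over a full
  period does not see the phase \<open>s\<close>.\<close>

lemma nn_integral_cos_sin_combination:
  fixes g :: "real \<Rightarrow> ennreal"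
  assumes [measurable]: "g \<in> borel_measurable borel"
  shows "(\<integral>\<^sup>+t\<in>{0<..<2*pi}. g (A * cos t + B * sin t) \<partial>lborel) =
         (\<integral>\<^sup>+t\<in>{0<..<2*pi}. g (sqrt (A\<^sup>2 + B\<^sup>2) * cos t) \<partial>lborel)"
proof -
  define r where "r = sqrt (A\<^sup>2 + B\<^sup>2)"
  obtain s where s: "0 \<le> s" "s < 2 * pi" "A = r * cos s" "B = r * sin s"
  proof (cases "r = 0")
    case True
    then show ?thesis using that[of 0] by (auto simp: r_def sum_power2_eq_zero_iff)
  next
    case False
    have r2: "r\<^sup>2 = A\<^sup>2 + B\<^sup>2" by (simp add: r_def)
    have "(A / r)\<^sup>2 + (B / r)\<^sup>2 = r\<^sup>2 / r\<^sup>2"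
      unfolding power_divide add_divide_distrib[symmetric] r2 ..
    also have "\<dots> = 1" using False by simp
    finally have "(A / r)\<^sup>2 + (B / r)\<^sup>2 = 1" .
    then obtain s where "0 \<le> s" "s < 2 * pi" "A / r = cos s" "B / r = sin s"
      by (rule sincos_total_2pi)
    then show ?thesis using that[of s] False by (metis nonzero_mult_div_cancel_left times_divide_eq_right)
  qed
  have eq: "A * cos t + B * sin t = r * cos (t - s)" for t
    unfolding s(3,4) cos_diff by (simp add: algebra_simps)
  show ?thesis
    unfolding eq r_def[symmetric]
    by (rule nn_integral_periodic_shift[OF _ _ s(1,2)]) simp_all
qed

section \<open>Deflection vectors in a collision frame\<close>

text \<open>Three orthonormal vectors span the space, so the residual \<open>w\<close>, being
  orthogonal to all of them, is orthogonal to itself. This expresses the length of the part of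
  \<open>p\<close> orthogonal to \<open>u\<close> without the frame.\<close>

lemma orthonormal_parseval_R3:
  fixes a b c p :: R3
  assumes "norm a = 1" "norm b = 1" "norm c = 1" "a \<bullet> b = 0" "a \<bullet> c = 0" "b \<bullet> c = 0"
  shows "(p \<bullet> a)\<^sup>2 + (p \<bullet> b)\<^sup>2 + (p \<bullet> c)\<^sup>2 = (norm p)\<^sup>2"
proof -
  have n: "a \<bullet> a = 1" "b \<bullet> b = 1" "c \<bullet> c = 1" using assms by (auto simp: norm_eq_1)
  have sym: "b \<bullet> a = 0" "c \<bullet> a = 0" "c \<bullet> b = 0" using assms by (auto simp: inner_commute)
  have ne: "a \<noteq> b" "a \<noteq> c" "b \<noteq> c" using assms n by auto
  define B where "B = {a, b, c}"
  have ind: "independent B"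
    using assms n by (intro pairwise_orthogonal_independent) (auto simp: B_def pairwise_def orthogonal_def sym)
  have "card B = 3" using ne by (simp add: B_def)
  then have sp: "span B = UNIV"
    using ind card_ge_dim_independent[of B UNIV] by (auto simp: dim_UNIV)
  define w where "w = p - ((p \<bullet> a) *\<^sub>R a + (p \<bullet> b) *\<^sub>R b + (p \<bullet> c) *\<^sub>R c)"
  have "orthogonal w y" if "y \<in> B" for y
    using that n assms sym by (auto simp: B_def w_def orthogonal_def inner_diff_left inner_add_left)
  then have "orthogonal w w" using orthogonal_to_span[of w B w] sp by auto
  then have "w = 0" by (simp add: orthogonal_self)
  then have p: "p = (p \<bullet> a) *\<^sub>R a + (p \<bullet> b) *\<^sub>R b + (p \<bullet> c) *\<^sub>R c" by (simp add: w_def)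
  have "(norm p)\<^sup>2 = p \<bullet> p" by (simp add: power2_norm_eq_inner)
  also have "\<dots> = p \<bullet> ((p \<bullet> a) *\<^sub>R a + (p \<bullet> b) *\<^sub>R b + (p \<bullet> c) *\<^sub>R c)" using p by simp
  also have "\<dots> = (p \<bullet> a)\<^sup>2 + (p \<bullet> b)\<^sup>2 + (p \<bullet> c)\<^sup>2"
    by (simp only: inner_add_right inner_scaleR_right power2_eq_square)
  finally show ?thesis by simp
qed

text \<open>With \<open>(l, m) = (cos \<theta>, sin \<theta>)\<close> this is \<open>(u \<bullet> \<omega>) \<omega> = v' - v\<close>; with \<open>(l, m) = (sin \<theta>, - cos \<theta>)\<close> it is the
  complementary part \<open>v\<^sub>*' - v\<close>. Both roles are needed, since the gain term has to be bounded in either argument.\<close>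

definition frame_dir :: "(R3 \<Rightarrow> R3) \<Rightarrow> (R3 \<Rightarrow> R3) \<Rightarrow> real \<Rightarrow> real \<Rightarrow> R3 \<Rightarrow> real \<Rightarrow> R3" where
  "frame_dir e2 e3 l m u \<phi> =
     (l * l) *\<^sub>R u + (l * m * norm u) *\<^sub>R (cos \<phi> *\<^sub>R e2 u + sin \<phi> *\<^sub>R e3 u)"

lemma frame_dir_measurable:
  assumes "collision_frame e2 e3" and [measurable]: "f \<in> borel_measurable M" "g \<in> borel_measurable M"
  shows "(\<lambda>x. frame_dir e2 e3 l m (f x) (g x)) \<in> borel_measurable M"
proof -
  have [measurable]: "e2 \<in> borel_measurable borel" "e3 \<in> borel_measurable borel"
    using assms by (auto simp: collision_frame_def)
  show ?thesis unfolding frame_dir_def by measurable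
qed

lemma collision_frameD:
  assumes "collision_frame e2 e3" "u \<noteq> 0"
  shows "norm (e2 u) = 1" "norm (e3 u) = 1" "u \<bullet> e2 u = 0" "u \<bullet> e3 u = 0" "e2 u \<bullet> e3 u = 0"
    "e2 u \<bullet> e2 u = 1" "e3 u \<bullet> e3 u = 1"
  using assms by (auto simp: collision_frame_def norm_eq_1[symmetric])

text \<open>The components along and across \<open>u\<close> have lengths l^2 |u| and |l m| |u|;
  their squares add up to l^2 |u|^2 (l^2 + m^2).\<close>

lemma norm_frame_dir:
  assumes fr: "collision_frame e2 e3" and lm: "l\<^sup>2 + m\<^sup>2 = 1"
  shows "norm (frame_dir e2 e3 l m u \<phi>) = \<bar>l\<bar> * norm u"
proof (cases "u = 0")
  case False
  note f = collision_frameD[OF fr False]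
  have f': "e2 u \<bullet> u = 0" "e3 u \<bullet> u = 0" "e3 u \<bullet> e2 u = 0"
    using f by (simp_all add: inner_commute)
  have "(norm (frame_dir e2 e3 l m u \<phi>))\<^sup>2 =
      (l*l)\<^sup>2 * (u \<bullet> u) + (l * m * norm u)\<^sup>2 * (cos \<phi> * cos \<phi>) + (l * m * norm u)\<^sup>2 * (sin \<phi> * sin \<phi>)"
    unfolding power2_norm_eq_inner frame_dir_def
    by (simp add: f f' inner_add_left inner_add_right power2_eq_square distrib_left mult_ac)
  also have "\<dots> = (l*l)\<^sup>2 * (norm u)\<^sup>2 + (l * m * norm u)\<^sup>2 * (cos \<phi> * cos \<phi> + sin \<phi> * sin \<phi>)"
    by (simp only: power2_norm_eq_inner distrib_left add.assoc)
  also have "\<dots> = l\<^sup>2 * (norm u)\<^sup>2 * (l\<^sup>2 + m\<^sup>2)"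
    unfolding sin_cos_squared_add3 by (simp add: power2_eq_square algebra_simps)
  also have "\<dots> = (\<bar>l\<bar> * norm u)\<^sup>2" using lm by (simp add: power_mult_distrib)
  finally show ?thesis by (rule power2_eq_imp_eq) auto
qed (simp add: frame_dir_def)

lemma norm_add_frame_dir_sq:
  assumes fr: "collision_frame e2 e3" and lm: "l\<^sup>2 + m\<^sup>2 = 1"
  shows "(norm (p + frame_dir e2 e3 l m u \<phi>))\<^sup>2 = (norm p)\<^sup>2 + l\<^sup>2 * (norm u)\<^sup>2
     + 2 * (l\<^sup>2 * (u \<bullet> p) + l * m * norm u * ((e2 u \<bullet> p) * cos \<phi> + (e3 u \<bullet> p) * sin \<phi>))"
proof -
  have "(norm (p + frame_dir e2 e3 l m u \<phi>))\<^sup>2 =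
     (norm p)\<^sup>2 + (norm (frame_dir e2 e3 l m u \<phi>))\<^sup>2 + 2 * (p \<bullet> frame_dir e2 e3 l m u \<phi>)"
    by (simp add: power2_norm_eq_inner inner_add_left inner_add_right inner_commute)
  then show ?thesis unfolding norm_frame_dir[OF fr lm]
    by (simp add: frame_dir_def inner_add_right inner_commute power2_eq_square algebra_simps)
qed

text \<open>The expanded square depends on \<phi> only through a combination of cos \<phi> and sin
  \<phi>. Its average therefore sees only the amplitude, and Parseval turns this amplitude into an
  expression in |u|, |p| and \<open>u \<bullet> p\<close>. The right-hand side no longer mentions
  the frame.\<close>

lemma frame_angle_integral:
  assumes fr: "collision_frame e2 e3" and lm: "l\<^sup>2 + m\<^sup>2 = 1" and u: "u \<noteq> 0"
  shows "(\<integral>\<^sup>+\<phi>\<in>{0<..<2*pi}. ennreal (exp (- k * (norm (p + frame_dir e2 e3 l m u \<phi>))\<^sup>2)) \<partial>lborel) =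
    (\<integral>\<^sup>+\<phi>\<in>{0<..<2*pi}. ennreal (exp (- k * ((norm p)\<^sup>2 + l\<^sup>2 * (norm u)\<^sup>2
     + 2 * (l\<^sup>2 * (u \<bullet> p) + l * m * (sqrt ((norm u)\<^sup>2 * (norm p)\<^sup>2 - (u \<bullet> p)\<^sup>2) * cos \<phi>))))) \<partial>lborel)"
proof -
  note f = collision_frameD[OF fr u]
  define g where "g = (\<lambda>y. ennreal (exp (- k * ((norm p)\<^sup>2 + l\<^sup>2 * (norm u)\<^sup>2
     + 2 * (l\<^sup>2 * (u \<bullet> p) + l * m * (norm u * y))))))"
  have [measurable]: "g \<in> borel_measurable borel" unfolding g_def by measurable
  have "(p \<bullet> (u /\<^sub>R norm u))\<^sup>2 + (p \<bullet> e2 u)\<^sup>2 + (p \<bullet> e3 u)\<^sup>2 = (norm p)\<^sup>2"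
    by (rule orthonormal_parseval_R3) (use u f in auto)
  then have "(e2 u \<bullet> p)\<^sup>2 + (e3 u \<bullet> p)\<^sup>2 = (norm p)\<^sup>2 - (p \<bullet> (u /\<^sub>R norm u))\<^sup>2"
    unfolding inner_commute[of p "e2 u"] inner_commute[of p "e3 u"] by linarith
  then have "(norm u)\<^sup>2 * ((e2 u \<bullet> p)\<^sup>2 + (e3 u \<bullet> p)\<^sup>2) = (norm u)\<^sup>2 * (norm p)\<^sup>2 - (norm u)\<^sup>2 * (p \<bullet> (u /\<^sub>R norm u))\<^sup>2"
    by (simp only: right_diff_distrib)
  also have "(norm u)\<^sup>2 * (p \<bullet> (u /\<^sub>R norm u))\<^sup>2 = (u \<bullet> p)\<^sup>2"
    using u unfolding inner_commute[of p] by (simp add: power_mult_distrib power_inverse)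
  finally have "sqrt ((norm u)\<^sup>2 * ((e2 u \<bullet> p)\<^sup>2 + (e3 u \<bullet> p)\<^sup>2)) = sqrt ((norm u)\<^sup>2 * (norm p)\<^sup>2 - (u \<bullet> p)\<^sup>2)"
    by simp
  then have r: "norm u * sqrt ((e2 u \<bullet> p)\<^sup>2 + (e3 u \<bullet> p)\<^sup>2) = sqrt ((norm u)\<^sup>2 * (norm p)\<^sup>2 - (u \<bullet> p)\<^sup>2)"
    by (simp add: real_sqrt_mult)
  have "(\<integral>\<^sup>+\<phi>\<in>{0<..<2*pi}. ennreal (exp (- k * (norm (p + frame_dir e2 e3 l m u \<phi>))\<^sup>2)) \<partial>lborel) =
     (\<integral>\<^sup>+\<phi>\<in>{0<..<2*pi}. g ((e2 u \<bullet> p) * cos \<phi> + (e3 u \<bullet> p) * sin \<phi>) \<partial>lborel)"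
    unfolding g_def norm_add_frame_dir_sq[OF fr lm] by (simp add: mult.assoc)
  also have "\<dots> = (\<integral>\<^sup>+\<phi>\<in>{0<..<2*pi}. g (sqrt ((e2 u \<bullet> p)\<^sup>2 + (e3 u \<bullet> p)\<^sup>2) * cos \<phi>) \<partial>lborel)"
    by (rule nn_integral_cos_sin_combination) simp
  also have "\<dots> = (\<integral>\<^sup>+\<phi>\<in>{0<..<2*pi}. ennreal (exp (- k * ((norm p)\<^sup>2 + l\<^sup>2 * (norm u)\<^sup>2
     + 2 * (l\<^sup>2 * (u \<bullet> p) + l * m * (sqrt ((norm u)\<^sup>2 * (norm p)\<^sup>2 - (u \<bullet> p)\<^sup>2) * cos \<phi>))))) \<partial>lborel)"
    unfolding g_def r[symmetric] by (simp add: mult.assoc)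
  finally show ?thesis .
qed

section \<open>Gaussian integrals over all deflections\<close>

text \<open>The model integral behind the gain bounds. The exponent \<open>e\<close> stays free
  because it is used both with \<gamma> and with min \<gamma> (-2); \<open>k\<close> stays free
  because it is halved in the comparison of nearby points.\<close>

definition frame_gauss :: "(R3 \<Rightarrow> R3) \<Rightarrow> (R3 \<Rightarrow> R3) \<Rightarrow> real \<Rightarrow> real \<Rightarrow> real \<Rightarrow> real \<Rightarrow> R3 \<Rightarrow> ennreal" where
  "frame_gauss e2 e3 l m e k p = (\<integral>\<^sup>+u. ennreal (norm u powr e) *
     (\<integral>\<^sup>+\<phi>\<in>{0<..<2*pi}. ennreal (exp (- k * (norm (p + frame_dir e2 e3 l m u \<phi>))\<^sup>2)) \<partial>lborel) \<partial>lborel)"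

text \<open>The frame itself does not commute with \<open>T\<close>. After the \<phi>-integration,
  however, the integrand \<Psi> depends only on |p|, |u| and \<open>u \<bullet> p\<close>, hence is
  invariant under a joint rotation of \<open>p\<close> and \<open>u\<close>, and the rotation of
  \<open>u\<close> is then undone by substitution. The point u = 0, where the frame is unspecified,
  is null.\<close>

lemma frame_gauss_orthogonal:
  assumes fr: "collision_frame e2 e3" and lm: "l\<^sup>2 + m\<^sup>2 = 1" and T: "orthogonal_transformation T"
  shows "frame_gauss e2 e3 l m e k (T p) = frame_gauss e2 e3 l m e k p"
proof -
  define \<Psi> where "\<Psi> = (\<lambda>(p::R3) (u::R3). ennreal (norm u powr e) * (\<integral>\<^sup>+\<phi>\<in>{0<..<2*pi}. ennreal (exp (- k * ((norm p)\<^sup>2 + l\<^sup>2 * (norm u)\<^sup>2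
     + 2 * (l\<^sup>2 * (u \<bullet> p) + l * m * (sqrt ((norm u)\<^sup>2 * (norm p)\<^sup>2 - (u \<bullet> p)\<^sup>2) * cos \<phi>))))) \<partial>lborel))"
  have [measurable]: "\<Psi> p \<in> borel_measurable borel" for p :: R3
    unfolding \<Psi>_def by measurable
  have eq: "frame_gauss e2 e3 l m e k p = (\<integral>\<^sup>+u. \<Psi> p u \<partial>lborel)" for p
    unfolding frame_gauss_def \<Psi>_def
    by (rule nn_integral_cong_AE, use AE_lborel_singleton[of 0] in eventually_elim)
       (subst frame_angle_integral[OF fr lm], assumption, rule refl)
  have "\<Psi> (T p) (T u) = \<Psi> p u" for u
    using T unfolding \<Psi>_def by (simp add: orthogonal_transformation_def orthogonal_transformation_norm)
  then have "(\<integral>\<^sup>+u. \<Psi> p u \<partial>lborel) = (\<integral>\<^sup>+u. \<Psi> (T p) (T u) \<partial>lborel)" by simp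
  also have "\<dots> = (\<integral>\<^sup>+u. \<Psi> (T p) u \<partial>lborel)"
    by (rule nn_integral_lborel_orthogonal[OF T]) simp
  finally show ?thesis by (simp add: eq)
qed

text \<open>A Harnack inequality; together with rotation invariance it compares \<open>frame_gauss\<close> at \<open>p\<close> with its values on a whole shell.\<close>

lemma frame_gauss_harnack:
  assumes fr: "collision_frame e2 e3" and k: "k > 0" and pq: "norm (p - q) \<le> 1"
  shows "frame_gauss e2 e3 l m e k p \<le> ennreal (exp k) * frame_gauss e2 e3 l m e (k / 2) q"
proof -
  note [measurable] = frame_dir_measurable[OF fr]
  \<comment> \<open>From |q + c|^2 \<le> 2 |p + c|^2 + 2: halving \<open>k\<close> pays for the
    factor 2, and the additive 2 leaves exp k.\<close>
  have pt: "exp (- k * (norm (p + c))\<^sup>2) \<le> exp k * exp (- (k/2) * (norm (q + c))\<^sup>2)" for c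
  proof -
    have "norm (q + c) \<le> norm (p + c) + 1"
      using norm_triangle_ineq4[of "p + c" "p - q"] pq by (simp add: add.commute)
    then have "(norm (q + c))\<^sup>2 \<le> (norm (p + c) + 1)\<^sup>2" by (intro power_mono) auto
    also have "\<dots> \<le> 2 * (norm (p + c))\<^sup>2 + 2"
      using sum_squares_ge_zero[of "norm (p + c) - 1" 0] by (simp add: power2_eq_square algebra_simps)
    finally have "k * (norm (q + c))\<^sup>2 \<le> k * (2 * (norm (p + c))\<^sup>2 + 2)" using k by (intro mult_left_mono) auto
    then show ?thesis by (simp add: algebra_simps flip: exp_add)
  qed
  have "frame_gauss e2 e3 l m e k p \<le> (\<integral>\<^sup>+u. ennreal (exp k) * (ennreal (norm u powr e) *
     (\<integral>\<^sup>+\<phi>\<in>{0<..<2*pi}. ennreal (exp (- (k/2) * (norm (q + frame_dir e2 e3 l m u \<phi>))\<^sup>2)) \<partial>lborel)) \<partial>lborel)"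
    unfolding frame_gauss_def
  proof (rule nn_integral_mono)
    fix u
    have "(\<integral>\<^sup>+\<phi>\<in>{0<..<2*pi}. ennreal (exp (- k * (norm (p + frame_dir e2 e3 l m u \<phi>))\<^sup>2)) \<partial>lborel)
      \<le> (\<integral>\<^sup>+\<phi>. ennreal (exp k) * (ennreal (exp (- (k/2) * (norm (q + frame_dir e2 e3 l m u \<phi>))\<^sup>2)) * indicator {0<..<2*pi} \<phi>) \<partial>lborel)"
      using pt by (intro nn_integral_mono) (auto simp: indicator_def ennreal_mult[symmetric] intro!: ennreal_leI)
    also have "\<dots> = ennreal (exp k) * (\<integral>\<^sup>+\<phi>\<in>{0<..<2*pi}. ennreal (exp (- (k/2) * (norm (q + frame_dir e2 e3 l m u \<phi>))\<^sup>2)) \<partial>lborel)"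
      by (subst nn_integral_cmult) auto
    finally show "ennreal (norm u powr e) * (\<integral>\<^sup>+\<phi>\<in>{0<..<2*pi}. ennreal (exp (- k * (norm (p + frame_dir e2 e3 l m u \<phi>))\<^sup>2)) \<partial>lborel)
      \<le> ennreal (exp k) * (ennreal (norm u powr e) * (\<integral>\<^sup>+\<phi>\<in>{0<..<2*pi}. ennreal (exp (- (k/2) * (norm (q + frame_dir e2 e3 l m u \<phi>))\<^sup>2)) \<partial>lborel))"
      by (subst mult.left_commute) (rule mult_left_mono, auto)
  qed
  also have "\<dots> = ennreal (exp k) * frame_gauss e2 e3 l m e (k / 2) q"
    unfolding frame_gauss_def by (subst nn_integral_cmult) auto
  finally show ?thesis .
qed

text \<open>An orthogonal map taking \<open>d\<close> to \<open>c\<close> preserves |q|. Hence,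
  under an integral over a radial set of \<open>q\<close>, only the length of the shift
  matters.\<close>

lemma orthogonal_shell_integral:
  fixes c d :: R3
  assumes n: "norm c = norm d" and [measurable]: "g \<in> borel_measurable borel" "A \<in> sets borel"
  shows "(\<integral>\<^sup>+q. indicator A (norm q) * g (norm (q + c)) \<partial>lborel) = (\<integral>\<^sup>+q. indicator A (norm q) * g (norm (q + d)) \<partial>lborel)"
proof -
  obtain T where T: "orthogonal_transformation T" "T d = c"
    using orthogonal_transformation_exists[of d c] n by metis
  have "norm (T q + c) = norm (q + d)" for q
    using T orthogonal_transformation_norm[OF T(1), of "q + d"]
    by (metis linear_add orthogonal_transformation_linear)
  then show ?thesis
    using nn_integral_lborel_orthogonal[OF T(1), of "\<lambda>q. indicator A (norm q) * g (norm (q + c))"]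
      orthogonal_transformation_norm[OF T(1)] by simp
qed

text \<open>Tonelli brings the \<open>q\<close>-integral inside. For fixed \<open>u\<close> and
  \<phi> the deflection has length l |u|, so it may be replaced by \<open>l *\<^sub>R u\<close>.
  Nothing then depends on \<phi>, and its range contributes 2 pi.\<close>

lemma frame_gauss_shell:
  assumes fr: "collision_frame e2 e3" and lm: "l\<^sup>2 + m\<^sup>2 = 1" and l: "l > 0" and A [measurable]: "A \<in> sets borel"
  shows "(\<integral>\<^sup>+q. indicator A (norm q) * frame_gauss e2 e3 l m e k q \<partial>lborel) = ennreal (2 * pi) *
     (\<integral>\<^sup>+q. indicator A (norm q) * (\<integral>\<^sup>+u. ennreal (norm u powr e * exp (- k * (norm ((q::R3) + l *\<^sub>R u))\<^sup>2)) \<partial>lborel) \<partial>lborel)"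
proof -
  note [measurable] = frame_dir_measurable[OF fr]
  define w where "w = (\<lambda>u::R3. ennreal (norm u powr e))"
  define g where "g = (\<lambda>r. ennreal (exp (- k * r\<^sup>2)))"
  have [measurable]: "w \<in> borel_measurable borel" "g \<in> borel_measurable borel"
    unfolding w_def g_def by measurable
  define V where "V = (\<lambda>u::R3. (\<integral>\<^sup>+q. indicator A (norm (q::R3)) * g (norm ((q::R3) + l *\<^sub>R u)) \<partial>lborel))"
  have [measurable]: "V \<in> borel_measurable borel" unfolding V_def by measurable
  have "(\<integral>\<^sup>+q. indicator A (norm q) * frame_gauss e2 e3 l m e k q \<partial>lborel) =
     (\<integral>\<^sup>+q. \<integral>\<^sup>+u. \<integral>\<^sup>+\<phi>. w u * indicator {0<..<2*pi} \<phi> * (indicator A (norm q) * g (norm (q + frame_dir e2 e3 l m u \<phi>))) \<partial>lborel \<partial>lborel \<partial>lborel)"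
  proof (rule nn_integral_cong)
    fix q :: R3
    have "indicator A (norm q) * frame_gauss e2 e3 l m e k q =
        (\<integral>\<^sup>+u. indicator A (norm q) * (w u * (\<integral>\<^sup>+\<phi>. g (norm (q + frame_dir e2 e3 l m u \<phi>)) * indicator {0<..<2*pi} \<phi> \<partial>lborel)) \<partial>lborel)"
      by (subst nn_integral_cmult) (simp_all add: frame_gauss_def w_def g_def)
    also have "\<dots> = (\<integral>\<^sup>+u. \<integral>\<^sup>+\<phi>. w u * indicator {0<..<2*pi} \<phi> * (indicator A (norm q) * g (norm (q + frame_dir e2 e3 l m u \<phi>))) \<partial>lborel \<partial>lborel)"
      by (intro nn_integral_cong, (subst nn_integral_cmult[symmetric], measurable)+)
         (auto intro!: nn_integral_cong simp: mult_ac)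
    finally show "indicator A (norm q) * frame_gauss e2 e3 l m e k q = \<dots>" .
  qed
  also have "\<dots> = (\<integral>\<^sup>+u. \<integral>\<^sup>+q. \<integral>\<^sup>+\<phi>. w u * indicator {0<..<2*pi} \<phi> * (indicator A (norm q) * g (norm (q + frame_dir e2 e3 l m u \<phi>))) \<partial>lborel \<partial>lborel \<partial>lborel)"
    by (rule lborel_pair.Fubini'[symmetric]) measurable
  also have "\<dots> = (\<integral>\<^sup>+u. \<integral>\<^sup>+\<phi>. \<integral>\<^sup>+q. w u * indicator {0<..<2*pi} \<phi> * (indicator A (norm q) * g (norm (q + frame_dir e2 e3 l m u \<phi>))) \<partial>lborel \<partial>lborel \<partial>lborel)"
    by (intro nn_integral_cong lborel_pair.Fubini'[symmetric]) measurable
  also have "\<dots> = (\<integral>\<^sup>+u. \<integral>\<^sup>+\<phi>. w u * indicator {0<..<2*pi} \<phi> * V u \<partial>lborel \<partial>lborel)"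
  proof (intro nn_integral_cong)
    fix u :: R3 and \<phi> :: real
    have "(\<integral>\<^sup>+q. indicator A (norm q) * g (norm (q + frame_dir e2 e3 l m u \<phi>)) \<partial>lborel) = V u"
      unfolding V_def using l by (intro orthogonal_shell_integral) (simp_all add: norm_frame_dir[OF fr lm])
    then show "(\<integral>\<^sup>+q. w u * indicator {0<..<2*pi} \<phi> * (indicator A (norm q) * g (norm (q + frame_dir e2 e3 l m u \<phi>))) \<partial>lborel)
      = w u * indicator {0<..<2*pi} \<phi> * V u"
      by (subst nn_integral_cmult) simp_all
  qed
  also have "\<dots> = (\<integral>\<^sup>+u. ennreal (2 * pi) * (w u * V u) \<partial>lborel)"
  proof (rule nn_integral_cong)
    fix u
    have "(\<integral>\<^sup>+\<phi>. w u * indicator {0<..<2*pi} \<phi> * V u \<partial>lborel) = (\<integral>\<^sup>+\<phi>. (w u * V u) * indicator {0<..<2*pi} \<phi> \<partial>lborel)"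
      by (simp add: mult_ac)
    also have "\<dots> = ennreal (2 * pi) * (w u * V u)"
      by (subst nn_integral_cmult_indicator) (simp_all add: mult.commute)
    finally show "(\<integral>\<^sup>+\<phi>. w u * indicator {0<..<2*pi} \<phi> * V u \<partial>lborel) = \<dots>" .
  qed
  also have "\<dots> = ennreal (2 * pi) * (\<integral>\<^sup>+u. w u * V u \<partial>lborel)"
    by (rule nn_integral_cmult) measurable
  also have "(\<integral>\<^sup>+u. w u * V u \<partial>lborel) = (\<integral>\<^sup>+u. \<integral>\<^sup>+q. indicator A (norm q) * (w u * g (norm ((q::R3) + l *\<^sub>R u))) \<partial>lborel \<partial>lborel)"
    unfolding V_def
    by (intro nn_integral_cong, subst nn_integral_cmult[symmetric], measurable)
       (auto intro!: nn_integral_cong simp: mult_ac)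
  also have "\<dots> = (\<integral>\<^sup>+q. \<integral>\<^sup>+u. indicator A (norm q) * (w u * g (norm ((q::R3) + l *\<^sub>R u))) \<partial>lborel \<partial>lborel)"
    by (rule lborel_pair.Fubini') measurable
  also have "\<dots> = (\<integral>\<^sup>+q. indicator A (norm q) * (\<integral>\<^sup>+u. ennreal (norm u powr e * exp (- k * (norm ((q::R3) + l *\<^sub>R u))\<^sup>2)) \<partial>lborel) \<partial>lborel)"
  proof (rule nn_integral_cong)
    fix q :: R3
    have "(\<integral>\<^sup>+u. indicator A (norm q) * (w u * g (norm (q + l *\<^sub>R u))) \<partial>lborel) =
        indicator A (norm q) * (\<integral>\<^sup>+u. w u * g (norm (q + l *\<^sub>R u)) \<partial>lborel)"
      by (rule nn_integral_cmult) measurable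
    then show "(\<integral>\<^sup>+u. indicator A (norm q) * (w u * g (norm (q + l *\<^sub>R u))) \<partial>lborel) =
        indicator A (norm q) * (\<integral>\<^sup>+u. ennreal (norm u powr e * exp (- k * (norm (q + l *\<^sub>R u))\<^sup>2)) \<partial>lborel)"
      by (simp add: w_def g_def ennreal_mult)
  qed
  finally show ?thesis .
qed

text \<open>The Jacobian contributes the dimension to the exponent of \<open>l\<close>, the
  homogeneous weight contributes \<open>e\<close>.\<close>

lemma nn_integral_powr_norm_scale:
  fixes g :: "'a::euclidean_space \<Rightarrow> real"
  assumes l: "l > 0" and [measurable]: "g \<in> borel_measurable borel" and g: "\<And>x. g x \<ge> 0"
  shows "ennreal (l powr (real DIM('a) + e)) * (\<integral>\<^sup>+u. ennreal (norm u powr e * g (l *\<^sub>R u)) \<partial>lborel)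
     = (\<integral>\<^sup>+u. ennreal (norm u powr e * g u) \<partial>lborel)"
proof -
  have "(\<integral>\<^sup>+u. ennreal (norm u powr e * g u) \<partial>lborel) = 
    ennreal (l ^ DIM('a)) * (\<integral>\<^sup>+u. ennreal (l powr e) * ennreal (norm u powr e * g (l *\<^sub>R u)) \<partial>lborel)"
    using l g by (subst nn_integral_lborel_scale[OF _ l, symmetric])
      (auto simp: powr_mult ennreal_mult[symmetric] mult_ac intro!: arg_cong2[where f="(*)"] nn_integral_cong)
  also have "\<dots> = (ennreal (l ^ DIM('a)) * ennreal (l powr e)) * (\<integral>\<^sup>+u. ennreal (norm u powr e * g (l *\<^sub>R u)) \<partial>lborel)"
    by (subst nn_integral_cmult) (auto simp: mult.assoc)
  also have "ennreal (l ^ DIM('a)) * ennreal (l powr e) = ennreal (l powr (real DIM('a) + e))"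
    using l by (simp add: ennreal_mult[symmetric] powr_add powr_realpow)
  finally show ?thesis by simp
qed

text \<open>The value at \<open>p\<close> is compared with the average over a shell of thickness 1,
  where the deflection becomes \<open>l *\<^sub>R u\<close>. The substitution y = l u uses up the
  factor l^(3 + e) and leaves the plain Gaussian integral, whose bound varies by at most 2^|e|
  across the shell. The constant collects exp k from the Harnack comparison, 2 pi from \<phi>, and
  this factor. It does not depend on \<open>l\<close>, \<open>m\<close> or the frame.\<close>

lemma frame_gauss_le:
  assumes e: "-3 < e" and k: "k > 0"
  shows "\<exists>C>0. \<forall>e2 e3 l m p. collision_frame e2 e3 \<longrightarrow> l > 0 \<longrightarrow> l\<^sup>2 + m\<^sup>2 = 1 \<longrightarrow>
    ennreal (l powr (3 + e)) * frame_gauss e2 e3 l m e k p \<le> ennreal (C * (1 + norm p) powr e)"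
proof -
  obtain C where C: "C > 0" and CN: "\<And>q::R3. (\<integral>\<^sup>+y. ennreal (norm y powr e * exp (- (k/2) * (norm (q + y))\<^sup>2)) \<partial>lborel)
           \<le> ennreal (C * (1 + norm q) powr e)"
    using nn_integral_powr_gauss_le[where 'a = R3, of e "k/2"] e k by auto
  define C' where "C' = exp k * (2 * pi) * (C * 2 powr \<bar>e\<bar>)"
  have "ennreal (l powr (3 + e)) * frame_gauss e2 e3 l m e k p \<le> ennreal (C' * (1 + norm p) powr e)"
    if fr: "collision_frame e2 e3" and l: "l > 0" and lm: "l\<^sup>2 + m\<^sup>2 = 1" for e2 e3 l m p
  proof -
    define R where "R = norm p"
    define A where "A = {R..R+1}"
    have [measurable]: "A \<in> sets borel" by (simp add: A_def)
    define S where "S = {q::R3. norm q \<in> A}"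
    have [measurable]: "S \<in> sets borel" unfolding S_def by measurable
    have indS: "indicator A (norm q) = (indicator S q :: ennreal)" for q by (simp add: indicator_def S_def)
    \<comment> \<open>The shell measure stands on both sides of the final estimate and is cancelled,
      so it has to be positive and finite; a ball of radius 1/2 centred in the middle of the shell
      gives positivity.\<close>
    have pos: "emeasure lborel S > 0"
    proof -
      define c where "c = (R + 1/2) *\<^sub>R (axis 1 1 :: R3)"
      have nc: "norm c = R + 1/2" by (simp add: c_def norm_axis_1 R_def)
      have "ball c (1/2) \<subseteq> S"
      proof
        fix x assume "x \<in> ball c (1/2)"
        then have "norm (c - x) < 1/2" by (simp add: dist_norm)
        then show "x \<in> S" using nc norm_triangle_ineq2[of c x] norm_triangle_ineq2[of x c]
          by (auto simp: S_def A_def norm_minus_commute)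
      qed
      then have "emeasure lborel (ball c (1/2)) \<le> emeasure lborel S" by (intro emeasure_mono) auto
      moreover have "emeasure lborel (ball c (1/2)) > 0"
        using content_ball_pos[of "1/2" c] by (auto simp: measure_def zero_less_iff_neq_zero)
      ultimately show ?thesis by (rule less_le_trans[rotated])
    qed
    have fin: "emeasure lborel S < \<infinity>"
    proof -
      have "emeasure lborel S \<le> emeasure lborel (cball (0::R3) (R+1))"
        by (intro emeasure_mono) (auto simp: S_def A_def)
      also have "\<dots> < \<infinity>" using emeasure_bounded_finite[of "cball (0::R3) (R+1)"] by simp
      finally show ?thesis .
    qed
    define fg where "fg = frame_gauss e2 e3 l m e k p"
    have le1: "fg \<le> ennreal (exp k) * frame_gauss e2 e3 l m e (k/2) q" if "q \<in> S" for q
    proof -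
      have q: "R \<le> norm q" "norm q \<le> R + 1" using that by (auto simp: S_def A_def)
      \<comment> \<open>The radial projection of \<open>q\<close> to the sphere through
        \<open>p\<close>. It is a rotated copy of \<open>p\<close> and lies within distance 1 of
        \<open>q\<close>. For q = 0 the shell condition forces R = 0.\<close>
      define p' where "p' = (if q = 0 then 0 else (R / norm q) *\<^sub>R q)"
      have np: "norm p' = norm p" using q by (auto simp: p'_def R_def)
      have "norm (p' - q) \<le> 1"
      proof (cases "q = 0")
        case False
        then have "p' - q = (R / norm q - 1) *\<^sub>R q" by (simp add: p'_def algebra_simps)
        then have "norm (p' - q) = \<bar>(R / norm q - 1) * norm q\<bar>" by (simp add: abs_mult)
        also have "(R / norm q - 1) * norm q = R - norm q" using False by (simp add: field_simps)
        finally show ?thesis using q by simp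
      qed (simp add: p'_def)
      moreover obtain T where "orthogonal_transformation T" "T p = p'"
        using orthogonal_transformation_exists[of p p'] np by metis
      ultimately show ?thesis
        using frame_gauss_harnack[OF fr k, of p' q l m e] frame_gauss_orthogonal[OF fr lm, of T e k p]
        by (simp add: fg_def)
    qed
    have [measurable]: "frame_gauss e2 e3 l m e k' \<in> borel_measurable borel" for k'
      unfolding frame_gauss_def using frame_dir_measurable[OF fr, measurable] by measurable
    have "emeasure lborel S * fg = (\<integral>\<^sup>+q. fg * indicator S q \<partial>lborel)"
      by (simp add: nn_integral_cmult_indicator mult.commute)
    also have "\<dots> \<le> (\<integral>\<^sup>+q. ennreal (exp k) * (indicator A (norm q) * frame_gauss e2 e3 l m e (k/2) q) \<partial>lborel)"
      using le1 by (intro nn_integral_mono) (simp add: indS split: split_indicator)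
    also have "\<dots> = ennreal (exp k) * (\<integral>\<^sup>+q. indicator A (norm q) * frame_gauss e2 e3 l m e (k/2) q \<partial>lborel)"
      by (rule nn_integral_cmult) measurable
    also have "\<dots> = ennreal (exp k) * (ennreal (2 * pi) *
     (\<integral>\<^sup>+q. indicator A (norm q) * (\<integral>\<^sup>+u. ennreal (norm u powr e * exp (- (k/2) * (norm ((q::R3) + l *\<^sub>R u))\<^sup>2)) \<partial>lborel) \<partial>lborel))"
      by (subst frame_gauss_shell[OF fr lm l]) simp_all
    finally have main: "emeasure lborel S * fg \<le> ennreal (exp k) * (ennreal (2 * pi) *
     (\<integral>\<^sup>+q. indicator A (norm q) * (\<integral>\<^sup>+u. ennreal (norm u powr e * exp (- (k/2) * (norm ((q::R3) + l *\<^sub>R u))\<^sup>2)) \<partial>lborel) \<partial>lborel))" .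
    \<comment> \<open>The scaling factor is carried as a multiplier until it meets the inner
      integral, so that no division in \<open>ennreal\<close> occurs.\<close>
    define L where "L = ennreal (l powr (3 + e))"
    have "emeasure lborel S * (L * fg) \<le> ennreal (exp k) * (ennreal (2 * pi) *
     (\<integral>\<^sup>+q. indicator A (norm q) * (L * (\<integral>\<^sup>+u. ennreal (norm u powr e * exp (- (k/2) * (norm ((q::R3) + l *\<^sub>R u))\<^sup>2)) \<partial>lborel)) \<partial>lborel))"
      (is "_ \<le> ?rhs")
    proof -
      have "emeasure lborel S * (L * fg) = L * (emeasure lborel S * fg)" by (simp add: mult_ac)
      also have "\<dots> \<le> L * (ennreal (exp k) * (ennreal (2 * pi) *
     (\<integral>\<^sup>+q. indicator A (norm q) * (\<integral>\<^sup>+u. ennreal (norm u powr e * exp (- (k/2) * (norm ((q::R3) + l *\<^sub>R u))\<^sup>2)) \<partial>lborel) \<partial>lborel)))"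
        by (rule mult_left_mono[OF main]) simp
      also have "\<dots> = ennreal (exp k) * (ennreal (2 * pi) *
     (L * (\<integral>\<^sup>+q. indicator A (norm q) * (\<integral>\<^sup>+u. ennreal (norm u powr e * exp (- (k/2) * (norm ((q::R3) + l *\<^sub>R u))\<^sup>2)) \<partial>lborel) \<partial>lborel)))"
        by (simp add: mult_ac)
      also have "\<dots> = ?rhs"
        by (subst nn_integral_cmult[symmetric]) (simp_all add: mult_ac)
      finally show ?thesis .
    qed
    also have "?rhs \<le> ennreal (exp k) * (ennreal (2 * pi) * (\<integral>\<^sup>+q. ennreal (C * 2 powr \<bar>e\<bar> * (1 + R) powr e) * indicator S q \<partial>lborel))"
    proof (intro mult_left_mono nn_integral_mono)
      fix q :: R3
      have "L * (\<integral>\<^sup>+u. ennreal (norm u powr e * exp (- (k/2) * (norm ((q::R3) + l *\<^sub>R u))\<^sup>2)) \<partial>lborel)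
         = (\<integral>\<^sup>+y. ennreal (norm y powr e * exp (- (k/2) * (norm (q + y))\<^sup>2)) \<partial>lborel)"
        unfolding L_def using nn_integral_powr_norm_scale[OF l, of "\<lambda>y::R3. exp (- (k/2) * (norm (q + y))\<^sup>2)" e] by simp
      also have "\<dots> \<le> ennreal (C * (1 + norm q) powr e)" by (rule CN)
      finally have 1: "L * (\<integral>\<^sup>+u. ennreal (norm u powr e * exp (- (k/2) * (norm ((q::R3) + l *\<^sub>R u))\<^sup>2)) \<partial>lborel) \<le> ennreal (C * (1 + norm q) powr e)" .
      have 2: "(1 + norm q) powr e \<le> 2 powr \<bar>e\<bar> * (1 + R) powr e" if "q \<in> S"
      proof -
        have q: "R \<le> norm q" "norm q \<le> R + 1" "R \<ge> 0" using that by (auto simp: S_def A_def R_def)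
        show ?thesis
        proof (cases "e \<ge> 0")
          case True
          have "(1 + norm q) powr e \<le> (2 * (1 + R)) powr e" using q True by (intro powr_mono2) auto
          also have "\<dots> = 2 powr \<bar>e\<bar> * (1 + R) powr e" using q True by (subst powr_mult) auto
          finally show ?thesis .
        next
          case False
          have "(1 + norm q) powr e \<le> (1 + R) powr e" using q False by (intro powr_mono2') auto
          also have "\<dots> \<le> 2 powr \<bar>e\<bar> * (1 + R) powr e"
            using mult_right_mono[of 1 "2 powr \<bar>e\<bar>" "(1 + R) powr e"] by (simp add: ge_one_powr_ge_zero)
          finally show ?thesis .
        qed
      qed
      show "indicator A (norm q) * (L * (\<integral>\<^sup>+u. ennreal (norm u powr e * exp (- (k/2) * (norm ((q::R3) + l *\<^sub>R u))\<^sup>2)) \<partial>lborel))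
        \<le> ennreal (C * 2 powr \<bar>e\<bar> * (1 + R) powr e) * indicator S q"
      proof (cases "q \<in> S")
        case True
        have "ennreal (C * (1 + norm q) powr e) \<le> ennreal (C * 2 powr \<bar>e\<bar> * (1 + R) powr e)"
          using mult_left_mono[OF 2[OF True], of C] C by (intro ennreal_leI) (simp add: mult_ac)
        then show ?thesis using 1 True by (simp add: indS)
      qed (simp add: indS)
    qed simp_all
    also have "\<dots> = emeasure lborel S * ennreal (C' * (1 + R) powr e)"
      using C by (subst nn_integral_cmult_indicator) (simp_all add: C'_def ennreal_mult mult_ac)
    finally have "emeasure lborel S * (L * fg) \<le> emeasure lborel S * ennreal (C' * (1 + R) powr e)" .
    then have "L * fg \<le> ennreal (C' * (1 + R) powr e)"
      using pos fin by (metis ennreal_mult_le_mult_iff infinity_ennreal_def less_irrefl)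
    then show ?thesis by (simp add: L_def fg_def R_def)
  qed
  moreover have "C' > 0" using C by (simp add: C'_def)
  ultimately show ?thesis by blast
qed

section \<open>Weight integrals for the gain and loss terms\<close>

lemma frame_dir_complement:
  assumes "l\<^sup>2 + m\<^sup>2 = 1"
  shows "u - frame_dir e2 e3 l m u \<phi> = frame_dir e2 e3 m (- l) u \<phi>"
proof -
  have "m * m = 1 - l * l" using assms by (simp add: power2_eq_square)
  then have "(m * m) *\<^sub>R u = u - (l * l) *\<^sub>R u" by (simp only: scaleR_diff_left scaleR_one)
  then show ?thesis by (simp add: frame_dir_def mult.commute)
qed

text \<open>Peetre's inequality rearranged for negative exponents: decay at \<open>q + y\<close>
  becomes decay at \<open>q\<close>, at the price of growth in \<open>y\<close>.\<close>

lemma one_plus_norm_powr_minus_le: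
  fixes q y :: "'a::real_normed_vector"
  assumes "s \<ge> 0"
  shows "(1 + norm (q + y)) powr (- s) \<le> (1 + norm q) powr (- s) * (1 + norm y) powr s"
proof -
  have p: "0 < (1 + norm x) powr s" for x :: 'a using norm_ge_zero[of x] by (smt (verit) powr_gt_zero)
  show ?thesis
    using one_plus_norm_powr_le[OF assms, of q y] p[of q] p[of y] p[of "q + y"]
    by (simp add: powr_minus field_simps)
qed

text \<open>For small \<open>l\<close> the decay \<open>(1 + |m| r)\<^sup>-\<^sup>2\<^sup>\<beta>\<close> is traded for a smaller power of \<open>r\<close>: the exponent \<open>e \<le> -2\<close> makes the
  factor \<open>l\<^sup>3\<^sup>+\<^sup>e\<close> that the scaling \<open>y = l u\<close> requires larger than \<open>l\<close>.\<close>

lemma angular_weight_le: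
  fixes l m r \<gamma> \<beta> :: real
  assumes l: "l > 0" and lm: "l\<^sup>2 + m\<^sup>2 = 1" and r: "r > 0" and \<gamma>: "-3 < \<gamma>" and \<beta>: "2 * \<beta> > 3 + \<gamma>"
  defines "e \<equiv> min \<gamma> (-2)"
  shows "l * \<bar>m\<bar> * (r powr \<gamma> * (1 + \<bar>m\<bar> * r) powr (- 2 * \<beta>)) \<le>
    (2 powr (3 + \<gamma>) + 2 powr (\<gamma> - e)) * (l powr (3 + \<gamma>) * r powr \<gamma> + l powr (3 + e) * r powr e)"
proof -
  have "l\<^sup>2 \<le> 1" using lm zero_le_power2[of m] by linarith
  then have l1: "l \<le> 1" using l by (simp add: abs_square_le_1)
  have "m\<^sup>2 \<le> 1" using lm zero_le_power2[of l] by linarith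
  then have m1: "\<bar>m\<bar> \<le> 1" by (simp add: abs_square_le_1)
  have e: "e \<le> \<gamma>" "e \<le> -2" "-3 < e" using \<gamma> by (auto simp: e_def)
  have \<beta>0: "\<beta> > 0" using \<beta> \<gamma> by simp
  define a where "a = l powr (3 + \<gamma>) * r powr \<gamma>"
  define b where "b = l powr (3 + e) * r powr e"
  have ab: "a \<ge> 0" "b \<ge> 0" by (auto simp: a_def b_def)
  have lm1: "l * \<bar>m\<bar> \<le> l" using l m1 by (simp add: mult_left_le)
  have mr: "0 \<le> \<bar>m\<bar> * r" using r by simp
  have "l * \<bar>m\<bar> * (r powr \<gamma> * (1 + \<bar>m\<bar> * r) powr (- 2 * \<beta>)) \<le> 2 powr (3 + \<gamma>) * a + 2 powr (\<gamma> - e) * b"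
  \<comment> \<open>For \<open>l\<close> bounded below the factor l^(3 + \<gamma>) costs only a
    constant and the decay is dropped. For small \<open>l\<close> the cofactor |m| is at least 1/2,
    so the decay is a genuine decay in \<open>r\<close>.\<close>
  proof (cases "l \<ge> 1/2")
    case True
    have "(1/2) powr (3 + \<gamma>) \<le> l powr (3 + \<gamma>)" using True \<gamma> by (intro powr_mono2) auto
    then have 1: "1 \<le> 2 powr (3 + \<gamma>) * l powr (3 + \<gamma>)" by (simp add: powr_divide field_simps)
    have "(1 + \<bar>m\<bar> * r) powr (- 2 * \<beta>) \<le> 1"
      using mr \<beta>0 by (simp add: powr_minus inverse_le_1_iff ge_one_powr_ge_zero)
    then have "l * \<bar>m\<bar> * (r powr \<gamma> * (1 + \<bar>m\<bar> * r) powr (- 2 * \<beta>)) \<le> 1 * (r powr \<gamma> * 1)"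
      using lm1 l1 l by (intro mult_mono order_trans[OF lm1 l1]) auto
    also have "\<dots> \<le> 2 powr (3 + \<gamma>) * a"
      using mult_right_mono[OF 1, of "r powr \<gamma>"] by (simp add: a_def mult_ac)
    finally show ?thesis using ab by (simp add: add_increasing2)
  next
    case False
    have "l\<^sup>2 \<le> (1/2)\<^sup>2" using False l by (intro power_mono) auto
    then have "(1/2)\<^sup>2 \<le> \<bar>m\<bar>\<^sup>2" using lm by (simp add: power2_eq_square)
    then have m2: "\<bar>m\<bar> \<ge> 1/2" by (rule power2_le_imp_le) simp
    have "r / 2 \<le> 1 + \<bar>m\<bar> * r" using mult_right_mono[OF m2, of r] r by linarith
    \<comment> \<open>The exponent \<gamma> - e is \<gamma> + 2 or 0, in either case at most 2
      \<beta>, so part of the available decay suffices.\<close>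
    have "(1 + \<bar>m\<bar> * r) powr (- 2 * \<beta>) \<le> (1 + \<bar>m\<bar> * r) powr (- (\<gamma> - e))"
      using mr \<beta> \<beta>0 by (intro powr_mono) (auto simp: e_def)
    also have "\<dots> \<le> (r / 2) powr (- (\<gamma> - e))"
      using \<open>r / 2 \<le> 1 + \<bar>m\<bar> * r\<close> e r by (intro powr_mono2') auto
    also have "\<dots> = 2 powr (\<gamma> - e) * r powr (e - \<gamma>)"
      using r by (simp add: powr_divide powr_minus powr_diff field_simps)
    finally have 1: "(1 + \<bar>m\<bar> * r) powr (- 2 * \<beta>) \<le> 2 powr (\<gamma> - e) * r powr (e - \<gamma>)" .
    have 2: "l * \<bar>m\<bar> \<le> l powr (3 + e)"
    proof -
      have "l powr 1 \<le> l powr (3 + e)" using l l1 e by (intro powr_mono') auto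
      then show ?thesis using order_trans[OF lm1, of "l powr (3 + e)"] l by simp
    qed
    have "l * \<bar>m\<bar> * (r powr \<gamma> * (1 + \<bar>m\<bar> * r) powr (- 2 * \<beta>)) \<le> l powr (3 + e) * (r powr \<gamma> * (2 powr (\<gamma> - e) * r powr (e - \<gamma>)))"
      using 1 2 l by (intro mult_mono) auto
    also have "\<dots> = 2 powr (\<gamma> - e) * b"
      using r by (simp add: b_def powr_diff)
    finally show ?thesis using ab by (simp add: add_increasing)
  qed
  also have "\<dots> \<le> (2 powr (3 + \<gamma>) + 2 powr (\<gamma> - e)) * (a + b)"
    using ab by (simp add: algebra_simps)
  finally show ?thesis by (simp add: a_def b_def)
qed

text \<open>Here \<open>p\<close> is one of the two post-collisional velocities. Adding the
  deflection of the other one gives \<open>v\<^sub>*\<close>, where the Gaussian sits, and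
  subtracting the complementary deflection gives the other post-collisional velocity, where the
  bounded factor decays. The weight l |m| is cos \<theta> sin \<theta> in both roles.\<close>

abbreviation gain_density :: "(R3 \<Rightarrow> R3) \<Rightarrow> (R3 \<Rightarrow> R3) \<Rightarrow> real \<Rightarrow> real \<Rightarrow> real \<Rightarrow> real \<Rightarrow> R3 \<Rightarrow> R3 \<Rightarrow> real \<Rightarrow> ennreal" where
  "gain_density e2 e3 \<gamma> \<beta> l m p u \<phi> \<equiv> ennreal (norm u powr \<gamma> * (l * \<bar>m\<bar>)) *
     ennreal (exp (- (norm (p + frame_dir e2 e3 l m u \<phi>))\<^sup>2 / 2)
        * (1 + norm (p + frame_dir e2 e3 l m u \<phi> - frame_dir e2 e3 m (- l) u \<phi>)) powr (- 2 * \<beta>))"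

text \<open>The decay sits at a point that moves with \<phi>. Peetre's inequality moves it to the
  complementary deflection, whose length |m| |u| does not depend on \<phi>. The price is 2 \<beta>
  powers of 1 + |v_*|, paid with half of the Gaussian. \<open>angular_weight_le\<close> then leaves
  two multiples of \<open>frame_gauss\<close>, with exponents \<gamma> and \<open>e\<close>, each
  with the power of \<open>l\<close> that its bound requires.\<close>

lemma gain_weight_integral_le:
  fixes \<gamma> \<beta> :: real
  assumes \<gamma>: "-3 < \<gamma>" and \<beta>: "2 * \<beta> > 3 + \<gamma>"
  shows "\<exists>C>0. \<forall>e2 e3 l m p. collision_frame e2 e3 \<longrightarrow> l > 0 \<longrightarrow> l\<^sup>2 + m\<^sup>2 = 1 \<longrightarrow>
    (\<integral>\<^sup>+u. (\<integral>\<^sup>+\<phi>\<in>{0<..<2*pi}. gain_density e2 e3 \<gamma> \<beta> l m p u \<phi> \<partial>lborel) \<partial>lborel)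
      \<le> ennreal (C * (1 + norm p) powr \<gamma>)"
proof -
  define e where "e = min \<gamma> (-2)"
  have e: "-3 < e" "e \<le> \<gamma>" using \<gamma> by (auto simp: e_def)
  obtain C1 where C1: "C1 > 0" and b1: "\<And>e2 e3 l m p. collision_frame e2 e3 \<Longrightarrow> l > 0 \<Longrightarrow> l\<^sup>2 + m\<^sup>2 = 1 \<Longrightarrow>
    ennreal (l powr (3 + \<gamma>)) * frame_gauss e2 e3 l m \<gamma> (1/4) p \<le> ennreal (C1 * (1 + norm p) powr \<gamma>)"
    using frame_gauss_le[OF \<gamma>, of "1/4"] by auto
  obtain C2 where C2: "C2 > 0" and b2: "\<And>e2 e3 l m p. collision_frame e2 e3 \<Longrightarrow> l > 0 \<Longrightarrow> l\<^sup>2 + m\<^sup>2 = 1 \<Longrightarrow>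
    ennreal (l powr (3 + e)) * frame_gauss e2 e3 l m e (1/4) p \<le> ennreal (C2 * (1 + norm p) powr e)"
    using frame_gauss_le[OF e(1), of "1/4"] by auto
  \<comment> \<open>The value n^2 / (4 k) of \<open>powr_mult_gauss_le\<close> for n = 2 \<beta> and
    k = 1/4, the half of the Gaussian that is spent.\<close>
  define G where "G = exp ((2 * \<beta>)\<^sup>2)"
  define D where "D = G * (2 powr (3 + \<gamma>) + 2 powr (\<gamma> - e))"
  have D0: "D > 0" by (simp add: D_def G_def add_pos_pos)
  have "(\<integral>\<^sup>+u. (\<integral>\<^sup>+\<phi>\<in>{0<..<2*pi}. gain_density e2 e3 \<gamma> \<beta> l m p u \<phi> \<partial>lborel) \<partial>lborel)
      \<le> ennreal (D * (C1 + C2) * (1 + norm p) powr \<gamma>)"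
    if fr: "collision_frame e2 e3" and l: "l > 0" and lm: "l\<^sup>2 + m\<^sup>2 = 1" for e2 e3 l m p
  proof -
    note [measurable] = frame_dir_measurable[OF fr]
    have ml: "m\<^sup>2 + (-l)\<^sup>2 = 1" using lm by simp
    define E where "E = (\<lambda>u \<phi>. exp (- (1/4) * (norm (p + frame_dir e2 e3 l m u \<phi>))\<^sup>2))"
    define I where "I = (\<lambda>u. \<integral>\<^sup>+\<phi>\<in>{0<..<2*pi}. ennreal (E u \<phi>) \<partial>lborel)"
    have [measurable]: "I \<in> borel_measurable borel" unfolding I_def E_def by measurable
    define r1 where "r1 = (\<lambda>u::R3. ennreal (l powr (3 + \<gamma>)) * ennreal (norm u powr \<gamma>) + ennreal (l powr (3 + e)) * ennreal (norm u powr e))"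
    have [measurable]: "r1 \<in> borel_measurable borel" unfolding r1_def by measurable
    have pt: "norm u powr \<gamma> * (l * \<bar>m\<bar>) * (exp (- (norm (p + frame_dir e2 e3 l m u \<phi>))\<^sup>2 / 2)
        * (1 + norm (p + frame_dir e2 e3 l m u \<phi> - frame_dir e2 e3 m (- l) u \<phi>)) powr (- 2 * \<beta>))
       \<le> D * ((l powr (3 + \<gamma>) * norm u powr \<gamma> + l powr (3 + e) * norm u powr e) * E u \<phi>)" if u: "u \<noteq> 0" for u \<phi>
    proof -
      define c where "c = frame_dir e2 e3 l m u \<phi>"
      define a where "a = frame_dir e2 e3 m (- l) u \<phi>"
      have na: "norm a = \<bar>m\<bar> * norm u" unfolding a_def by (rule norm_frame_dir[OF fr ml])
      have \<beta>0: "2 * \<beta> \<ge> 0" using \<beta> \<gamma> by simp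
      have w: "(1 + norm (p + c - a)) powr (- 2 * \<beta>) \<le> (1 + norm a) powr (- 2 * \<beta>) * (1 + norm (p + c)) powr (2 * \<beta>)"
        using one_plus_norm_powr_minus_le[OF \<beta>0, of "-a" "p + c"] by simp
      have "(1 + norm (p + c)) powr (2 * \<beta>) * exp (- (1/4) * (norm (p + c))\<^sup>2) \<le> G"
        unfolding G_def using powr_mult_gauss_le[of "1/4" "norm (p + c)" "2 * \<beta>"] by simp
      then have "(1 + norm (p + c)) powr (2 * \<beta>) * exp (- (1/4) * (norm (p + c))\<^sup>2) * exp (- (1/4) * (norm (p + c))\<^sup>2) \<le> G * E u \<phi>"
        unfolding E_def c_def[symmetric] by (intro mult_right_mono) auto
      then have g: "exp (- (norm (p + c))\<^sup>2 / 2) * (1 + norm (p + c)) powr (2 * \<beta>) \<le> G * E u \<phi>"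
        by (simp add: mult.assoc flip: exp_add) (simp add: mult.commute)
      have "norm u powr \<gamma> * (l * \<bar>m\<bar>) * (exp (- (norm (p + c))\<^sup>2 / 2) * (1 + norm (p + c - a)) powr (- 2 * \<beta>))
          \<le> norm u powr \<gamma> * (l * \<bar>m\<bar>) * (exp (- (norm (p + c))\<^sup>2 / 2) * ((1 + norm a) powr (- 2 * \<beta>) * (1 + norm (p + c)) powr (2 * \<beta>)))"
        using w l by (intro mult_left_mono) auto
      also have "\<dots> = (l * \<bar>m\<bar> * (norm u powr \<gamma> * (1 + \<bar>m\<bar> * norm u) powr (- 2 * \<beta>))) * (exp (- (norm (p + c))\<^sup>2 / 2) * (1 + norm (p + c)) powr (2 * \<beta>))"
        by (simp add: na mult_ac)
      also have "\<dots> \<le> ((2 powr (3 + \<gamma>) + 2 powr (\<gamma> - e)) * (l powr (3 + \<gamma>) * norm u powr \<gamma> + l powr (3 + e) * norm u powr e)) * (G * E u \<phi>)"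
        unfolding e_def using u by (intro mult_mono g angular_weight_le l lm \<gamma> \<beta>) auto
      also have "\<dots> = D * ((l powr (3 + \<gamma>) * norm u powr \<gamma> + l powr (3 + e) * norm u powr e) * E u \<phi>)"
        by (simp add: D_def mult_ac)
      finally show ?thesis unfolding c_def a_def .
    qed
    have "(\<integral>\<^sup>+u. (\<integral>\<^sup>+\<phi>\<in>{0<..<2*pi}. gain_density e2 e3 \<gamma> \<beta> l m p u \<phi> \<partial>lborel) \<partial>lborel)
      \<le> (\<integral>\<^sup>+u. ennreal D * (r1 u * I u) \<partial>lborel)"
    proof (rule nn_integral_mono_AE, use AE_lborel_singleton[of 0] in eventually_elim)
      fix u :: R3 assume u: "u \<noteq> 0"
      have "(\<integral>\<^sup>+\<phi>\<in>{0<..<2*pi}. gain_density e2 e3 \<gamma> \<beta> l m p u \<phi> \<partial>lborel)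
        \<le> (\<integral>\<^sup>+\<phi>. (ennreal D * r1 u) * (ennreal (E u \<phi>) * indicator {0<..<2*pi} \<phi>) \<partial>lborel)"
      proof (rule nn_integral_mono)
        fix \<phi>
        have "gain_density e2 e3 \<gamma> \<beta> l m p u \<phi>
          \<le> ennreal (D * ((l powr (3 + \<gamma>) * norm u powr \<gamma> + l powr (3 + e) * norm u powr e) * E u \<phi>))"
          using pt[OF u, of \<phi>] l by (subst ennreal_mult[symmetric]) (auto intro!: ennreal_leI)
        also have "\<dots> = (ennreal D * r1 u) * ennreal (E u \<phi>)"
          using D0 by (simp add: r1_def E_def ennreal_mult ennreal_plus mult.assoc)
        finally show "gain_density e2 e3 \<gamma> \<beta> l m p u \<phi> * indicator {0<..<2*pi} \<phi>
           \<le> (ennreal D * r1 u) * (ennreal (E u \<phi>) * indicator {0<..<2*pi} \<phi>)"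
          by (simp split: split_indicator)
      qed
      also have "\<dots> = ennreal D * (r1 u * I u)"
        unfolding I_def E_def by (subst nn_integral_cmult) (simp_all add: mult.assoc)
      finally show "(\<integral>\<^sup>+\<phi>\<in>{0<..<2*pi}. gain_density e2 e3 \<gamma> \<beta> l m p u \<phi> \<partial>lborel)
        \<le> ennreal D * (r1 u * I u)" .
    qed
    also have "\<dots> = ennreal D * (\<integral>\<^sup>+u. ennreal (l powr (3 + \<gamma>)) * (ennreal (norm u powr \<gamma>) * I u) + ennreal (l powr (3 + e)) * (ennreal (norm u powr e) * I u) \<partial>lborel)"
      by (subst nn_integral_cmult) (simp_all add: r1_def distrib_right mult.assoc)
    also have "\<dots> = ennreal D * (ennreal (l powr (3 + \<gamma>)) * frame_gauss e2 e3 l m \<gamma> (1/4) p + ennreal (l powr (3 + e)) * frame_gauss e2 e3 l m e (1/4) p)"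
      by (simp add: nn_integral_add nn_integral_cmult) (simp add: frame_gauss_def I_def E_def)
    also have "\<dots> \<le> ennreal D * (ennreal (C1 * (1 + norm p) powr \<gamma>) + ennreal (C2 * (1 + norm p) powr e))"
      by (intro mult_left_mono add_mono b1 b2 fr l lm) simp
    also have "\<dots> \<le> ennreal D * (ennreal (C1 * (1 + norm p) powr \<gamma>) + ennreal (C2 * (1 + norm p) powr \<gamma>))"
      using C1 C2 e by (intro mult_left_mono add_mono ennreal_leI powr_mono) auto
    also have "\<dots> = ennreal (D * (C1 + C2) * (1 + norm p) powr \<gamma>)"
      using C1 C2 D0 by (simp add: ennreal_mult[symmetric] ennreal_plus[symmetric] algebra_simps del: ennreal_plus)
    finally show ?thesis .
  qed
  moreover have "D * (C1 + C2) > 0" using D0 C1 C2 by simp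
  ultimately show ?thesis by blast
qed

text \<open>In the loss term with the square-integrated factor at \<open>p\<close>, taken as
  \<open>v\<^sub>*\<close>, the Gaussian is constant in \<open>u\<close>, so integrability can come
  only from the decay of the other factor at \<open>p - u\<close>. Moved to \<open>u\<close> by
  Peetre's inequality, it leaves |u|^\<gamma> (1 + |u|)^(-2 \<beta>), integrable at infinity exactly
  because 2 \<beta> - \<gamma> > 3.\<close>

lemma loss_weight_integral_le:
  fixes \<gamma> \<beta> :: real
  assumes \<gamma>: "-3 < \<gamma>" and \<beta>: "2 * \<beta> > 3 + \<gamma>"
  shows "\<exists>C>0. \<forall>p::R3. (\<integral>\<^sup>+u. ennreal (norm u powr \<gamma> * (exp (- (norm p)\<^sup>2 / 2) * (1 + norm (p - u)) powr (- 2 * \<beta>))) \<partial>lborel)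
     \<le> ennreal (C * (1 + norm p) powr \<gamma>)"
proof -
  define m0 where "m0 = min \<gamma> 0"
  \<comment> \<open>A positive \<gamma> is charged to the decay and a negative one stays in the
    singular factor; either way \<rho> - m0 = 2 \<beta> - \<gamma>.\<close>
  define \<rho> where "\<rho> = 2 * \<beta> - max \<gamma> 0"
  define w where "w = (\<lambda>u::R3. norm u powr m0 * (1 + norm u) powr (- \<rho>))"
  have [measurable]: "w \<in> borel_measurable borel" unfolding w_def by measurable
  have "(\<integral>\<^sup>+u. ennreal (w u) \<partial>lborel) < \<infinity>"
    unfolding w_def by (rule nn_integral_power_weight_finite) (use \<gamma> \<beta> in \<open>auto simp: m0_def \<rho>_def\<close>)
  then obtain I where I: "(\<integral>\<^sup>+u. ennreal (w u) \<partial>lborel) = ennreal I" "I \<ge> 0"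
    by (cases "(\<integral>\<^sup>+u. ennreal (w u) \<partial>lborel)") auto
  define G where "G = exp ((2 * \<beta> - \<gamma>)\<^sup>2 / 2)"
  have \<beta>0: "2 * \<beta> \<ge> 0" using \<beta> \<gamma> by simp
  have pt: "norm u powr \<gamma> * (exp (- (norm p)\<^sup>2 / 2) * (1 + norm (p - u)) powr (- 2 * \<beta>)) \<le> G * (1 + norm p) powr \<gamma> * w u"
    for p u :: R3
  proof -
    have 1: "(1 + norm (p - u)) powr (- 2 * \<beta>) \<le> (1 + norm u) powr (- 2 * \<beta>) * (1 + norm p) powr (2 * \<beta>)"
      using one_plus_norm_powr_minus_le[OF \<beta>0, of "-u" p] by simp
    have 2: "exp (- (norm p)\<^sup>2 / 2) * (1 + norm p) powr (2 * \<beta>) \<le> G * (1 + norm p) powr \<gamma>"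
    proof -
      have "(1 + norm p) powr (2 * \<beta> - \<gamma>) * exp (- (norm p)\<^sup>2 / 2) \<le> G"
        unfolding G_def using powr_mult_gauss_le[of "1/2" "norm p" "2 * \<beta> - \<gamma>"] by simp
      then have "(1 + norm p) powr (2 * \<beta> - \<gamma>) * exp (- (norm p)\<^sup>2 / 2) * (1 + norm p) powr \<gamma> \<le> G * (1 + norm p) powr \<gamma>"
        by (rule mult_right_mono) simp
      moreover have "(1 + norm p) powr (2 * \<beta> - \<gamma>) * (1 + norm p) powr \<gamma> = (1 + norm p) powr (2 * \<beta>)"
        by (simp flip: powr_add)
      ultimately show ?thesis by (metis (no_types, lifting) mult.assoc mult.commute)
    qed
    have 3: "norm u powr \<gamma> * (1 + norm u) powr (- 2 * \<beta>) \<le> w u"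
    proof (cases "\<gamma> \<ge> 0")
      case True
      show ?thesis
      proof (cases "u = 0")
        case False
        have "norm u powr \<gamma> \<le> (1 + norm u) powr \<gamma>" using True by (intro powr_mono2) auto
        then have "norm u powr \<gamma> * (1 + norm u) powr (- 2 * \<beta>) \<le> (1 + norm u) powr \<gamma> * (1 + norm u) powr (- 2 * \<beta>)"
          by (rule mult_right_mono) simp
        then show ?thesis using True False by (simp add: w_def m0_def \<rho>_def powr_add[symmetric])
      qed (simp add: w_def)
    next
      case False
      then show ?thesis by (simp add: w_def m0_def \<rho>_def)
    qed
    have "norm u powr \<gamma> * (exp (- (norm p)\<^sup>2 / 2) * (1 + norm (p - u)) powr (- 2 * \<beta>)) \<le>
      norm u powr \<gamma> * (exp (- (norm p)\<^sup>2 / 2) * ((1 + norm u) powr (- 2 * \<beta>) * (1 + norm p) powr (2 * \<beta>)))"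
      using 1 by (intro mult_left_mono) auto
    also have "\<dots> = (exp (- (norm p)\<^sup>2 / 2) * (1 + norm p) powr (2 * \<beta>)) * (norm u powr \<gamma> * (1 + norm u) powr (- 2 * \<beta>))"
      by (simp add: mult_ac)
    also have "\<dots> \<le> (G * (1 + norm p) powr \<gamma>) * w u"
      by (rule mult_mono[OF 2 3]) (auto simp: G_def)
    finally show ?thesis .
  qed
  have "(\<integral>\<^sup>+u. ennreal (norm u powr \<gamma> * (exp (- (norm p)\<^sup>2 / 2) * (1 + norm (p - u)) powr (- 2 * \<beta>))) \<partial>lborel)
     \<le> ennreal (G * (I + 1) * (1 + norm p) powr \<gamma>)" for p :: R3
  proof -
    have "(\<integral>\<^sup>+u. ennreal (norm u powr \<gamma> * (exp (- (norm p)\<^sup>2 / 2) * (1 + norm (p - u)) powr (- 2 * \<beta>))) \<partial>lborel)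
      \<le> (\<integral>\<^sup>+u. ennreal (G * (1 + norm p) powr \<gamma>) * ennreal (w u) \<partial>lborel)"
      using pt[of _ p] by (intro nn_integral_mono, subst ennreal_mult[symmetric]) (auto simp: G_def w_def intro!: ennreal_leI)
    also have "\<dots> = ennreal (G * (1 + norm p) powr \<gamma>) * ennreal I" by (subst nn_integral_cmult) (simp_all add: I)
    also have "\<dots> \<le> ennreal (G * (I + 1) * (1 + norm p) powr \<gamma>)"
      using I by (subst ennreal_mult[symmetric]) (auto simp: G_def algebra_simps intro!: ennreal_leI)
    finally show ?thesis .
  qed
  moreover have "G * (I + 1) > 0" using I by (simp add: G_def)
  ultimately show ?thesis by blast
qed

section \<open>Bilinear collision operators over an abstract parameter space\<close>

text \<open>The gain term has \<open>A = v' - v\<close>, \<open>B = v\<^sub>*' - v\<close>, the loss term \<open>A = 0\<close>, \<open>B = v\<^sub>* - v\<close>; in both cases \<open>A + B = v\<^sub>* - v\<close>.\<close>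

definition coll_op :: "'z measure \<Rightarrow> ('z \<Rightarrow> ennreal) \<Rightarrow> ('z \<Rightarrow> R3) \<Rightarrow> ('z \<Rightarrow> R3) \<Rightarrow> (R3 \<Rightarrow> ennreal) \<Rightarrow> (R3 \<Rightarrow> ennreal) \<Rightarrow> R3 \<Rightarrow> ennreal" where
  "coll_op M W A B F G v =
     (\<integral>\<^sup>+z. W z * ennreal (exp (- (norm (v + A z + B z))\<^sup>2 / 2)) * (F (v + A z) * G (v + B z)) \<partial>M)"

text \<open>The estimate that is quadratic in the second argument follows from the one in the first
  by exchanging the two shifts.\<close>

lemma coll_op_commute: "coll_op M W A B F G v = coll_op M W B A G F v"
  unfolding coll_op_def by (simp add: add_ac mult_ac)

lemma ennreal_mult_self_powr:
  fixes x a :: real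
  shows "(ennreal (x powr a))\<^sup>2 = ennreal (x powr (2 * a))"
  by (simp add: ennreal_power power2_eq_square flip: powr_add ennreal_mult)

text \<open>The mass bound \<open>N\<close> grows like (1 + |v|)^\<gamma>, which cancels the weight
  (1 + |v|)^(-\<gamma>) on the left. After Tonelli and translation, the square of \<open>F\<close>
  stands at the integration variable \<open>p\<close>, and \<open>J\<close> bounds the remaining
  kernel. This explains why the two sides carry opposite powers of the velocity weight.\<close>

lemma coll_op_L2_le:
  assumes "sigma_finite_measure M"
    and [measurable]: "W \<in> borel_measurable M" "A \<in> borel_measurable M" "B \<in> borel_measurable M"
      "F \<in> borel_measurable borel" "G \<in> borel_measurable borel"
    and N: "\<And>v. (\<integral>\<^sup>+z. W z * ennreal (exp (- (norm (v + A z + B z))\<^sup>2 / 2)) \<partial>M) \<le> ennreal (c1 * (1 + norm v) powr \<gamma>)"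
    and J: "\<And>p. (\<integral>\<^sup>+z. W z * ennreal (exp (- (norm (p + B z))\<^sup>2 / 2) * (1 + norm (p + B z - A z)) powr (- 2 * \<beta>)) \<partial>M)
        \<le> ennreal (c2 * (1 + norm p) powr \<gamma>)"
    and G: "\<And>v. G v \<le> ennreal (g * (1 + norm v) powr (- \<beta>))" 
    and c: "c1 \<ge> 0" "c2 \<ge> 0" "g \<ge> 0"
  shows "(\<integral>\<^sup>+v. ennreal ((1 + norm v) powr (- \<gamma>)) * (coll_op M W A B F G v)\<^sup>2 \<partial>lborel)
      \<le> ennreal (c1 * c2 * g\<^sup>2) * (\<integral>\<^sup>+p. (F p)\<^sup>2 * ennreal ((1 + norm p) powr \<gamma>) \<partial>lborel)"
proof -
  interpret sigma_finite_measure M by fact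
  interpret P: pair_sigma_finite "lborel :: R3 measure" M ..
  define K where "K = (\<lambda>v z. W z * ennreal (exp (- (norm (v + A z + B z))\<^sup>2 / 2)))"
  define H where "H = (\<lambda>p z. W z * ennreal (exp (- (norm (p + B z))\<^sup>2 / 2)) * ((F p)\<^sup>2 * (G (p + B z - A z))\<^sup>2))"
  have [measurable]: "K v \<in> borel_measurable M" for v unfolding K_def by measurable
  have cs: "(coll_op M W A B F G v)\<^sup>2 \<le> ennreal (c1 * (1 + norm v) powr \<gamma>) * (\<integral>\<^sup>+z. K v z * ((F (v + A z))\<^sup>2 * (G (v + B z))\<^sup>2) \<partial>M)" for v
  proof -
    \<comment> \<open>Cauchy-Schwarz is applied to the constant 1 and \<open>f\<close> with the
      kernel as measure, so the first factor is the total mass of the kernel.\<close>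
    define D where "D = density M (K v)"
    define f where "f = (\<lambda>z. F (v + A z) * G (v + B z))"
    have [measurable]: "f \<in> borel_measurable M" unfolding f_def by measurable
    have "coll_op M W A B F G v = (\<integral>\<^sup>+z. 1 * f z \<partial>D)"
      by (simp add: coll_op_def D_def nn_integral_density f_def K_def)
    then have "(coll_op M W A B F G v)\<^sup>2 \<le> (\<integral>\<^sup>+z. 1^2 \<partial>D) * (\<integral>\<^sup>+z. (f z)^2 \<partial>D)"
      using Cauchy_Schwarz_nn_integral[of "\<lambda>_. 1" D f] by (simp add: D_def)
    also have "(\<integral>\<^sup>+z. 1^2 \<partial>D) = (\<integral>\<^sup>+z. K v z \<partial>M)" unfolding D_def by (simp add: nn_integral_density del: nn_integral_const)
    also have "\<dots> \<le> ennreal (c1 * (1 + norm v) powr \<gamma>)" unfolding K_def by (rule N)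
    also have "(\<integral>\<^sup>+z. (f z)^2 \<partial>D) = (\<integral>\<^sup>+z. K v z * ((F (v + A z))\<^sup>2 * (G (v + B z))\<^sup>2) \<partial>M)"
      unfolding D_def by (simp add: nn_integral_density f_def power_mult_distrib)
    finally show ?thesis by (simp add: mult_right_mono)
  qed
  have "(\<integral>\<^sup>+v. ennreal ((1 + norm v) powr (- \<gamma>)) * (coll_op M W A B F G v)\<^sup>2 \<partial>lborel)
    \<le> (\<integral>\<^sup>+v. ennreal c1 * (\<integral>\<^sup>+z. K v z * ((F (v + A z))\<^sup>2 * (G (v + B z))\<^sup>2) \<partial>M) \<partial>lborel)"
  proof (rule nn_integral_mono)
    fix v :: R3
    have nz: "1 + norm v \<noteq> 0" using norm_ge_zero[of v] by linarith
    have "ennreal ((1 + norm v) powr (- \<gamma>)) * (coll_op M W A B F G v)\<^sup>2 \<le> ennreal ((1 + norm v) powr (- \<gamma>)) * 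
      (ennreal (c1 * (1 + norm v) powr \<gamma>) * (\<integral>\<^sup>+z. K v z * ((F (v + A z))\<^sup>2 * (G (v + B z))\<^sup>2) \<partial>M))"
      by (rule mult_left_mono[OF cs]) simp
    also have "\<dots> = ennreal ((1 + norm v) powr (- \<gamma>) * (c1 * (1 + norm v) powr \<gamma>)) * (\<integral>\<^sup>+z. K v z * ((F (v + A z))\<^sup>2 * (G (v + B z))\<^sup>2) \<partial>M)"
      using c by (simp add: ennreal_mult mult.assoc)
    also have "(1 + norm v) powr (- \<gamma>) * (c1 * (1 + norm v) powr \<gamma>) = c1"
      using nz by (simp add: powr_minus field_simps)
    finally show "ennreal ((1 + norm v) powr (- \<gamma>)) * (coll_op M W A B F G v)\<^sup>2 \<le> ennreal c1 * (\<integral>\<^sup>+z. K v z * ((F (v + A z))\<^sup>2 * (G (v + B z))\<^sup>2) \<partial>M)" .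
  qed
  also have "\<dots> = ennreal c1 * (\<integral>\<^sup>+v. \<integral>\<^sup>+z. K v z * ((F (v + A z))\<^sup>2 * (G (v + B z))\<^sup>2) \<partial>M \<partial>lborel)"
    by (rule nn_integral_cmult) (simp add: K_def)
  also have "(\<integral>\<^sup>+v. \<integral>\<^sup>+z. K v z * ((F (v + A z))\<^sup>2 * (G (v + B z))\<^sup>2) \<partial>M \<partial>lborel)
     = (\<integral>\<^sup>+z. \<integral>\<^sup>+v. K v z * ((F (v + A z))\<^sup>2 * (G (v + B z))\<^sup>2) \<partial>lborel \<partial>M)"
    by (rule P.Fubini'[symmetric]) (simp add: K_def)
  also have "\<dots> = (\<integral>\<^sup>+z. \<integral>\<^sup>+p. H p z \<partial>lborel \<partial>M)"
  proof (rule nn_integral_cong)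
    fix z assume "z \<in> space M"
    have [measurable]: "(\<lambda>p. H p z) \<in> borel_measurable borel" unfolding H_def by measurable
    \<comment> \<open>With p = v + A the points v + A + B and v + B become p + B and p + B -
      A.\<close>
    have "K v z * ((F (v + A z))\<^sup>2 * (G (v + B z))\<^sup>2) = H (A z + v) z" for v
      by (simp add: K_def H_def algebra_simps)
    then show "(\<integral>\<^sup>+v. K v z * ((F (v + A z))\<^sup>2 * (G (v + B z))\<^sup>2) \<partial>lborel) = (\<integral>\<^sup>+p. H p z \<partial>lborel)"
      using nn_integral_lborel_translate[of "\<lambda>p. H p z" "A z"] by simp
  qed
  also have "\<dots> = (\<integral>\<^sup>+p. \<integral>\<^sup>+z. H p z \<partial>M \<partial>lborel)"
    by (rule P.Fubini') (simp add: H_def)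
  also have "\<dots> \<le> (\<integral>\<^sup>+p. ennreal (c2 * g\<^sup>2) * ((F p)\<^sup>2 * ennreal ((1 + norm p) powr \<gamma>)) \<partial>lborel)"
  proof (rule nn_integral_mono)
    fix p :: R3
    have "(\<integral>\<^sup>+z. H p z \<partial>M) \<le> (\<integral>\<^sup>+z. (ennreal (g\<^sup>2) * (F p)\<^sup>2) * (W z * ennreal (exp (- (norm (p + B z))\<^sup>2 / 2) * (1 + norm (p + B z - A z)) powr (- 2 * \<beta>))) \<partial>M)"
    proof (rule nn_integral_mono)
      fix z
      have "(G (p + B z - A z))\<^sup>2 \<le> (ennreal (g * (1 + norm (p + B z - A z)) powr (- \<beta>)))\<^sup>2"
        by (rule power_mono[OF G]) simp
      also have "\<dots> = ennreal (g\<^sup>2) * ennreal ((1 + norm (p + B z - A z)) powr (- 2 * \<beta>))"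
        using c ennreal_mult_self_powr[of "1 + norm (p + B z - A z)" "-\<beta>"]
        by (simp add: ennreal_mult power_mult_distrib ennreal_power)
      finally have "H p z \<le> W z * ennreal (exp (- (norm (p + B z))\<^sup>2 / 2)) * ((F p)\<^sup>2 * (ennreal (g\<^sup>2) * ennreal ((1 + norm (p + B z - A z)) powr (- 2 * \<beta>))))"
        unfolding H_def by (intro mult_left_mono) auto
      then show "H p z \<le> (ennreal (g\<^sup>2) * (F p)\<^sup>2) * (W z * ennreal (exp (- (norm (p + B z))\<^sup>2 / 2) * (1 + norm (p + B z - A z)) powr (- 2 * \<beta>)))"
        by (simp add: ennreal_mult mult_ac)
    qed
    also have "\<dots> = (ennreal (g\<^sup>2) * (F p)\<^sup>2) * (\<integral>\<^sup>+z. W z * ennreal (exp (- (norm (p + B z))\<^sup>2 / 2) * (1 + norm (p + B z - A z)) powr (- 2 * \<beta>)) \<partial>M)"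
      by (rule nn_integral_cmult) measurable
    also have "\<dots> \<le> (ennreal (g\<^sup>2) * (F p)\<^sup>2) * ennreal (c2 * (1 + norm p) powr \<gamma>)"
      by (rule mult_left_mono[OF J]) simp
    also have "\<dots> = ennreal (c2 * g\<^sup>2) * ((F p)\<^sup>2 * ennreal ((1 + norm p) powr \<gamma>))"
      using c by (simp add: ennreal_mult mult_ac)
    finally show "(\<integral>\<^sup>+z. H p z \<partial>M) \<le> \<dots>" .
  qed
  also have "\<dots> = ennreal (c2 * g\<^sup>2) * (\<integral>\<^sup>+p. (F p)\<^sup>2 * ennreal ((1 + norm p) powr \<gamma>) \<partial>lborel)"
    by (rule nn_integral_cmult) measurable
  finally have "(\<integral>\<^sup>+v. ennreal ((1 + norm v) powr (- \<gamma>)) * (coll_op M W A B F G v)\<^sup>2 \<partial>lborel)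
    \<le> ennreal c1 * (ennreal (c2 * g\<^sup>2) * (\<integral>\<^sup>+p. (F p)\<^sup>2 * ennreal ((1 + norm p) powr \<gamma>) \<partial>lborel))"
    by (simp add: mult_left_mono)
  then show ?thesis using c by (simp add: ennreal_mult mult.assoc)
qed

text \<open>Orthogonality of the shifts is energy conservation: the squares of |v + a| and |v + b|
  add up to |v|^2 plus that of |v + a + b|, hence at least one of the two velocities is comparable
  to \<open>v\<close>.\<close>

lemma one_plus_norm_le_of_orthogonal:
  fixes v a b :: "'a::real_inner"
  assumes "a \<bullet> b = 0"
  shows "1 + norm v \<le> (1 + norm (v + a)) * (1 + norm (v + b))"
proof -
  have "(norm (v + a))\<^sup>2 + (norm (v + b))\<^sup>2 = (norm v)\<^sup>2 + (norm (v + a + b))\<^sup>2"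
    using assms by (simp add: power2_norm_eq_inner inner_add_left inner_add_right inner_commute)
  then have "(norm v)\<^sup>2 \<le> (norm (v + a))\<^sup>2 + (norm (v + b))\<^sup>2" by simp
  also have "\<dots> \<le> (norm (v + a) + norm (v + b))\<^sup>2" by (simp add: power2_sum)
  finally have "norm v \<le> norm (v + a) + norm (v + b)" by (rule power2_le_imp_le) simp
  moreover have "0 \<le> norm (v + a) * norm (v + b)" by simp
  ultimately show ?thesis unfolding distrib_left distrib_right by linarith
qed

text \<open>By orthogonality the product of the two decaying bounds is at most f g (1 +
  |v|)^(-\<beta>), a constant in \<open>z\<close>; only the mass \<open>N\<close> remains to be
  integrated.\<close>

lemma coll_op_Linf_le:
  assumes [measurable]: "W \<in> borel_measurable M" "A \<in> borel_measurable M" "B \<in> borel_measurable M"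
    and AB: "\<And>z. A z \<bullet> B z = 0"
    and N: "\<And>v. (\<integral>\<^sup>+z. W z * ennreal (exp (- (norm (v + A z + B z))\<^sup>2 / 2)) \<partial>M) \<le> ennreal (c1 * (1 + norm v) powr \<gamma>)"
    and F: "\<And>v. F v \<le> ennreal (f * (1 + norm v) powr (- \<beta>))"
    and G: "\<And>v. G v \<le> ennreal (g * (1 + norm v) powr (- \<beta>))" 
    and c: "c1 \<ge> 0" "f \<ge> 0" "g \<ge> 0" "\<beta> \<ge> 0"
  shows "coll_op M W A B F G v \<le> ennreal (c1 * f * g * (1 + norm v) powr (\<gamma> - \<beta>))"
proof -
  have "coll_op M W A B F G v \<le> (\<integral>\<^sup>+z. ennreal (f * g * (1 + norm v) powr (- \<beta>)) * (W z * ennreal (exp (- (norm (v + A z + B z))\<^sup>2 / 2))) \<partial>M)"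
    unfolding coll_op_def
  proof (rule nn_integral_mono)
    fix z
    have "F (v + A z) * G (v + B z) \<le> ennreal (f * (1 + norm (v + A z)) powr (- \<beta>)) * ennreal (g * (1 + norm (v + B z)) powr (- \<beta>))"
      by (intro mult_mono F G) auto
    also have "\<dots> = ennreal (f * g * ((1 + norm (v + A z)) * (1 + norm (v + B z))) powr (- \<beta>))"
      using c norm_ge_zero[of "v + A z"] norm_ge_zero[of "v + B z"]
      by (subst powr_mult) (auto simp: ennreal_mult[symmetric] mult_ac)
    also have "\<dots> \<le> ennreal (f * g * (1 + norm v) powr (- \<beta>))"
      using c one_plus_norm_le_of_orthogonal[OF AB[of z], of v] 
      by (intro ennreal_leI mult_left_mono powr_mono2') (auto intro: add_pos_nonneg)
    finally show "W z * ennreal (exp (- (norm (v + A z + B z))\<^sup>2 / 2)) * (F (v + A z) * G (v + B z))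
       \<le> ennreal (f * g * (1 + norm v) powr (- \<beta>)) * (W z * ennreal (exp (- (norm (v + A z + B z))\<^sup>2 / 2)))"
      by (metis (no_types, lifting) mult.commute mult_left_mono zero_le)
  qed
  also have "\<dots> = ennreal (f * g * (1 + norm v) powr (- \<beta>)) * (\<integral>\<^sup>+z. W z * ennreal (exp (- (norm (v + A z + B z))\<^sup>2 / 2)) \<partial>M)"
    by (rule nn_integral_cmult) measurable
  also have "\<dots> \<le> ennreal (f * g * (1 + norm v) powr (- \<beta>)) * ennreal (c1 * (1 + norm v) powr \<gamma>)"
    by (rule mult_left_mono[OF N]) simp
  also have "\<dots> = ennreal (c1 * f * g * (1 + norm v) powr (\<gamma> - \<beta>))"
    using c by (simp add: ennreal_mult[symmetric] powr_diff powr_minus divide_inverse mult_ac)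
  finally show ?thesis .
qed

section \<open>The concrete gain and loss operators\<close>

text \<open>Parameters are z = (u, \<phi>, \<theta>) with the relative velocity \<open>u\<close> in
  place of \<open>v\<^sub>*\<close>, which makes the shifts independent of \<open>v\<close>. The
  factor cos \<theta> replaces b (cos \<theta>), with its constant split off.\<close>

definition coll_weight :: "real \<Rightarrow> R3 \<times> real \<times> real \<Rightarrow> ennreal" where
  "coll_weight \<gamma> z = ennreal (norm (fst z) powr \<gamma> * (cos (snd (snd z)) * sin (snd (snd z)))) * indicator collision_domain z"

definition gain_shift :: "(R3 \<Rightarrow> R3) \<Rightarrow> (R3 \<Rightarrow> R3) \<Rightarrow> R3 \<times> real \<times> real \<Rightarrow> R3" where
  "gain_shift e2 e3 z = frame_dir e2 e3 (cos (snd (snd z))) (sin (snd (snd z))) (fst z) (fst (snd z))"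

definition gain_coshift :: "(R3 \<Rightarrow> R3) \<Rightarrow> (R3 \<Rightarrow> R3) \<Rightarrow> R3 \<times> real \<times> real \<Rightarrow> R3" where
  "gain_coshift e2 e3 z = frame_dir e2 e3 (sin (snd (snd z))) (- cos (snd (snd z))) (fst z) (fst (snd z))"

lemma collision_domain_borel [measurable]: "collision_domain \<in> sets borel"
  unfolding collision_domain_def
  by (intro borel_open open_Times) auto

lemma coll_weight_measurable [measurable]: "coll_weight \<gamma> \<in> borel_measurable borel"
  unfolding coll_weight_def borel_prod[symmetric] by (measurable, simp add: borel_prod)

lemma gain_shift_measurable:
  assumes "collision_frame e2 e3"
  shows "gain_shift e2 e3 \<in> borel_measurable borel" "gain_coshift e2 e3 \<in> borel_measurable borel"
proof -
  have [measurable]: "e2 \<in> borel_measurable borel" "e3 \<in> borel_measurable borel"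
    using assms by (auto simp: collision_frame_def)
  show "gain_shift e2 e3 \<in> borel_measurable borel" "gain_coshift e2 e3 \<in> borel_measurable borel"
    unfolding gain_shift_def gain_coshift_def frame_dir_def borel_prod[symmetric] by measurable
qed

lemma gain_shift_add: "gain_shift e2 e3 z + gain_coshift e2 e3 z = fst z"
  using frame_dir_complement[of "cos (snd (snd z))" "sin (snd (snd z))" "fst z" e2 e3 "fst (snd z)"]
  by (simp add: gain_shift_def gain_coshift_def algebra_simps)

text \<open>The lengths are |cos \<theta>| |u| and |sin \<theta>| |u|, and the sum of the two
  vectors is \<open>u\<close>; comparing squared lengths leaves no room for a cross term.\<close>

lemma gain_shift_orthogonal:
  assumes "collision_frame e2 e3"
  shows "gain_shift e2 e3 z \<bullet> gain_coshift e2 e3 z = 0"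
proof -
  define c s where "c = cos (snd (snd z))" and "s = sin (snd (snd z))"
  have cs: "c\<^sup>2 + s\<^sup>2 = 1" "s\<^sup>2 + (-c)\<^sup>2 = 1" by (simp_all add: c_def s_def)
  have "(norm (fst z))\<^sup>2 = (norm (gain_shift e2 e3 z))\<^sup>2 + (norm (gain_coshift e2 e3 z))\<^sup>2
      + 2 * (gain_shift e2 e3 z \<bullet> gain_coshift e2 e3 z)"
    unfolding gain_shift_add[of e2 e3 z, symmetric]
    by (simp add: power2_norm_eq_inner inner_add_left inner_add_right inner_commute)
  moreover have "norm (gain_shift e2 e3 z) = \<bar>c\<bar> * norm (fst z)" "norm (gain_coshift e2 e3 z) = \<bar>s\<bar> * norm (fst z)"
    using norm_frame_dir[OF assms cs(1)] norm_frame_dir[OF assms cs(2)]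
    by (simp_all add: gain_shift_def gain_coshift_def c_def s_def)
  ultimately have "(norm (fst z))\<^sup>2 = (c\<^sup>2 + s\<^sup>2) * (norm (fst z))\<^sup>2 + 2 * (gain_shift e2 e3 z \<bullet> gain_coshift e2 e3 z)"
    by (simp add: power_mult_distrib distrib_right)
  then show ?thesis using cs by simp
qed

text \<open>\<theta> is placed outermost because the gain bounds are proved for each \<theta>,
  uniformly.\<close>

lemma nn_integral_lborel_triple:
  fixes f :: "R3 \<times> real \<times> real \<Rightarrow> ennreal"
  assumes [measurable]: "f \<in> borel_measurable borel"
  shows "(\<integral>\<^sup>+z. f z \<partial>lborel) = (\<integral>\<^sup>+\<theta>. \<integral>\<^sup>+u. \<integral>\<^sup>+\<phi>. f (u, \<phi>, \<theta>) \<partial>lborel \<partial>lborel \<partial>lborel)"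
proof -
  have [measurable]: "f \<in> borel_measurable (borel \<Otimes>\<^sub>M (borel \<Otimes>\<^sub>M borel))" by (simp add: borel_prod)
  have "(\<integral>\<^sup>+z. f z \<partial>lborel) = (\<integral>\<^sup>+u. \<integral>\<^sup>+y. f (u, y) \<partial>lborel \<partial>lborel)"
    using lborel.nn_integral_fst[of f lborel] assms by (simp add: lborel_prod)
  also have "\<dots> = (\<integral>\<^sup>+u. \<integral>\<^sup>+\<phi>. \<integral>\<^sup>+\<theta>. f (u, \<phi>, \<theta>) \<partial>lborel \<partial>lborel \<partial>lborel)"
  proof (rule nn_integral_cong)
    fix u :: R3
    have "(\<lambda>y. f (u, y)) \<in> borel_measurable borel" unfolding borel_prod[symmetric] by measurable
    then show "(\<integral>\<^sup>+y. f (u, y) \<partial>lborel) = (\<integral>\<^sup>+\<phi>. \<integral>\<^sup>+\<theta>. f (u, \<phi>, \<theta>) \<partial>lborel \<partial>lborel)"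
      using lborel.nn_integral_fst[of "\<lambda>y. f (u, y)" lborel] by (simp add: lborel_prod)
  qed
  also have "\<dots> = (\<integral>\<^sup>+u. \<integral>\<^sup>+\<theta>. \<integral>\<^sup>+\<phi>. f (u, \<phi>, \<theta>) \<partial>lborel \<partial>lborel \<partial>lborel)"
    by (intro nn_integral_cong lborel_pair.Fubini'[symmetric]) measurable
  also have "\<dots> = (\<integral>\<^sup>+\<theta>. \<integral>\<^sup>+u. \<integral>\<^sup>+\<phi>. f (u, \<phi>, \<theta>) \<partial>lborel \<partial>lborel \<partial>lborel)"
    by (rule lborel_pair.Fubini'[symmetric]) measurable
  finally show ?thesis .
qed

text \<open>When the integrand depends on \<open>u\<close> alone, cos \<theta> sin \<theta> \<le> 1
  and the angles contribute the area 2 pi times pi / 2.\<close>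

lemma coll_weight_integral_radial_le:
  fixes f :: "R3 \<Rightarrow> ennreal"
  assumes [measurable]: "f \<in> borel_measurable borel"
  shows "(\<integral>\<^sup>+z. coll_weight \<gamma> z * f (fst z) \<partial>lborel) \<le> ennreal (pi\<^sup>2) * (\<integral>\<^sup>+u. ennreal (norm u powr \<gamma>) * f u \<partial>lborel)"
proof -
  have m[measurable]: "(\<lambda>z::R3\<times>real\<times>real. f (fst z)) \<in> borel_measurable borel"
    unfolding borel_prod[symmetric] by measurable
  define I where "I = (\<integral>\<^sup>+u. ennreal (norm u powr \<gamma>) * f u \<partial>lborel)"
  have "(\<integral>\<^sup>+z. coll_weight \<gamma> z * f (fst z) \<partial>lborel)
    \<le> (\<integral>\<^sup>+\<theta>. \<integral>\<^sup>+u. \<integral>\<^sup>+\<phi>. indicator {0<..<pi/2} \<theta> * ((ennreal (norm u powr \<gamma>) * f u) * indicator {0<..<2*pi} \<phi>) \<partial>lborel \<partial>lborel \<partial>lborel)"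
  proof (subst nn_integral_lborel_triple, measurable, intro nn_integral_mono)
    fix \<theta> \<phi> :: real and u :: R3
    have "cos \<theta> * sin \<theta> \<le> 1" if "0 < \<theta>" "\<theta> < pi/2"
      using that sin_gt_zero2[of \<theta>] cos_gt_zero_pi[of \<theta>] by (intro mult_le_one) auto
    then have "norm u powr \<gamma> * (cos \<theta> * sin \<theta>) \<le> norm u powr \<gamma>" if "0 < \<theta>" "\<theta> < pi/2"
      using that by (intro mult_left_le) auto
    then show "coll_weight \<gamma> (u, \<phi>, \<theta>) * f (fst (u, \<phi>, \<theta>))
      \<le> indicator {0<..<pi/2} \<theta> * ((ennreal (norm u powr \<gamma>) * f u) * indicator {0<..<2*pi} \<phi>)"
      by (auto simp: coll_weight_def collision_domain_def split: split_indicator intro!: mult_right_mono ennreal_leI)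
  qed
  also have "\<dots> = (\<integral>\<^sup>+\<theta>. \<integral>\<^sup>+u. (indicator {0<..<pi/2} \<theta> * ennreal (2*pi)) * (ennreal (norm u powr \<gamma>) * f u) \<partial>lborel \<partial>lborel)"
  proof (intro nn_integral_cong)
    fix \<theta> :: real and u :: R3
    have "(\<integral>\<^sup>+\<phi>. indicator {0<..<pi/2} \<theta> * ((ennreal (norm u powr \<gamma>) * f u) * indicator {0<..<2*pi} \<phi>) \<partial>lborel)
      = (\<integral>\<^sup>+\<phi>. (indicator {0<..<pi/2} \<theta> * (ennreal (norm u powr \<gamma>) * f u)) * indicator {0<..<2*pi} \<phi> \<partial>lborel)"
      by (simp add: mult.assoc)
    also have "\<dots> = (indicator {0<..<pi/2} \<theta> * ennreal (2*pi)) * (ennreal (norm u powr \<gamma>) * f u)"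
      by (subst nn_integral_cmult_indicator) (simp_all add: mult_ac)
    finally show "(\<integral>\<^sup>+\<phi>. indicator {0<..<pi/2} \<theta> * ((ennreal (norm u powr \<gamma>) * f u) * indicator {0<..<2*pi} \<phi>) \<partial>lborel) = \<dots>" .
  qed
  also have "\<dots> = (\<integral>\<^sup>+\<theta>. (ennreal (2*pi) * I) * indicator {0<..<pi/2} \<theta> \<partial>lborel)"
    by (intro nn_integral_cong, subst nn_integral_cmult) (simp_all add: I_def mult_ac)
  also have "\<dots> = (ennreal (2*pi) * I) * ennreal (pi/2)"
    by (subst nn_integral_cmult_indicator) simp_all
  also have "\<dots> = (ennreal (2*pi) * ennreal (pi/2)) * I" by (simp add: mult_ac)
  also have "ennreal (2*pi) * ennreal (pi/2) = ennreal (pi\<^sup>2)"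
    by (subst ennreal_mult[symmetric]) (simp_all add: power2_eq_square)
  finally show ?thesis by (simp add: I_def)
qed

text \<open>The bound for fixed \<theta> is uniform, so integrating it costs the length pi / 2 of
  the \<theta>-interval.\<close>

lemma coll_weight_integral_angular_le:
  fixes f :: "R3 \<times> real \<times> real \<Rightarrow> ennreal"
  assumes [measurable]: "f \<in> borel_measurable borel"
    and b: "\<And>\<theta>. 0 < \<theta> \<Longrightarrow> \<theta> < pi/2 \<Longrightarrow>
      (\<integral>\<^sup>+u. (\<integral>\<^sup>+\<phi>\<in>{0<..<2*pi}. ennreal (norm u powr \<gamma> * (cos \<theta> * sin \<theta>)) * f (u, \<phi>, \<theta>) \<partial>lborel) \<partial>lborel) \<le> ennreal c"
    and c: "c \<ge> 0"
  shows "(\<integral>\<^sup>+z. coll_weight \<gamma> z * f z \<partial>lborel) \<le> ennreal (pi / 2 * c)"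
proof -
  have "(\<integral>\<^sup>+z. coll_weight \<gamma> z * f z \<partial>lborel) = (\<integral>\<^sup>+\<theta>. \<integral>\<^sup>+u. \<integral>\<^sup>+\<phi>. coll_weight \<gamma> (u, \<phi>, \<theta>) * f (u, \<phi>, \<theta>) \<partial>lborel \<partial>lborel \<partial>lborel)"
    by (rule nn_integral_lborel_triple) measurable
  also have "\<dots> \<le> (\<integral>\<^sup>+\<theta>. ennreal c * indicator {0<..<pi/2} \<theta> \<partial>lborel)"
  proof (rule nn_integral_mono)
    fix \<theta> :: real
    show "(\<integral>\<^sup>+u. \<integral>\<^sup>+\<phi>. coll_weight \<gamma> (u, \<phi>, \<theta>) * f (u, \<phi>, \<theta>) \<partial>lborel \<partial>lborel) \<le> ennreal c * indicator {0<..<pi/2} \<theta>"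
    proof (cases "0 < \<theta> \<and> \<theta> < pi/2")
      case True
      then have "coll_weight \<gamma> (u, \<phi>, \<theta>) * f (u, \<phi>, \<theta>) = ennreal (norm u powr \<gamma> * (cos \<theta> * sin \<theta>)) * f (u, \<phi>, \<theta>) * indicator {0<..<2*pi} \<phi>" for u \<phi>
        by (auto simp: coll_weight_def collision_domain_def split: split_indicator)
      then show ?thesis using b[of \<theta>] True by simp
    next
      case False
      then have "coll_weight \<gamma> (u, \<phi>, \<theta>) = 0" for u \<phi> by (auto simp: coll_weight_def collision_domain_def)
      then show ?thesis by simp
    qed
  qed
  also have "\<dots> = ennreal (pi / 2 * c)" using c
    by (subst nn_integral_cmult_indicator) (simp_all add: ennreal_mult[symmetric] mult.commute)
  finally show ?thesis .
qed

text \<open>Gain and loss are added although they are subtracted in \<open>Q\<close>: this operator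
  serves only as a majorant.\<close>

definition coll_sum :: "(R3 \<Rightarrow> R3) \<Rightarrow> (R3 \<Rightarrow> R3) \<Rightarrow> real \<Rightarrow> (R3 \<Rightarrow> ennreal) \<Rightarrow> (R3 \<Rightarrow> ennreal) \<Rightarrow> R3 \<Rightarrow> ennreal" where
  "coll_sum e2 e3 \<gamma> F G v =
     coll_op lborel (coll_weight \<gamma>) (gain_shift e2 e3) (gain_coshift e2 e3) F G v
     + coll_op lborel (coll_weight \<gamma>) (\<lambda>z. 0) fst F G v"

lemma ennreal_sum_squared_le: "(x + y)\<^sup>2 \<le> 2 * x\<^sup>2 + 2 * (y::ennreal)\<^sup>2"
proof (cases "x = top \<or> y = top")
  case False
  then obtain a b where ab: "x = ennreal a" "y = ennreal b" "a \<ge> 0" "b \<ge> 0"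
    by (metis enn2real_nonneg ennreal_enn2real_if)
  have "(a + b)\<^sup>2 \<le> 2 * a\<^sup>2 + 2 * b\<^sup>2"
    using zero_le_power2[of "a - b"] by (simp add: power2_eq_square algebra_simps)
  then have "ennreal ((a + b)\<^sup>2) \<le> ennreal (2 * a\<^sup>2 + 2 * b\<^sup>2)" by (rule ennreal_leI)
  moreover have "ennreal ((a + b)\<^sup>2) = (x + y)\<^sup>2" using ab by (simp add: ennreal_power flip: ennreal_plus)
  moreover have "ennreal (2 * a\<^sup>2 + 2 * b\<^sup>2) = 2 * x\<^sup>2 + 2 * y\<^sup>2" using ab by (simp add: ennreal_power ennreal_mult)
  ultimately show ?thesis by simp
qed (auto simp: power2_eq_square)

lemma coll_op_measurable:
  assumes "sigma_finite_measure M"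
    and [measurable]: "W \<in> borel_measurable M" "A \<in> borel_measurable M" "B \<in> borel_measurable M"
      "F \<in> borel_measurable borel" "G \<in> borel_measurable borel"
  shows "coll_op M W A B F G \<in> borel_measurable borel"
proof -
  interpret sigma_finite_measure M by fact
  show ?thesis unfolding coll_op_def by measurable
qed

text \<open>Bilinearity of the collision operator will leave one difference and one bounded factor
  in each term, and the difference may be in either slot. Hence there is one weighted L^2 bound for
  each argument besides the pointwise one. All reduce to the mass bound \<open>N0\<close> and to
  four kernels: gain or loss, with the squared factor in the first or second slot.\<close>

lemma coll_sum_bounds:
  fixes \<gamma> \<beta> :: real
  assumes fr: "collision_frame e2 e3" and \<gamma>: "-3 < \<gamma>" and \<beta>: "2 * \<beta> > 3 + \<gamma>"
  shows "\<exists>C>0.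
    (\<forall>F G f g v. (\<forall>v. F v \<le> ennreal (f * (1 + norm v) powr (- \<beta>))) \<longrightarrow> (\<forall>v. G v \<le> ennreal (g * (1 + norm v) powr (- \<beta>)))
       \<longrightarrow> f \<ge> 0 \<longrightarrow> g \<ge> 0 \<longrightarrow> coll_sum e2 e3 \<gamma> F G v \<le> ennreal (C * f * g * (1 + norm v) powr (\<gamma> - \<beta>))) \<and>
    (\<forall>F G g. F \<in> borel_measurable borel \<longrightarrow> G \<in> borel_measurable borel \<longrightarrow> (\<forall>v. G v \<le> ennreal (g * (1 + norm v) powr (- \<beta>))) \<longrightarrow> g \<ge> 0
       \<longrightarrow> (\<integral>\<^sup>+v. ennreal ((1 + norm v) powr (- \<gamma>)) * (coll_sum e2 e3 \<gamma> F G v)\<^sup>2 \<partial>lborel)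
          \<le> ennreal (C * g\<^sup>2) * (\<integral>\<^sup>+p. (F p)\<^sup>2 * ennreal ((1 + norm p) powr \<gamma>) \<partial>lborel)) \<and>
    (\<forall>F G f. F \<in> borel_measurable borel \<longrightarrow> G \<in> borel_measurable borel \<longrightarrow> (\<forall>v. F v \<le> ennreal (f * (1 + norm v) powr (- \<beta>))) \<longrightarrow> f \<ge> 0
       \<longrightarrow> (\<integral>\<^sup>+v. ennreal ((1 + norm v) powr (- \<gamma>)) * (coll_sum e2 e3 \<gamma> F G v)\<^sup>2 \<partial>lborel)
          \<le> ennreal (C * f\<^sup>2) * (\<integral>\<^sup>+p. (G p)\<^sup>2 * ennreal ((1 + norm p) powr \<gamma>) \<partial>lborel))"
proof -
  define W where "W = coll_weight \<gamma>"
  define a where "a = gain_shift e2 e3"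
  define c where "c = gain_coshift e2 e3"
  have ac: "a z + c z = fst z" for z unfolding a_def c_def by (rule gain_shift_add)
  have [measurable]: "W \<in> borel_measurable borel" "a \<in> borel_measurable borel" "c \<in> borel_measurable borel"
    "(fst :: R3 \<times> real \<times> real \<Rightarrow> R3) \<in> borel_measurable borel"
    unfolding W_def a_def c_def using gain_shift_measurable[OF fr] 
    by (auto intro!: borel_measurable_continuous_onI continuous_on_fst continuous_on_id)
  have \<beta>0: "\<beta> \<ge> 0" using \<beta> \<gamma> by simp
  obtain C1 where C1: "C1 > 0" "\<And>q::R3. (\<integral>\<^sup>+y. ennreal (norm y powr \<gamma> * exp (- (1/2) * (norm (q + y))\<^sup>2)) \<partial>lborel)
           \<le> ennreal (C1 * (1 + norm q) powr \<gamma>)"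
    using nn_integral_powr_gauss_le[where 'a = R3, of \<gamma> "1/2"] \<gamma> by auto
  obtain C2 where C2: "C2 > 0" "\<And>p::R3. (\<integral>\<^sup>+u. ennreal (norm u powr \<gamma> * (exp (- (norm p)\<^sup>2 / 2) * (1 + norm (p - u)) powr (- 2 * \<beta>))) \<partial>lborel)
     \<le> ennreal (C2 * (1 + norm p) powr \<gamma>)"
    using loss_weight_integral_le[OF \<gamma> \<beta>] by auto
  obtain C3 where C3: "C3 > 0" "\<And>e2 e3 l m p. collision_frame e2 e3 \<Longrightarrow> l > 0 \<Longrightarrow> l\<^sup>2 + m\<^sup>2 = 1 \<Longrightarrow>
    (\<integral>\<^sup>+u. (\<integral>\<^sup>+\<phi>\<in>{0<..<2*pi}. gain_density e2 e3 \<gamma> \<beta> l m p u \<phi> \<partial>lborel) \<partial>lborel)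
      \<le> ennreal (C3 * (1 + norm p) powr \<gamma>)"
    using gain_weight_integral_le[OF \<gamma> \<beta>] by auto
  define k where "k = pi\<^sup>2 * C1 + pi\<^sup>2 * C2 + pi / 2 * C3"
  have k: "pi\<^sup>2 * C1 \<le> k" "pi\<^sup>2 * C2 \<le> k" "pi / 2 * C3 \<le> k" "k > 0"
    using C1 C2 C3 by (auto simp: k_def add_pos_pos)
  have N0: "(\<integral>\<^sup>+z. W z * ennreal (exp (- (norm (v + fst z))\<^sup>2 / 2)) \<partial>lborel) \<le> ennreal (k * (1 + norm v) powr \<gamma>)" for v
  proof -
    have "(\<integral>\<^sup>+z. W z * ennreal (exp (- (norm (v + fst z))\<^sup>2 / 2)) \<partial>lborel) \<le> ennreal (pi\<^sup>2) * (\<integral>\<^sup>+u. ennreal (norm u powr \<gamma>) * ennreal (exp (- (norm (v + u))\<^sup>2 / 2)) \<partial>lborel)"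
      unfolding W_def by (rule coll_weight_integral_radial_le) measurable
    also have "\<dots> \<le> ennreal (pi\<^sup>2) * ennreal (C1 * (1 + norm v) powr \<gamma>)"
      using C1(2)[of v] by (intro mult_left_mono) (simp_all add: ennreal_mult)
    also have "\<dots> = ennreal (pi\<^sup>2 * C1 * (1 + norm v) powr \<gamma>)"
      using C1 by (simp add: ennreal_mult mult.assoc)
    also have "\<dots> \<le> ennreal (k * (1 + norm v) powr \<gamma>)" using k by (intro ennreal_leI mult_right_mono) auto
    finally show ?thesis .
  qed
  have Nac: "(\<integral>\<^sup>+z. W z * ennreal (exp (- (norm (v + a z + c z))\<^sup>2 / 2)) \<partial>lborel) \<le> ennreal (k * (1 + norm v) powr \<gamma>)" for v
    using N0[of v] by (simp add: add.assoc ac)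
  have Nca: "(\<integral>\<^sup>+z. W z * ennreal (exp (- (norm (v + c z + a z))\<^sup>2 / 2)) \<partial>lborel) \<le> ennreal (k * (1 + norm v) powr \<gamma>)" for v
    using N0[of v] by (simp add: add.assoc add.commute[of "c _"] ac)
  have N0u: "(\<integral>\<^sup>+z. W z * ennreal (exp (- (norm (v + 0 + fst z))\<^sup>2 / 2)) \<partial>lborel) \<le> ennreal (k * (1 + norm v) powr \<gamma>)" for v
    using N0[of v] by simp
  have Nu0: "(\<integral>\<^sup>+z. W z * ennreal (exp (- (norm (v + fst z + 0))\<^sup>2 / 2)) \<partial>lborel) \<le> ennreal (k * (1 + norm v) powr \<gamma>)" for v
    using N0[of v] by simp
  \<comment> \<open>Loss term with the squared factor at \<open>v\<close>: the Gaussian at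
    \<open>v\<^sub>*\<close> already integrates, and the decay is simply dropped.\<close>
  have J0u: "(\<integral>\<^sup>+z. W z * ennreal (exp (- (norm (p + fst z))\<^sup>2 / 2) * (1 + norm (p + fst z - 0)) powr (- 2 * \<beta>)) \<partial>lborel) \<le> ennreal (k * (1 + norm p) powr \<gamma>)" for p
  proof -
    have "(1 + norm x) powr (- 2 * \<beta>) \<le> 1" for x :: R3
      using \<beta>0 norm_ge_zero[of x] by (simp add: powr_minus inverse_le_1_iff ge_one_powr_ge_zero)
    then have "(\<integral>\<^sup>+z. W z * ennreal (exp (- (norm (p + fst z))\<^sup>2 / 2) * (1 + norm (p + fst z - 0)) powr (- 2 * \<beta>)) \<partial>lborel)
      \<le> (\<integral>\<^sup>+z. W z * ennreal (exp (- (norm (p + fst z))\<^sup>2 / 2)) \<partial>lborel)"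
      by (intro nn_integral_mono mult_left_mono ennreal_leI mult_left_le) auto
    then show ?thesis using N0[of p] by (rule order_trans)
  qed
  \<comment> \<open>Loss term with the squared factor at \<open>v\<^sub>*\<close>, the case in which
    the Gaussian does not depend on \<open>u\<close>.\<close>
  have Ju0: "(\<integral>\<^sup>+z. W z * ennreal (exp (- (norm (p + 0))\<^sup>2 / 2) * (1 + norm (p + 0 - fst z)) powr (- 2 * \<beta>)) \<partial>lborel) \<le> ennreal (k * (1 + norm p) powr \<gamma>)" for p
  proof -
    have "(\<integral>\<^sup>+z. W z * ennreal (exp (- (norm p)\<^sup>2 / 2) * (1 + norm (p - fst z)) powr (- 2 * \<beta>)) \<partial>lborel) \<le>
      ennreal (pi\<^sup>2) * (\<integral>\<^sup>+u. ennreal (norm u powr \<gamma>) * ennreal (exp (- (norm p)\<^sup>2 / 2) * (1 + norm (p - u)) powr (- 2 * \<beta>)) \<partial>lborel)"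
      unfolding W_def by (rule coll_weight_integral_radial_le) measurable
    also have "\<dots> \<le> ennreal (pi\<^sup>2) * ennreal (C2 * (1 + norm p) powr \<gamma>)"
      using C2(2)[of p] by (intro mult_left_mono) (simp_all add: ennreal_mult)
    also have "\<dots> = ennreal (pi\<^sup>2 * C2 * (1 + norm p) powr \<gamma>)"
      using C2 by (simp add: ennreal_mult mult.assoc)
    also have "\<dots> \<le> ennreal (k * (1 + norm p) powr \<gamma>)" using k by (intro ennreal_leI mult_right_mono) auto
    finally show ?thesis by simp
  qed
  have fin: "ennreal (pi / 2 * (C3 * (1 + norm p) powr \<gamma>)) \<le> ennreal (k * (1 + norm p) powr \<gamma>)" for p :: R3
    using k mult_right_mono[OF k(3), of "(1 + norm p) powr \<gamma>"] by (intro ennreal_leI) (simp add: mult.assoc)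
  \<comment> \<open>Squared factor at \<open>v'\<close>: the small-deflection parameter is l = sin
    \<theta>, so grazing of the complementary shift occurs as \<theta> tends to 0.\<close>
  have Jac: "(\<integral>\<^sup>+z. W z * ennreal (exp (- (norm (p + c z))\<^sup>2 / 2) * (1 + norm (p + c z - a z)) powr (- 2 * \<beta>)) \<partial>lborel) \<le> ennreal (k * (1 + norm p) powr \<gamma>)" for p
  proof (rule order_trans[OF _ fin], unfold W_def, rule coll_weight_integral_angular_le)
    fix \<theta> :: real assume th: "0 < \<theta>" "\<theta> < pi/2"
    have s: "sin \<theta> > 0" "cos \<theta> > 0" using th sin_gt_zero2[of \<theta>] cos_gt_zero_pi[of \<theta>] by auto
    show "(\<integral>\<^sup>+u. (\<integral>\<^sup>+\<phi>\<in>{0<..<2*pi}. ennreal (norm u powr \<gamma> * (cos \<theta> * sin \<theta>)) * 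
       ennreal (exp (- (norm (p + c (u, \<phi>, \<theta>)))\<^sup>2 / 2) * (1 + norm (p + c (u, \<phi>, \<theta>) - a (u, \<phi>, \<theta>))) powr (- 2 * \<beta>)) \<partial>lborel) \<partial>lborel)
       \<le> ennreal (C3 * (1 + norm p) powr \<gamma>)"
      using C3(2)[OF fr, of "sin \<theta>" "- cos \<theta>" p] s
      by (simp add: a_def c_def gain_shift_def gain_coshift_def frame_dir_def mult.commute)
  qed (use C3 in simp_all)
  \<comment> \<open>Squared factor at \<open>v\<^sub>*'\<close>: now l = cos \<theta>, and it is the
    factor cos \<theta> in the bound for \<open>b\<close> that controls \<theta> near pi /
    2.\<close>
  have Jca: "(\<integral>\<^sup>+z. W z * ennreal (exp (- (norm (p + a z))\<^sup>2 / 2) * (1 + norm (p + a z - c z)) powr (- 2 * \<beta>)) \<partial>lborel) \<le> ennreal (k * (1 + norm p) powr \<gamma>)" for p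
  proof (rule order_trans[OF _ fin], unfold W_def, rule coll_weight_integral_angular_le)
    fix \<theta> :: real assume th: "0 < \<theta>" "\<theta> < pi/2"
    have s: "sin \<theta> > 0" "cos \<theta> > 0" using th sin_gt_zero2[of \<theta>] cos_gt_zero_pi[of \<theta>] by auto
    show "(\<integral>\<^sup>+u. (\<integral>\<^sup>+\<phi>\<in>{0<..<2*pi}. ennreal (norm u powr \<gamma> * (cos \<theta> * sin \<theta>)) * 
       ennreal (exp (- (norm (p + a (u, \<phi>, \<theta>)))\<^sup>2 / 2) * (1 + norm (p + a (u, \<phi>, \<theta>) - c (u, \<phi>, \<theta>))) powr (- 2 * \<beta>)) \<partial>lborel) \<partial>lborel)
       \<le> ennreal (C3 * (1 + norm p) powr \<gamma>)"
      using C3(2)[OF fr, of "cos \<theta>" "sin \<theta>" p] s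
      by (simp add: a_def c_def gain_shift_def gain_coshift_def)
  qed (use C3 in simp_all)
  have sf: "sigma_finite_measure (lborel :: (R3 \<times> real \<times> real) measure)" by standard
  have two: "(\<integral>\<^sup>+v. ennreal ((1 + norm v) powr (- \<gamma>)) * (coll_sum e2 e3 \<gamma> F G v)\<^sup>2 \<partial>lborel) \<le> ennreal (4 * k * k * g\<^sup>2) * X"
    if [measurable]: "F \<in> borel_measurable borel" "G \<in> borel_measurable borel" and
      "(\<integral>\<^sup>+v. ennreal ((1 + norm v) powr (- \<gamma>)) * (coll_op lborel W a c F G v)\<^sup>2 \<partial>lborel) \<le> ennreal (k * k * g\<^sup>2) * X"
      "(\<integral>\<^sup>+v. ennreal ((1 + norm v) powr (- \<gamma>)) * (coll_op lborel W (\<lambda>z. 0) fst F G v)\<^sup>2 \<partial>lborel) \<le> ennreal (k * k * g\<^sup>2) * X" for F G g X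
  proof -
    have [measurable]: "coll_op lborel W a c F G \<in> borel_measurable borel" "coll_op lborel W (\<lambda>z. 0) fst F G \<in> borel_measurable borel"
      by (intro coll_op_measurable sf; simp)+
    have "(\<integral>\<^sup>+v. ennreal ((1 + norm v) powr (- \<gamma>)) * (coll_sum e2 e3 \<gamma> F G v)\<^sup>2 \<partial>lborel)
      \<le> (\<integral>\<^sup>+v. 2 * (ennreal ((1 + norm v) powr (- \<gamma>)) * (coll_op lborel W a c F G v)\<^sup>2)
         + 2 * (ennreal ((1 + norm v) powr (- \<gamma>)) * (coll_op lborel W (\<lambda>z. 0) fst F G v)\<^sup>2) \<partial>lborel)"
    proof (rule nn_integral_mono)
      fix v
      show "ennreal ((1 + norm v) powr (- \<gamma>)) * (coll_sum e2 e3 \<gamma> F G v)\<^sup>2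
        \<le> 2 * (ennreal ((1 + norm v) powr (- \<gamma>)) * (coll_op lborel W a c F G v)\<^sup>2)
         + 2 * (ennreal ((1 + norm v) powr (- \<gamma>)) * (coll_op lborel W (\<lambda>z. 0) fst F G v)\<^sup>2)"
        unfolding coll_sum_def W_def[symmetric] a_def[symmetric] c_def[symmetric]
        using mult_left_mono[OF ennreal_sum_squared_le[of "coll_op lborel W a c F G v" "coll_op lborel W (\<lambda>z. 0) fst F G v"], of "ennreal ((1 + norm v) powr (- \<gamma>))"]
        by (simp add: distrib_left mult_ac)
    qed
    also have "\<dots> \<le> 2 * (ennreal (k * k * g\<^sup>2) * X) + 2 * (ennreal (k * k * g\<^sup>2) * X)"
      using that(3,4) by (simp add: nn_integral_add nn_integral_cmult add_mono mult_left_mono)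
    also have "\<dots> = ennreal (4 * (k * k * g\<^sup>2)) * X"
      using k by (simp add: ennreal_mult mult.assoc flip: distrib_right)
    finally show ?thesis by (simp add: mult.assoc)
  qed
  \<comment> \<open>The summand 2 k serves the pointwise bound for the sum of two operators; 4 k^2
    serves the L^2 bounds, where the square of the sum adds a factor 2 to each of the two
    terms.\<close>
  define C where "C = 4 * k * k + 2 * k"
  have C: "2 * k \<le> C" "4 * k * k \<le> C" "C > 0" using k by (auto simp: C_def add_pos_pos)
  have up: "ennreal (4 * k * k * g\<^sup>2) * X \<le> ennreal (C * g\<^sup>2) * X" for g X
    using C by (intro mult_right_mono ennreal_leI) auto
  show ?thesis
  proof (intro exI[of _ C] conjI allI impI)
    fix F G :: "R3 \<Rightarrow> ennreal" and f g :: real and v :: R3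
    assume b: "\<forall>v. F v \<le> ennreal (f * (1 + norm v) powr (- \<beta>))" "\<forall>v. G v \<le> ennreal (g * (1 + norm v) powr (- \<beta>))" "0 \<le> f" "0 \<le> g"
    have "coll_op lborel W a c F G v \<le> ennreal (k * f * g * (1 + norm v) powr (\<gamma> - \<beta>))"
      by (rule coll_op_Linf_le) (use b k \<beta>0 Nac gain_shift_orthogonal[OF fr] gain_shift_measurable[OF fr] in \<open>simp_all add: a_def c_def\<close>)
    moreover have "coll_op lborel W (\<lambda>z. 0) fst F G v \<le> ennreal (k * f * g * (1 + norm v) powr (\<gamma> - \<beta>))"
      by (rule coll_op_Linf_le) (use b k \<beta>0 N0u in simp_all)
    ultimately have "coll_sum e2 e3 \<gamma> F G v \<le> ennreal (k * f * g * (1 + norm v) powr (\<gamma> - \<beta>)) + ennreal (k * f * g * (1 + norm v) powr (\<gamma> - \<beta>))"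
      unfolding coll_sum_def W_def[symmetric] a_def[symmetric] c_def[symmetric] by (rule add_mono)
    also have "\<dots> = ennreal ((2 * k) * (f * g * (1 + norm v) powr (\<gamma> - \<beta>)))"
      using k b by (subst ennreal_plus[symmetric]) (auto simp: algebra_simps)
    also have "\<dots> \<le> ennreal (C * (f * g * (1 + norm v) powr (\<gamma> - \<beta>)))"
      using C b by (intro ennreal_leI mult_right_mono) auto
    finally show "coll_sum e2 e3 \<gamma> F G v \<le> ennreal (C * f * g * (1 + norm v) powr (\<gamma> - \<beta>))" by (simp add: mult.assoc)
  next
    fix F G :: "R3 \<Rightarrow> ennreal" and g :: real
    assume m[measurable]: "F \<in> borel_measurable borel" "G \<in> borel_measurable borel" and b: "\<forall>v. G v \<le> ennreal (g * (1 + norm v) powr (- \<beta>))" "0 \<le> g"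
    show "(\<integral>\<^sup>+v. ennreal ((1 + norm v) powr (- \<gamma>)) * (coll_sum e2 e3 \<gamma> F G v)\<^sup>2 \<partial>lborel)
          \<le> ennreal (C * g\<^sup>2) * (\<integral>\<^sup>+p. (F p)\<^sup>2 * ennreal ((1 + norm p) powr \<gamma>) \<partial>lborel)"
    proof (rule order_trans[OF two up])
      show "(\<integral>\<^sup>+v. ennreal ((1 + norm v) powr (- \<gamma>)) * (coll_op lborel W a c F G v)\<^sup>2 \<partial>lborel) \<le> ennreal (k * k * g\<^sup>2) * (\<integral>\<^sup>+p. (F p)\<^sup>2 * ennreal ((1 + norm p) powr \<gamma>) \<partial>lborel)"
        by (rule coll_op_L2_le[OF sf _ _ _ _ _ Nac Jac]) (use b k in simp_all)
      show "(\<integral>\<^sup>+v. ennreal ((1 + norm v) powr (- \<gamma>)) * (coll_op lborel W (\<lambda>z. 0) fst F G v)\<^sup>2 \<partial>lborel) \<le> ennreal (k * k * g\<^sup>2) * (\<integral>\<^sup>+p. (F p)\<^sup>2 * ennreal ((1 + norm p) powr \<gamma>) \<partial>lborel)"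
        by (rule coll_op_L2_le[OF sf _ _ _ _ _ N0u J0u]) (use b k in simp_all)
    qed (rule m)+
  next
    fix F G :: "R3 \<Rightarrow> ennreal" and f :: real
    assume m[measurable]: "F \<in> borel_measurable borel" "G \<in> borel_measurable borel" and b: "\<forall>v. F v \<le> ennreal (f * (1 + norm v) powr (- \<beta>))" "0 \<le> f"
    show "(\<integral>\<^sup>+v. ennreal ((1 + norm v) powr (- \<gamma>)) * (coll_sum e2 e3 \<gamma> F G v)\<^sup>2 \<partial>lborel)
          \<le> ennreal (C * f\<^sup>2) * (\<integral>\<^sup>+p. (G p)\<^sup>2 * ennreal ((1 + norm p) powr \<gamma>) \<partial>lborel)"
    proof (rule order_trans[OF two up])
      show "(\<integral>\<^sup>+v. ennreal ((1 + norm v) powr (- \<gamma>)) * (coll_op lborel W a c F G v)\<^sup>2 \<partial>lborel) \<le> ennreal (k * k * f\<^sup>2) * (\<integral>\<^sup>+p. (G p)\<^sup>2 * ennreal ((1 + norm p) powr \<gamma>) \<partial>lborel)"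
        unfolding coll_op_commute[of _ _ a]
        by (rule coll_op_L2_le[OF sf _ _ _ _ _ Nca Jca]) (use b k in simp_all)
      show "(\<integral>\<^sup>+v. ennreal ((1 + norm v) powr (- \<gamma>)) * (coll_op lborel W (\<lambda>z. 0) fst F G v)\<^sup>2 \<partial>lborel) \<le> ennreal (k * k * f\<^sup>2) * (\<integral>\<^sup>+p. (G p)\<^sup>2 * ennreal ((1 + norm p) powr \<gamma>) \<partial>lborel)"
        unfolding coll_op_commute[of _ _ "\<lambda>z. 0"]
        by (rule coll_op_L2_le[OF sf _ _ _ _ _ Nu0 Ju0]) (use b k in simp_all)
    qed (rule m)+
  qed (rule C)
qed

section \<open>The collision integrand of \<Gamma>\<close>

text \<open>Since \<open>u \<bullet> \<omega>\<close> is |u| cos \<theta>, the vector added to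
  \<open>v\<close> is the deflection with l = cos \<theta> and m = sin \<theta>. For u = 0 both
  sides are \<open>v\<close>, whatever the frame does there.\<close>

lemma post_v_eq:
  assumes fr: "collision_frame e2 e3"
  shows "post_v (collision_dir e2 e3 u \<phi> \<theta>) v (v + u) = v + gain_shift e2 e3 (u, \<phi>, \<theta>)"
proof (cases "u = 0")
  case False
  note f = collision_frameD[OF fr False]
  have "u \<bullet> collision_dir e2 e3 u \<phi> \<theta> = norm u * cos \<theta>"
    using False f by (simp add: collision_dir_def inner_add_right power2_norm_eq_inner[symmetric] power2_eq_square field_simps)
  then show ?thesis
    using False by (simp add: post_v_def gain_shift_def frame_dir_def collision_dir_def scaleR_add_right mult_ac)
qed (simp add: post_v_def gain_shift_def frame_dir_def)

lemma post_vs_eq: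
  assumes fr: "collision_frame e2 e3"
  shows "post_vs (collision_dir e2 e3 u \<phi> \<theta>) v (v + u) = v + gain_coshift e2 e3 (u, \<phi>, \<theta>)"
proof -
  have "post_vs w v (v + u) = v + u - (post_v w v (v + u) - v)" for w by (simp add: post_v_def post_vs_def)
  moreover have "gain_coshift e2 e3 (u, \<phi>, \<theta>) = u - gain_shift e2 e3 (u, \<phi>, \<theta>)"
    using gain_shift_add[of e2 e3 "(u, \<phi>, \<theta>)"] by (simp add: eq_diff_eq add.commute)
  ultimately show ?thesis by (simp add: post_v_eq[OF fr])
qed

lemma Maxwellian_powr_half: "Maxwellian w powr (1/2) = pi powr (-3/4) * exp (- (norm w)\<^sup>2 / 2)"
proof -
  have "exp (- (norm w)\<^sup>2) powr (1/2) = exp (- (norm w)\<^sup>2 / 2)" by (simp add: powr_def)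
  then show ?thesis unfolding Maxwellian_def by (simp add: powr_mult powr_powr)
qed

lemma Maxwellian_powr_minus_half: "Maxwellian w powr (-1/2) * Maxwellian w powr (1/2) = 1"
proof -
  have "Maxwellian w \<noteq> 0" by (simp add: Maxwellian_def)
  then show ?thesis by (simp flip: powr_add)
qed

text \<open>Pythagoras for orthogonal shifts is conservation of energy, and the Maxwellian is
  exponential in the energy.\<close>

lemma Maxwellian_collision:
  assumes "a \<bullet> c = 0"
  shows "Maxwellian (v + a) powr (1/2) * Maxwellian (v + c) powr (1/2)
     = Maxwellian v powr (1/2) * Maxwellian (v + (a + c)) powr (1/2)"
proof -
  have "(norm (v + a))\<^sup>2 + (norm (v + c))\<^sup>2 = (norm v)\<^sup>2 + (norm (v + (a + c)))\<^sup>2"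
    using assms by (simp add: power2_norm_eq_inner inner_add_left inner_add_right inner_commute)
  then show ?thesis
    unfolding Maxwellian_powr_half by (simp add: mult_ac add_divide_distrib[symmetric] flip: exp_add)
qed

abbreviation mw :: "(R3 \<Rightarrow> real) \<Rightarrow> R3 \<Rightarrow> real" where
  "mw k \<equiv> \<lambda>w. Maxwellian w powr (1/2) * k w"

abbreviation Gam_integrand :: "real \<Rightarrow> (real \<Rightarrow> real) \<Rightarrow> (R3 \<Rightarrow> R3) \<Rightarrow> (R3 \<Rightarrow> R3) \<Rightarrow> (R3 \<Rightarrow> real) \<Rightarrow> (R3 \<Rightarrow> real) \<Rightarrow> R3
    \<Rightarrow> R3 \<times> real \<times> real \<Rightarrow> real" where
  "Gam_integrand \<gamma> b e2 e3 k1 k2 v z \<equiv> Maxwellian v powr (-1/2) * collision_integrand \<gamma> b e2 e3 (mw k1) (mw k2) v z"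

text \<open>Conservation of momentum and energy move the Maxwellian weight onto the partner velocity.\<close>

lemma weighted_collision_integrand_eq:
  assumes fr: "collision_frame e2 e3"
  shows "Gam_integrand \<gamma> b e2 e3 k1 k2 v (v + u, \<phi>, \<theta>) =
    Maxwellian (v + u) powr (1/2) * (k1 (v + gain_shift e2 e3 (u, \<phi>, \<theta>)) * k2 (v + gain_coshift e2 e3 (u, \<phi>, \<theta>)) - k1 v * k2 (v + u))
      * (norm u powr \<gamma> * b (cos \<theta>) * sin \<theta>)"
proof -
  define a where "a = gain_shift e2 e3 (u, \<phi>, \<theta>)"
  define c where "c = gain_coshift e2 e3 (u, \<phi>, \<theta>)"
  define K where "K = norm u powr \<gamma> * b (cos \<theta>) * sin \<theta>"
  have ac: "a + c = u" unfolding a_def c_def by (simp add: gain_shift_add)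
  have o: "a \<bullet> c = 0" unfolding a_def c_def by (rule gain_shift_orthogonal[OF fr])
  have "collision_integrand \<gamma> b e2 e3 (mw k1) (mw k2) v (v + u, \<phi>, \<theta>)
    = ((Maxwellian (v + a) powr (1/2) * Maxwellian (v + c) powr (1/2)) * (k1 (v + a) * k2 (v + c))
        - Maxwellian v powr (1/2) * Maxwellian (v + u) powr (1/2) * (k1 v * k2 (v + u))) * K"
    by (simp add: collision_integrand_def Let_def post_v_eq[OF fr] post_vs_eq[OF fr] collision_kernel_def K_def a_def c_def mult_ac)
  also have "\<dots> = Maxwellian v powr (1/2) * (Maxwellian (v + u) powr (1/2) * (k1 (v + a) * k2 (v + c) - k1 v * k2 (v + u)) * K)"
    unfolding Maxwellian_collision[OF o] ac by (simp add: algebra_simps)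
  finally show ?thesis
    unfolding a_def[symmetric] c_def[symmetric] K_def[symmetric]
    by (metis (no_types, lifting) Maxwellian_powr_minus_half mult.assoc mult_1)
qed

text \<open>The exponential weight is absorbed into the function, so that membership in the weighted
  supremum space becomes a bound by a multiple of (1 + |w|)^(-\<beta>).\<close>

definition wabs :: "real \<Rightarrow> (R3 \<Rightarrow> real) \<Rightarrow> R3 \<Rightarrow> ennreal" where
  "wabs \<alpha> f w = ennreal (exp (\<alpha> * (norm w)\<^sup>2) * \<bar>f w\<bar>)"

lemma wabs_measurable [measurable]: "f \<in> borel_measurable borel \<Longrightarrow> wabs \<alpha> f \<in> borel_measurable borel"
  unfolding wabs_def by measurable

text \<open>The bilinear splitting k1 k2 - j1 j2 = (k1 - j1) k2 + j1 (k2 - j2), with the exponential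
  weight at \<open>v\<close> distributed over the two velocities. Taking j1 = j2 = 0 gives the size
  of the product; taking values at another point of \<Omega> gives the Sobolev difference.\<close>

lemma weighted_product_diff_le:
  assumes "\<alpha> \<ge> 0" and "(norm v)\<^sup>2 \<le> (norm p)\<^sup>2 + (norm q)\<^sup>2"
  shows "ennreal (exp (\<alpha> * (norm v)\<^sup>2) * \<bar>k1 p * k2 q - j1 p * j2 q\<bar>)
     \<le> wabs \<alpha> (\<lambda>w. k1 w - j1 w) p * wabs \<alpha> k2 q + wabs \<alpha> j1 p * wabs \<alpha> (\<lambda>w. k2 w - j2 w) q"
proof -
  have "k1 p * k2 q - j1 p * j2 q = (k1 p - j1 p) * k2 q + j1 p * (k2 q - j2 q)" by (simp add: algebra_simps)
  then have 1: "\<bar>k1 p * k2 q - j1 p * j2 q\<bar> \<le> \<bar>k1 p - j1 p\<bar> * \<bar>k2 q\<bar> + \<bar>j1 p\<bar> * \<bar>k2 q - j2 q\<bar>"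
    by (metis abs_mult abs_triangle_ineq)
  have "exp (\<alpha> * (norm v)\<^sup>2) \<le> exp (\<alpha> * ((norm p)\<^sup>2 + (norm q)\<^sup>2))"
    using assms by (simp add: mult_left_mono)
  then have 2: "exp (\<alpha> * (norm v)\<^sup>2) \<le> exp (\<alpha> * (norm p)\<^sup>2) * exp (\<alpha> * (norm q)\<^sup>2)"
    by (simp add: distrib_left flip: exp_add)
  have "exp (\<alpha> * (norm v)\<^sup>2) * \<bar>k1 p * k2 q - j1 p * j2 q\<bar> \<le>
    exp (\<alpha> * (norm p)\<^sup>2) * exp (\<alpha> * (norm q)\<^sup>2) * (\<bar>k1 p - j1 p\<bar> * \<bar>k2 q\<bar> + \<bar>j1 p\<bar> * \<bar>k2 q - j2 q\<bar>)"
    by (rule mult_mono[OF 2 1]) auto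
  then show ?thesis
    unfolding wabs_def
    by (simp add: ennreal_mult[symmetric] ennreal_plus[symmetric] algebra_simps del: ennreal_plus)
qed

text \<open>A pointwise majorant by the integrand \<open>P\<close> of \<open>coll_sum\<close>. The
  shift by (v, 0) replaces \<open>v\<^sub>*\<close> by the relative velocity. The gain part
  distributes the exponential weight by energy conservation; the loss part contains \<open>v\<close>
  itself. The power of pi is the normalisation of the square root of the Maxwellian.\<close>

lemma collision_integrand_diff_le:
  fixes z :: "R3 \<times> real \<times> real" and v :: R3 and \<gamma> :: real
  assumes fr: "collision_frame e2 e3" and \<alpha>: "\<alpha> \<ge> 0" and z: "z \<in> collision_domain"
    and b: "\<And>\<theta>. 0 < \<theta> \<Longrightarrow> \<theta> < pi/2 \<Longrightarrow> 0 \<le> b (cos \<theta>) \<and> b (cos \<theta>) \<le> Cb * cos \<theta>" and Cb: "Cb \<ge> 0"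
  defines "I \<equiv> \<lambda>k1 k2. Gam_integrand \<gamma> b e2 e3 k1 k2 v ((v, 0) + z)"
    and "P \<equiv> \<lambda>F G. coll_weight \<gamma> z * ennreal (exp (- (norm (v + fst z))\<^sup>2 / 2)) *
      (F (v + gain_shift e2 e3 z) * G (v + gain_coshift e2 e3 z) + F v * G (v + fst z))"
  shows "ennreal (exp (\<alpha> * (norm v)\<^sup>2) * \<bar>I k1 k2 - I j1 j2\<bar>) \<le> ennreal (pi powr (-3/4) * Cb) *
     (P (wabs \<alpha> (\<lambda>w. k1 w - j1 w)) (wabs \<alpha> k2) + P (wabs \<alpha> j1) (wabs \<alpha> (\<lambda>w. k2 w - j2 w)))"
proof -
  obtain u \<phi> \<theta> where zz: "z = (u, \<phi>, \<theta>)" by (cases z) auto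
  have th: "0 < \<theta>" "\<theta> < pi/2" using z by (auto simp: zz collision_domain_def)
  have sc: "sin \<theta> > 0" "cos \<theta> > 0" using th sin_gt_zero2[of \<theta>] cos_gt_zero_pi[of \<theta>] by auto
  define a where "a = gain_shift e2 e3 z"
  define c where "c = gain_coshift e2 e3 z"
  have ac: "a + c = u" unfolding a_def c_def by (simp add: gain_shift_add zz)
  have o: "a \<bullet> c = 0" unfolding a_def c_def by (rule gain_shift_orthogonal[OF fr])
  define K where "K = norm u powr \<gamma> * b (cos \<theta>) * sin \<theta>"
  define L where "L = norm u powr \<gamma> * (cos \<theta> * sin \<theta>)"
  have K: "0 \<le> K" "K \<le> Cb * L"
  proof -
    show "0 \<le> K" using b[OF th] sc by (simp add: K_def)
    have "K \<le> norm u powr \<gamma> * (Cb * cos \<theta>) * sin \<theta>"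
      unfolding K_def using b[OF th] sc by (intro mult_right_mono mult_left_mono) auto
    then show "K \<le> Cb * L" by (simp add: L_def mult_ac)
  qed
  define m where "m = Maxwellian (v + u) powr (1/2)"
  have m: "m = pi powr (-3/4) * exp (- (norm (v + u))\<^sup>2 / 2)" "m \<ge> 0" unfolding m_def by (simp_all add: Maxwellian_powr_half)
  define X where "X = k1 (v + a) * k2 (v + c) - j1 (v + a) * j2 (v + c)"
  define Y where "Y = k1 v * k2 (v + u) - j1 v * j2 (v + u)"
  have I: "I f g = m * (f (v + a) * g (v + c) - f v * g (v + u)) * K" for f g
    unfolding I_def using weighted_collision_integrand_eq[OF fr, of v \<gamma> b f g u \<phi> \<theta>]
    by (simp add: zz m_def a_def c_def K_def)
  have "I k1 k2 - I j1 j2 = m * (X - Y) * K" unfolding I X_def Y_def by (simp add: algebra_simps)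
  then have "\<bar>I k1 k2 - I j1 j2\<bar> = m * \<bar>X - Y\<bar> * K" using m(2) K by (simp add: abs_mult)
  also have "\<dots> \<le> m * (\<bar>X\<bar> + \<bar>Y\<bar>) * (Cb * L)"
    using m(2) K by (intro mult_mono) auto
  finally have "exp (\<alpha> * (norm v)\<^sup>2) * \<bar>I k1 k2 - I j1 j2\<bar> \<le> exp (\<alpha> * (norm v)\<^sup>2) * (m * (\<bar>X\<bar> + \<bar>Y\<bar>) * (Cb * L))"
    by (rule mult_left_mono) simp
  also have "\<dots> = (pi powr (-3/4) * Cb) * (L * exp (- (norm (v + u))\<^sup>2 / 2) * (exp (\<alpha> * (norm v)\<^sup>2) * \<bar>X\<bar> + exp (\<alpha> * (norm v)\<^sup>2) * \<bar>Y\<bar>))"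
    unfolding m by (simp add: algebra_simps)
  finally have "ennreal (exp (\<alpha> * (norm v)\<^sup>2) * \<bar>I k1 k2 - I j1 j2\<bar>) \<le> ennreal ((pi powr (-3/4) * Cb) * (L * exp (- (norm (v + u))\<^sup>2 / 2) * (exp (\<alpha> * (norm v)\<^sup>2) * \<bar>X\<bar> + exp (\<alpha> * (norm v)\<^sup>2) * \<bar>Y\<bar>)))"
    by (rule ennreal_leI)
  also have "\<dots> = ennreal (pi powr (-3/4) * Cb) * (ennreal L * ennreal (exp (- (norm (v + u))\<^sup>2 / 2)) * (ennreal (exp (\<alpha> * (norm v)\<^sup>2) * \<bar>X\<bar>) + ennreal (exp (\<alpha> * (norm v)\<^sup>2) * \<bar>Y\<bar>)))"
    using Cb sc by (simp add: ennreal_mult L_def)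
  also have "\<dots> \<le> ennreal (pi powr (-3/4) * Cb) * (ennreal L * ennreal (exp (- (norm (v + u))\<^sup>2 / 2)) * (
      (wabs \<alpha> (\<lambda>w. k1 w - j1 w) (v + a) * wabs \<alpha> k2 (v + c) + wabs \<alpha> j1 (v + a) * wabs \<alpha> (\<lambda>w. k2 w - j2 w) (v + c))
     + (wabs \<alpha> (\<lambda>w. k1 w - j1 w) v * wabs \<alpha> k2 (v + u) + wabs \<alpha> j1 v * wabs \<alpha> (\<lambda>w. k2 w - j2 w) (v + u))))"
  proof (intro mult_left_mono add_mono)
    have "(norm (v + a))\<^sup>2 + (norm (v + c))\<^sup>2 = (norm v)\<^sup>2 + (norm (v + (a + c)))\<^sup>2"
      using o by (simp add: power2_norm_eq_inner inner_add_left inner_add_right inner_commute)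
    then have "(norm v)\<^sup>2 \<le> (norm (v + a))\<^sup>2 + (norm (v + c))\<^sup>2" by simp
    then show "ennreal (exp (\<alpha> * (norm v)\<^sup>2) * \<bar>X\<bar>) \<le> wabs \<alpha> (\<lambda>w. k1 w - j1 w) (v + a) * wabs \<alpha> k2 (v + c) + wabs \<alpha> j1 (v + a) * wabs \<alpha> (\<lambda>w. k2 w - j2 w) (v + c)"
      unfolding X_def by (rule weighted_product_diff_le[OF \<alpha>])
    show "ennreal (exp (\<alpha> * (norm v)\<^sup>2) * \<bar>Y\<bar>) \<le> wabs \<alpha> (\<lambda>w. k1 w - j1 w) v * wabs \<alpha> k2 (v + u) + wabs \<alpha> j1 v * wabs \<alpha> (\<lambda>w. k2 w - j2 w) (v + u)"
      unfolding Y_def by (rule weighted_product_diff_le[OF \<alpha>]) simp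
  qed simp_all
  also have "\<dots> = ennreal (pi powr (-3/4) * Cb) *
     (P (wabs \<alpha> (\<lambda>w. k1 w - j1 w)) (wabs \<alpha> k2) + P (wabs \<alpha> j1) (wabs \<alpha> (\<lambda>w. k2 w - j2 w)))"
    unfolding P_def a_def[symmetric] c_def[symmetric] using z
    by (simp add: coll_weight_def L_def zz algebra_simps)
  finally show ?thesis .
qed

text \<open>Measurability is needed jointly in position, velocity and collision parameters, because
  the integral over the latter must again be Borel in phase space.\<close>

lemma collision_integrand_measurable:
  fixes h1 h2 :: "R3 \<Rightarrow> R3 \<Rightarrow> real"
  assumes fr: "collision_frame e2 e3" and [measurable]: "b \<in> borel_measurable borel"
    and h: "case_prod h1 \<in> borel_measurable borel" "case_prod h2 \<in> borel_measurable borel"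
  shows "(\<lambda>t. collision_integrand \<gamma> b e2 e3 (mw (h1 (fst (fst t))))
      (mw (h2 (fst (fst t)))) (snd (fst t)) (snd t))
    \<in> borel_measurable (borel :: ((R3 \<times> R3) \<times> (R3 \<times> real \<times> real)) measure)"
proof -
  have [measurable]: "e2 \<in> borel_measurable borel" "e3 \<in> borel_measurable borel"
    using fr by (auto simp: collision_frame_def)
  have hm[measurable]: "(\<lambda>t. h1 (f t) (g t)) \<in> borel_measurable M" "(\<lambda>t. h2 (f t) (g t)) \<in> borel_measurable M"
    if [measurable]: "f \<in> borel_measurable M" "g \<in> borel_measurable M" for f g and M :: "'c measure"
  proof -
    have "(\<lambda>t. (f t, g t)) \<in> borel_measurable M" by measurable
    then show "(\<lambda>t. h1 (f t) (g t)) \<in> borel_measurable M" "(\<lambda>t. h2 (f t) (g t)) \<in> borel_measurable M"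
      using measurable_compose[OF _ h(1)] measurable_compose[OF _ h(2)] by fastforce+
  qed
  show ?thesis
    unfolding collision_integrand_def Let_def case_prod_beta post_v_def post_vs_def collision_dir_def
      collision_kernel_def Maxwellian_def borel_prod[symmetric]
    by measurable
qed

section \<open>The collision integral on Borel functions of velocity\<close>

text \<open>The counterpart of \<Gamma> for a fixed position, with \<open>lborel\<close> for
  \<open>lebesgue\<close> and the Maxwellian prefactor moved under the integral.\<close>

definition Gam :: "real \<Rightarrow> (real \<Rightarrow> real) \<Rightarrow> (R3 \<Rightarrow> R3) \<Rightarrow> (R3 \<Rightarrow> R3) \<Rightarrow> (R3 \<Rightarrow> real) \<Rightarrow> (R3 \<Rightarrow> real) \<Rightarrow> R3 \<Rightarrow> real" where
  "Gam \<gamma> b e2 e3 k1 k2 v = (\<integral>z. indicator collision_domain z *\<^sub>R (Gam_integrand \<gamma> b e2 e3 k1 k2 v z) \<partial>lborel)"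

lemma coll_sum_zero: "coll_sum e2 e3 \<gamma> (\<lambda>_. 0) G v = 0" "coll_sum e2 e3 \<gamma> F (\<lambda>_. 0) v = 0"
  by (simp_all add: coll_sum_def coll_op_def)

text \<open>The pointwise majorant is integrated after translating the first parameter from
  \<open>v\<^sub>*\<close> to the relative velocity; this leaves \<open>collision_domain\<close>
  unchanged because its first factor is the whole space.\<close>

lemma collision_integrand_nn_integral_le:
  fixes v :: R3 and \<gamma> :: real
  assumes fr: "collision_frame e2 e3" and \<alpha>: "\<alpha> \<ge> 0"
    and b: "\<And>\<theta>. 0 < \<theta> \<Longrightarrow> \<theta> < pi/2 \<Longrightarrow> 0 \<le> b (cos \<theta>) \<and> b (cos \<theta>) \<le> Cb * cos \<theta>" and Cb: "Cb \<ge> 0"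
    and [measurable]: "b \<in> borel_measurable borel" "k1 \<in> borel_measurable borel" "k2 \<in> borel_measurable borel"
      "j1 \<in> borel_measurable borel" "j2 \<in> borel_measurable borel"
  defines "I \<equiv> \<lambda>k1 k2 z. indicator collision_domain z *\<^sub>R (Gam_integrand \<gamma> b e2 e3 k1 k2 v z)"
  shows "I k1 k2 \<in> borel_measurable borel" (is ?m)
    and "(\<integral>\<^sup>+z. ennreal (exp (\<alpha> * (norm v)\<^sup>2) * \<bar>I k1 k2 z - I j1 j2 z\<bar>) \<partial>lborel) \<le> ennreal (pi powr (-3/4) * Cb) *
     (coll_sum e2 e3 \<gamma> (wabs \<alpha> (\<lambda>w. k1 w - j1 w)) (wabs \<alpha> k2) v + coll_sum e2 e3 \<gamma> (wabs \<alpha> j1) (wabs \<alpha> (\<lambda>w. k2 w - j2 w)) v)" (is ?i)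
proof -
  have Im[measurable]: "I f g \<in> borel_measurable borel" if f[measurable]: "f \<in> borel_measurable borel" "g \<in> borel_measurable borel" for f g
  proof -
    have "case_prod (\<lambda>x::R3. f) \<in> borel_measurable borel" "case_prod (\<lambda>x::R3. g) \<in> borel_measurable borel"
      unfolding borel_prod[symmetric] by measurable
    from measurable_compose[OF _ collision_integrand_measurable[OF fr \<open>b \<in> borel_measurable borel\<close> this, of \<gamma>], of "\<lambda>z. ((v, v), z)" borel]
    have "(\<lambda>z. collision_integrand \<gamma> b e2 e3 (mw f) (mw g) v z) \<in> borel_measurable borel"
      by (simp add: borel_measurable_Pair)
    then show ?thesis unfolding I_def by measurable
  qed
  show ?m by (rule Im) measurable
  define P where "P = (\<lambda>F G (z :: R3 \<times> real \<times> real). coll_weight \<gamma> z * ennreal (exp (- (norm (v + fst z))\<^sup>2 / 2)) *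
      (F (v + gain_shift e2 e3 z) * G (v + gain_coshift e2 e3 z) + F v * G (v + fst z)))"
  have [measurable]: "gain_shift e2 e3 \<in> borel_measurable borel" "gain_coshift e2 e3 \<in> borel_measurable borel"
    "(fst :: R3 \<times> real \<times> real \<Rightarrow> R3) \<in> borel_measurable borel"
    using gain_shift_measurable[OF fr] by (auto intro!: borel_measurable_continuous_onI continuous_on_fst continuous_on_id)
  have [measurable]: "P F G \<in> borel_measurable borel" if [measurable]: "F \<in> borel_measurable borel" "G \<in> borel_measurable borel" for F G
    unfolding P_def by measurable
  have PS: "(\<integral>\<^sup>+z. P F G z \<partial>lborel) = coll_sum e2 e3 \<gamma> F G v" if [measurable]: "F \<in> borel_measurable borel" "G \<in> borel_measurable borel" for F G
  proof -
    have "P F G z = coll_weight \<gamma> z * ennreal (exp (- (norm (v + gain_shift e2 e3 z + gain_coshift e2 e3 z))\<^sup>2 / 2)) *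
        (F (v + gain_shift e2 e3 z) * G (v + gain_coshift e2 e3 z))
       + coll_weight \<gamma> z * ennreal (exp (- (norm (v + 0 + fst z))\<^sup>2 / 2)) * (F (v + 0) * G (v + fst z))" for z
      unfolding P_def by (simp add: add.assoc gain_shift_add distrib_left)
    then show ?thesis unfolding coll_sum_def coll_op_def by (simp add: nn_integral_add)
  qed
  have "(\<integral>\<^sup>+z. ennreal (exp (\<alpha> * (norm v)\<^sup>2) * \<bar>I k1 k2 z - I j1 j2 z\<bar>) \<partial>lborel)
    = (\<integral>\<^sup>+z. ennreal (exp (\<alpha> * (norm v)\<^sup>2) * \<bar>I k1 k2 ((v, 0) + z) - I j1 j2 ((v, 0) + z)\<bar>) \<partial>lborel)"
    by (rule nn_integral_lborel_translate[symmetric]) measurable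
  also have "\<dots> \<le> (\<integral>\<^sup>+z. ennreal (pi powr (-3/4) * Cb) *
     (P (wabs \<alpha> (\<lambda>w. k1 w - j1 w)) (wabs \<alpha> k2) z + P (wabs \<alpha> j1) (wabs \<alpha> (\<lambda>w. k2 w - j2 w)) z) \<partial>lborel)"
  proof (rule nn_integral_mono)
    fix z :: "R3 \<times> real \<times> real"
    have dom: "(v, 0) + z \<in> collision_domain \<longleftrightarrow> z \<in> collision_domain"
      by (cases z) (auto simp: collision_domain_def plus_prod_def zero_prod_def)
    show "ennreal (exp (\<alpha> * (norm v)\<^sup>2) * \<bar>I k1 k2 ((v, 0) + z) - I j1 j2 ((v, 0) + z)\<bar>)
       \<le> ennreal (pi powr (-3/4) * Cb) *
     (P (wabs \<alpha> (\<lambda>w. k1 w - j1 w)) (wabs \<alpha> k2) z + P (wabs \<alpha> j1) (wabs \<alpha> (\<lambda>w. k2 w - j2 w)) z)"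
    proof (cases "z \<in> collision_domain")
      case True
      then show ?thesis
        using collision_integrand_diff_le[OF fr \<alpha> True b Cb, of v \<gamma> k1 k2 j1 j2] by (simp add: I_def P_def dom)
    qed (simp add: I_def dom)
  qed
  also have "\<dots> = ennreal (pi powr (-3/4) * Cb) *
     (coll_sum e2 e3 \<gamma> (wabs \<alpha> (\<lambda>w. k1 w - j1 w)) (wabs \<alpha> k2) v + coll_sum e2 e3 \<gamma> (wabs \<alpha> j1) (wabs \<alpha> (\<lambda>w. k2 w - j2 w)) v)"
    by (subst nn_integral_cmult) (simp_all add: nn_integral_add PS)
  finally show ?i .
qed

text \<open>Finiteness of both majorants makes both integrals converge, which is what allows the
  difference of the integrals to be written as the integral of the difference.\<close>

lemma Gam_diff_le:
  assumes fr: "collision_frame e2 e3" and \<alpha>: "\<alpha> \<ge> 0"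
    and b: "\<And>\<theta>. 0 < \<theta> \<Longrightarrow> \<theta> < pi/2 \<Longrightarrow> 0 \<le> b (cos \<theta>) \<and> b (cos \<theta>) \<le> Cb * cos \<theta>" and Cb: "Cb \<ge> 0"
    and m: "b \<in> borel_measurable borel" "k1 \<in> borel_measurable borel" "k2 \<in> borel_measurable borel"
      "j1 \<in> borel_measurable borel" "j2 \<in> borel_measurable borel"
    and fin: "coll_sum e2 e3 \<gamma> (wabs \<alpha> k1) (wabs \<alpha> k2) v < \<infinity>" "coll_sum e2 e3 \<gamma> (wabs \<alpha> j1) (wabs \<alpha> j2) v < \<infinity>"
  shows "integrable lborel (\<lambda>z. indicator collision_domain z *\<^sub>R (Gam_integrand \<gamma> b e2 e3 k1 k2 v z))" (is ?int)
    and "ennreal (exp (\<alpha> * (norm v)\<^sup>2) * \<bar>Gam \<gamma> b e2 e3 k1 k2 v - Gam \<gamma> b e2 e3 j1 j2 v\<bar>) \<le> ennreal (pi powr (-3/4) * Cb) *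
     (coll_sum e2 e3 \<gamma> (wabs \<alpha> (\<lambda>w. k1 w - j1 w)) (wabs \<alpha> k2) v + coll_sum e2 e3 \<gamma> (wabs \<alpha> j1) (wabs \<alpha> (\<lambda>w. k2 w - j2 w)) v)" (is ?d)
proof -
  define I where "I = (\<lambda>k1 k2 z. indicator collision_domain z *\<^sub>R (Gam_integrand \<gamma> b e2 e3 k1 k2 v z))"
  have I0: "I (\<lambda>_. 0) (\<lambda>_. 0) z = 0" for z
    by (cases z) (simp add: I_def collision_integrand_def Let_def)
  have w0: "wabs \<alpha> (\<lambda>_. 0) = (\<lambda>_. 0)" by (simp add: wabs_def fun_eq_iff)
  have int: "integrable lborel (I f g)"
    if f: "f \<in> borel_measurable borel" "g \<in> borel_measurable borel" and fi: "coll_sum e2 e3 \<gamma> (wabs \<alpha> f) (wabs \<alpha> g) v < \<infinity>" for f g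
  proof (rule integrableI_bounded)
    have "I f g \<in> borel_measurable borel"
      unfolding I_def by (rule collision_integrand_nn_integral_le(1)[OF fr \<alpha> b Cb m(1) f f])
    then show "I f g \<in> borel_measurable lborel" by (simp only: measurable_lborel2)
    \<comment> \<open>Integrability is the difference estimate against the pair of zero functions,
      together with the fact that the exponential weight is at least 1.\<close>
    have "(\<integral>\<^sup>+z. ennreal (norm (I f g z)) \<partial>lborel) \<le> (\<integral>\<^sup>+z. ennreal (exp (\<alpha> * (norm v)\<^sup>2) * \<bar>I f g z - I (\<lambda>_. 0) (\<lambda>_. 0) z\<bar>) \<partial>lborel)"
    proof (intro nn_integral_mono ennreal_leI)
      fix z
      have "1 * \<bar>I f g z\<bar> \<le> exp (\<alpha> * (norm v)\<^sup>2) * \<bar>I f g z\<bar>" using \<alpha> by (intro mult_right_mono) auto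
      then show "norm (I f g z) \<le> exp (\<alpha> * (norm v)\<^sup>2) * \<bar>I f g z - I (\<lambda>_. 0) (\<lambda>_. 0) z\<bar>" by (simp add: I0)
    qed
    also have "\<dots> \<le> ennreal (pi powr (-3/4) * Cb) * (coll_sum e2 e3 \<gamma> (wabs \<alpha> (\<lambda>w. f w - 0)) (wabs \<alpha> g) v
        + coll_sum e2 e3 \<gamma> (wabs \<alpha> (\<lambda>_. 0)) (wabs \<alpha> (\<lambda>w. g w - 0)) v)"
      unfolding I_def by (rule collision_integrand_nn_integral_le(2)[OF fr \<alpha> b Cb m(1) f]) simp_all
    also have "\<dots> < \<infinity>" using fi by (simp add: w0 coll_sum_zero(1) ennreal_mult_less_top)
    finally show "(\<integral>\<^sup>+z. ennreal (norm (I f g z)) \<partial>lborel) < \<infinity>" .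
  qed
  show ?int using int[OF m(2,3) fin(1)] unfolding I_def .
  have G: "Gam \<gamma> b e2 e3 f g v = (\<integral>z. I f g z \<partial>lborel)" for f g unfolding Gam_def I_def ..
  have i1: "integrable lborel (I k1 k2)" and i2: "integrable lborel (I j1 j2)" using int m fin by auto
  have "exp (\<alpha> * (norm v)\<^sup>2) * \<bar>Gam \<gamma> b e2 e3 k1 k2 v - Gam \<gamma> b e2 e3 j1 j2 v\<bar> = norm (\<integral>z. exp (\<alpha> * (norm v)\<^sup>2) * (I k1 k2 z - I j1 j2 z) \<partial>lborel)"
    using i1 i2 by (simp add: G abs_mult)
  also have "ennreal \<dots> \<le> (\<integral>\<^sup>+z. ennreal (norm (exp (\<alpha> * (norm v)\<^sup>2) * (I k1 k2 z - I j1 j2 z))) \<partial>lborel)"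
    using i1 i2 by (intro integral_norm_bound_ennreal) auto
  also have "\<dots> = (\<integral>\<^sup>+z. ennreal (exp (\<alpha> * (norm v)\<^sup>2) * \<bar>I k1 k2 z - I j1 j2 z\<bar>) \<partial>lborel)"
    by (simp add: abs_mult)
  also have "\<dots> \<le> ennreal (pi powr (-3/4) * Cb) *
     (coll_sum e2 e3 \<gamma> (wabs \<alpha> (\<lambda>w. k1 w - j1 w)) (wabs \<alpha> k2) v + coll_sum e2 e3 \<gamma> (wabs \<alpha> j1) (wabs \<alpha> (\<lambda>w. k2 w - j2 w)) v)"
    unfolding I_def by (rule collision_integrand_nn_integral_le(2)[OF fr \<alpha> b Cb m])
  finally show ?d .
qed

section \<open>Borel representatives and null sets\<close>

lemma borel_measurable_completion_AE:
  assumes f: "f \<in> borel_measurable M" and ae: "AE x in M. f x = g x"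
  shows "g \<in> borel_measurable (completion M)"
proof (rule measurableI)
  fix S :: "'b set" assume S: "S \<in> sets borel"
  have "AE x in completion M. (x \<in> f -` S \<inter> space M) \<longleftrightarrow> (x \<in> g -` S \<inter> space M)"
    using AE_completion[OF ae] by (auto elim!: eventually_mono)
  then have "g -` S \<inter> space M \<in> sets (completion M)"
    by (rule completion.in_sets_AE) (use measurable_sets[OF f S] in auto)
  then show "g -` S \<inter> space (completion M) \<in> sets (completion M)" by simp
qed simp

text \<open>A Borel version is set to 0 wherever it exceeds the essential supremum. This changes it
  only on a null set over \<Omega>, and the bound then holds at every point, so that the later
  pointwise estimates carry no exceptional set.\<close>

lemma ex_borel_version:
  fixes h :: "R3 \<Rightarrow> R3 \<Rightarrow> real"
  assumes \<Omega>: "open \<Omega>" and hm: "phase_measurable \<Omega> h" and fin: "Linf_ext_norm \<Omega> \<alpha> \<beta> h < \<infinity>"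
  obtains h' where "case_prod h' \<in> borel_measurable borel"
    "\<And>x v. \<bar>h' x v\<bar> * exp (\<alpha> * (norm v)\<^sup>2) * (1 + norm v) powr \<beta> \<le> Linf_norm \<Omega> \<alpha> \<beta> h"
    "AE p in lborel. fst p \<in> \<Omega> \<longrightarrow> h (fst p) (snd p) = h' (fst p) (snd p)"
proof -
  define A where "A = Linf_norm \<Omega> \<alpha> \<beta> h"
  have A: "Linf_ext_norm \<Omega> \<alpha> \<beta> h = ennreal A" "A \<ge> 0" using fin by (auto simp: A_def Linf_norm_def)
  have S: "\<Omega> \<times> (UNIV :: R3 set) \<in> sets lebesgue" by (simp add: \<Omega> open_Times borel_open)
  have "(\<lambda>p. if p \<in> \<Omega> \<times> UNIV then case_prod h p else 0) \<in> borel_measurable lebesgue"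
    by (rule borel_measurable_if_I[OF hm[unfolded phase_measurable_def] S])
  from completion_ex_borel_measurable_real[OF this] obtain g :: "R3 \<times> R3 \<Rightarrow> real" where
    g[measurable]: "g \<in> borel_measurable borel" and ae: "AE p in lborel. (if p \<in> \<Omega> \<times> UNIV then case_prod h p else 0) = g p"
    by auto
  define w where "w = (\<lambda>p. \<bar>g p\<bar> * exp (\<alpha> * (norm (snd p))\<^sup>2) * (1 + norm (snd p)) powr \<beta>)"
  have [measurable]: "w \<in> borel_measurable borel"
    using g unfolding w_def borel_prod[symmetric] by measurable
  define h' where "h' = (\<lambda>x v. if w (x, v) \<le> A then g (x, v) else 0)"
  have "case_prod h' = (\<lambda>p. if w p \<le> A then g p else 0)" by (auto simp: h'_def)
  then have 1: "case_prod h' \<in> borel_measurable borel" by simp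
  have 2: "\<bar>h' x v\<bar> * exp (\<alpha> * (norm v)\<^sup>2) * (1 + norm v) powr \<beta> \<le> A" for x v
    using A by (auto simp: h'_def w_def)
  have "AE p in lebesgue_on (\<Omega> \<times> UNIV). (case p of (x, v) \<Rightarrow> ennreal (\<bar>h x v\<bar> * exp (\<alpha> * (norm v)\<^sup>2) * (1 + norm v) powr \<beta>)) \<le> ennreal A"
    using esssup_AE[of "\<lambda>(x, v). ennreal (\<bar>h x v\<bar> * exp (\<alpha> * (norm v)\<^sup>2) * (1 + norm v) powr \<beta>)" "lebesgue_on (\<Omega> \<times> UNIV)"]
    by (simp add: A(1)[symmetric] Linf_ext_norm_def)
  then have "AE p in lebesgue. p \<in> \<Omega> \<times> UNIV \<longrightarrow> (case p of (x, v) \<Rightarrow> ennreal (\<bar>h x v\<bar> * exp (\<alpha> * (norm v)\<^sup>2) * (1 + norm v) powr \<beta>)) \<le> ennreal A"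
    using S by (subst (asm) AE_restrict_space_iff) auto
  then have bd: "AE p in lborel. p \<in> \<Omega> \<times> UNIV \<longrightarrow> (case p of (x, v) \<Rightarrow> ennreal (\<bar>h x v\<bar> * exp (\<alpha> * (norm v)\<^sup>2) * (1 + norm v) powr \<beta>)) \<le> ennreal A"
    by (simp add: AE_completion_iff)
  have 3: "AE p in lborel. fst p \<in> \<Omega> \<longrightarrow> h (fst p) (snd p) = h' (fst p) (snd p)"
    using ae bd
  proof eventually_elim
    case (elim p)
    show ?case
    proof
      assume "fst p \<in> \<Omega>"
      then have p: "p \<in> \<Omega> \<times> UNIV" by (cases p) auto
      then have "g p = h (fst p) (snd p)" using elim(1) by (simp add: case_prod_beta)
      moreover from this have "w p \<le> A" using elim(2) p A(2) by (simp add: w_def case_prod_beta)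
      ultimately show "h (fst p) (snd p) = h' (fst p) (snd p)" by (simp add: h'_def)
    qed
  qed
  show ?thesis using that[OF 1 _ 3] 2 by (simp add: A_def)
qed

text \<open>Equality is needed for almost every \<theta>, not for almost every value of cos
  \<theta>. The exceptional angles form an image under arccos of a null set, which is null because
  arccos is differentiable on the open unit interval.\<close>

lemma ex_borel_angular_kernel:
  fixes b :: "real \<Rightarrow> real"
  assumes bm: "b \<in> borel_measurable (lebesgue_on {0<..<1})" and Cb: "Cb > 0"
    and bb: "\<And>\<theta>. 0 < \<theta> \<Longrightarrow> \<theta> < pi / 2 \<Longrightarrow> 0 < b (cos \<theta>) \<and> b (cos \<theta>) \<le> Cb * cos \<theta>"
  obtains b' where "b' \<in> borel_measurable borel"
    "\<And>\<theta>. 0 < \<theta> \<Longrightarrow> \<theta> < pi / 2 \<Longrightarrow> 0 \<le> b' (cos \<theta>) \<and> b' (cos \<theta>) \<le> Cb * cos \<theta>"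
    "AE \<theta> in lborel. 0 < \<theta> \<and> \<theta> < pi / 2 \<longrightarrow> b (cos \<theta>) = b' (cos \<theta>)"
proof -
  have "(\<lambda>t. if t \<in> {0<..<1} then b t else 0) \<in> borel_measurable lebesgue"
    by (rule borel_measurable_if_I[OF bm]) simp
  from completion_ex_borel_measurable_real[OF this] obtain g :: "real \<Rightarrow> real" where
    g[measurable]: "g \<in> borel_measurable borel" and ae: "AE t in lborel. (if t \<in> {0<..<1} then b t else 0) = g t"
    by auto
  \<comment> \<open>Truncation makes the bounds hold for every \<theta>; where the versions agree,
    \<open>b\<close> satisfies them already and nothing is cut off.\<close>
  define b' where "b' = (\<lambda>t. if 0 \<le> g t \<and> g t \<le> Cb * t then g t else 0)"
  have [measurable]: "b' \<in> borel_measurable borel" unfolding b'_def by measurable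
  have cosb: "0 < cos \<theta> \<and> cos \<theta> < 1" if "0 < \<theta>" "\<theta> < pi / 2" for \<theta> :: real
    using that cos_gt_zero_pi[of \<theta>] cos_monotone_0_pi[of 0 \<theta>] by auto
  obtain N where N: "{t. (if t \<in> {0<..<1} then b t else 0) \<noteq> g t} \<subseteq> N" "N \<in> null_sets lborel"
    using ae by (auto elim!: AE_E simp: null_sets_def)
  \<comment> \<open>Restricting to the open interval avoids the endpoint 1, where arccos is not
    differentiable.\<close>
  define N1 where "N1 = N \<inter> {0<..<1}"
  have "negligible N1" unfolding N1_def negligible_iff_null_sets
    using N(2) by (meson Int_lower1 null_sets_completion_iff2)
  then have "negligible (arccos ` N1)"
  proof (rule negligible_differentiable_image_negligible[rotated])
    show "arccos differentiable_on N1"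
      unfolding differentiable_on_def
    proof
      fix t assume "t \<in> N1"
      then have "(arccos has_real_derivative inverse (- sqrt (1 - t\<^sup>2))) (at t)"
        by (intro DERIV_arccos) (auto simp: N1_def)
      then show "arccos differentiable (at t within N1)"
        by (meson differentiable_at_withinI differentiableI has_field_derivative_imp_has_derivative)
    qed
  qed simp
  then have "AE \<theta> in lebesgue. \<theta> \<notin> arccos ` N1"
    by (simp add: negligible_iff_null_sets AE_not_in)
  then have "AE \<theta> in lborel. \<theta> \<notin> arccos ` N1" by (simp add: AE_completion_iff)
  then have "AE \<theta> in lborel. 0 < \<theta> \<and> \<theta> < pi / 2 \<longrightarrow> b (cos \<theta>) = b' (cos \<theta>)"
  proof eventually_elim
    case (elim \<theta>)
    show ?case
    proof
      assume th: "0 < \<theta> \<and> \<theta> < pi / 2"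
      then have c: "0 < cos \<theta>" "cos \<theta> < 1" using cosb by auto
      have "cos \<theta> \<notin> N"
      proof
        assume "cos \<theta> \<in> N"
        then have "arccos (cos \<theta>) \<in> arccos ` N1" using c by (auto simp: N1_def)
        then show False using elim th by (simp add: arccos_cos)
      qed
      then have "cos \<theta> \<notin> {t. (if t \<in> {0<..<1} then b t else 0) \<noteq> g t}" using N(1) by blast
      then have "b (cos \<theta>) = g (cos \<theta>)" using c by simp
      then show "b (cos \<theta>) = b' (cos \<theta>)" using bb[of \<theta>] th by (auto simp: b'_def)
    qed
  qed
  moreover have "0 \<le> b' (cos \<theta>) \<and> b' (cos \<theta>) \<le> Cb * cos \<theta>" if "0 < \<theta>" "\<theta> < pi / 2" for \<theta>
    using cosb[OF that] Cb by (auto simp: b'_def)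
  ultimately show ?thesis using that[of b'] by auto
qed

lemma AE_sections_notin_null:
  fixes N :: "('a::euclidean_space \<times> 'b::euclidean_space) set"
  assumes "N \<in> null_sets lborel"
  shows "AE x in lborel. AE v in lborel. (x, v) \<notin> N" "AE v in lborel. AE x in lborel. (x, v) \<notin> N"
proof -
  have N: "N \<in> sets (lborel \<Otimes>\<^sub>M lborel)" using null_setsD2[OF assms] by (simp only: lborel_prod)
  have "AE p in lborel \<Otimes>\<^sub>M lborel. p \<notin> N" using assms by (simp add: lborel_prod AE_not_in)
  then show 1: "AE x in lborel. AE v in lborel. (x, v) \<notin> N"
    using lborel_pair.AE_pair[of "\<lambda>p. p \<notin> N"] by simp
  have "{p \<in> space (lborel \<Otimes>\<^sub>M lborel). (fst p, snd p) \<notin> N} = space (lborel \<Otimes>\<^sub>M lborel) - N" by auto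
  then have "{p \<in> space (lborel \<Otimes>\<^sub>M lborel :: ('a \<times> 'b) measure). (fst p, snd p) \<notin> N} \<in> sets (lborel \<Otimes>\<^sub>M lborel)"
    using N by (metis sets.compl_sets)
  from lborel_pair.AE_commute[OF this] 1 show "AE v in lborel. AE x in lborel. (x, v) \<notin> N" by simp
qed

text \<open>Once the collision parameters are expressed by the relative velocity, v + A is a
  translate of \<open>v\<close> for each fixed parameter, so a null set of velocities pulls back to
  a null set. Tonelli exchanges the order: for almost every phase point, almost every collision
  lands outside \<open>N\<close>. This makes \<Gamma> insensitive to changes of its arguments on
  null sets.\<close>

lemma AE_shifted_notin_null:
  fixes N :: "(R3 \<times> R3) set" and A :: "R3 \<times> real \<times> real \<Rightarrow> R3"
  assumes N: "N \<in> null_sets lborel" and [measurable]: "A \<in> borel_measurable borel"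
  shows "AE p in lborel. AE z in lborel. (fst p, snd p + A (z - (snd p, 0))) \<notin> N"
proof -
  have Nb: "N \<in> sets borel" using null_setsD2[OF N] by (simp only: sets_lborel)
  define f where "f = (\<lambda>x v z. indicator N (x, v + A (z - (v, 0))) :: ennreal)"
  have fm: "(\<lambda>t. f (fst (fst t)) (snd (fst t)) (snd t)) \<in> borel_measurable ((borel \<Otimes>\<^sub>M borel) \<Otimes>\<^sub>M borel)"
  proof -
    have [measurable]: "N \<in> sets (borel \<Otimes>\<^sub>M borel)" using Nb by (simp only: borel_prod)
    have "(\<lambda>t::(R3 \<times> R3) \<times> R3 \<times> real \<times> real. snd t - (snd (fst t), 0)) \<in> borel_measurable borel"
      by (intro borel_measurable_continuous_onI continuous_intros)
    then have [measurable]: "(\<lambda>t::(R3 \<times> R3) \<times> R3 \<times> real \<times> real. A (snd t - (snd (fst t), 0))) \<in> borel_measurable ((borel \<Otimes>\<^sub>M borel) \<Otimes>\<^sub>M borel)"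
      unfolding borel_prod by (rule measurable_compose) measurable
    show ?thesis unfolding f_def by measurable
  qed
  have fx[measurable]: "(\<lambda>t. f x (fst t) (snd t)) \<in> borel_measurable (borel \<Otimes>\<^sub>M borel)" for x
    using measurable_compose[OF _ fm, of "\<lambda>t. ((x, fst t), snd t)"] by simp
  have fxv[measurable]: "f x v \<in> borel_measurable borel" for x v
    using measurable_compose[OF _ fm, of "\<lambda>t. ((x, v), t)"] by simp
  have Im[measurable]: "(\<lambda>p. \<integral>\<^sup>+z. f (fst p) (snd p) z \<partial>lborel) \<in> borel_measurable (borel \<Otimes>\<^sub>M borel)"
    using fm by (intro lborel.borel_measurable_nn_integral) (simp add: case_prod_beta)
  have "(\<integral>\<^sup>+p. \<integral>\<^sup>+z. f (fst p) (snd p) z \<partial>lborel \<partial>lborel) = (\<integral>\<^sup>+x. \<integral>\<^sup>+v. \<integral>\<^sup>+z. f x v z \<partial>lborel \<partial>lborel \<partial>lborel)"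
    using lborel.nn_integral_fst[of "\<lambda>p. \<integral>\<^sup>+z. f (fst p) (snd p) z \<partial>lborel" lborel] Im[unfolded borel_prod]
    by (simp add: lborel_prod)
  also have "\<dots> = (\<integral>\<^sup>+x. 0 \<partial>(lborel :: R3 measure))"
  proof (rule nn_integral_cong_AE, use AE_sections_notin_null(1)[OF N] in eventually_elim)
    fix x :: R3 assume x: "AE v in lborel. (x, v) \<notin> N"
    have [measurable]: "(\<lambda>t. (indicator N (x, fst t + A (snd t)) :: ennreal)) \<in> borel_measurable (borel \<Otimes>\<^sub>M borel)"
    proof -
      have [measurable]: "N \<in> sets (borel \<Otimes>\<^sub>M borel)" using Nb by (simp only: borel_prod)
      show ?thesis by measurable
    qed
    have "(\<integral>\<^sup>+v. \<integral>\<^sup>+z. f x v z \<partial>lborel \<partial>lborel) = (\<integral>\<^sup>+v. \<integral>\<^sup>+z. indicator N (x, v + A z) \<partial>lborel \<partial>lborel)"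
    proof (rule nn_integral_cong)
      fix v
      show "(\<integral>\<^sup>+z. f x v z \<partial>lborel) = (\<integral>\<^sup>+z. indicator N (x, v + A z) \<partial>lborel)"
        using nn_integral_lborel_translate[OF fxv[of x v], of "(v, 0)"] by (simp add: f_def)
    qed
    also have "\<dots> = (\<integral>\<^sup>+z. \<integral>\<^sup>+v. indicator N (x, v + A z) \<partial>lborel \<partial>lborel)"
      by (rule lborel_pair.Fubini'[symmetric]) (simp add: case_prod_beta)
    also have "\<dots> = (\<integral>\<^sup>+z. 0 \<partial>(lborel :: (R3 \<times> real \<times> real) measure))"
    proof (rule nn_integral_cong)
      fix z
      have [measurable]: "(\<lambda>v. indicator N (x, v) :: ennreal) \<in> borel_measurable borel"
      proof -
        have [measurable]: "N \<in> sets (borel \<Otimes>\<^sub>M borel)" using Nb by (simp only: borel_prod)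
        show ?thesis by measurable
      qed
      have "(\<integral>\<^sup>+v. indicator N (x, v + A z) \<partial>lborel) = (\<integral>\<^sup>+v. indicator N (x, v) \<partial>lborel)"
        using nn_integral_lborel_translate[of "\<lambda>v. indicator N (x, v)" "A z"] by (simp add: add.commute)
      also have "\<dots> = (\<integral>\<^sup>+v. 0 \<partial>(lborel :: R3 measure))"
        by (rule nn_integral_cong_AE) (use x in \<open>auto elim!: eventually_mono\<close>)
      finally show "(\<integral>\<^sup>+v. indicator N (x, v + A z) \<partial>lborel) = 0" by simp
    qed
    finally show "(\<integral>\<^sup>+v. \<integral>\<^sup>+z. f x v z \<partial>lborel \<partial>lborel) = 0" by simp
  qed
  finally have "(\<integral>\<^sup>+p. \<integral>\<^sup>+z. f (fst p) (snd p) z \<partial>lborel \<partial>lborel) = 0" by simp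
  then have "AE p in lborel. (\<integral>\<^sup>+z. f (fst p) (snd p) z \<partial>lborel) = 0"
    using Im by (subst (asm) nn_integral_0_iff_AE) (simp_all add: borel_prod)
  then show ?thesis
  proof eventually_elim
    case (elim p)
    then have "AE z in lborel. f (fst p) (snd p) z = 0"
      by (subst (asm) nn_integral_0_iff_AE) simp_all
    then show ?case by eventually_elim (auto simp: f_def indicator_def split: if_splits)
  qed
qed

section \<open>The Sobolev norms in Tonelli form\<close>

lemma Hs_ext_norm_sq_cong:
  assumes "AE x in lborel. x \<in> \<Omega> \<longrightarrow> u x = w x"
  shows "Hs_ext_norm_sq \<Omega> s u = Hs_ext_norm_sq \<Omega> s w"
proof -
  have "(\<integral>\<^sup>+x\<in>\<Omega>. ennreal (\<bar>u x\<bar>\<^sup>2) \<partial>lebesgue) = (\<integral>\<^sup>+x\<in>\<Omega>. ennreal (\<bar>w x\<bar>\<^sup>2) \<partial>lebesgue)"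
    unfolding nn_integral_completion
    by (rule nn_integral_cong_AE, use assms in eventually_elim) (auto simp: indicator_def)
  moreover have "(\<integral>\<^sup>+x\<in>\<Omega>. (\<integral>\<^sup>+y\<in>\<Omega>. ennreal (\<bar>u x - u y\<bar>\<^sup>2 / norm (x - y) powr (3 + 2 * s)) \<partial>lebesgue) \<partial>lebesgue)
     = (\<integral>\<^sup>+x\<in>\<Omega>. (\<integral>\<^sup>+y\<in>\<Omega>. ennreal (\<bar>w x - w y\<bar>\<^sup>2 / norm (x - y) powr (3 + 2 * s)) \<partial>lebesgue) \<partial>lebesgue)"
    unfolding nn_integral_completion
  proof (rule nn_integral_cong_AE, use assms in eventually_elim)
    fix x assume x: "x \<in> \<Omega> \<longrightarrow> u x = w x"
    have "(\<integral>\<^sup>+y\<in>\<Omega>. ennreal (\<bar>u x - u y\<bar>\<^sup>2 / norm (x - y) powr (3 + 2 * s)) \<partial>lborel) = (\<integral>\<^sup>+y\<in>\<Omega>. ennreal (\<bar>w x - w y\<bar>\<^sup>2 / norm (x - y) powr (3 + 2 * s)) \<partial>lborel)"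
      if "x \<in> \<Omega>"
      by (rule nn_integral_cong_AE, use assms in eventually_elim) (use x that in \<open>auto simp: indicator_def\<close>)
    then show "(\<integral>\<^sup>+y\<in>\<Omega>. ennreal (\<bar>u x - u y\<bar>\<^sup>2 / norm (x - y) powr (3 + 2 * s)) \<partial>lborel) * indicator \<Omega> x
       = (\<integral>\<^sup>+y\<in>\<Omega>. ennreal (\<bar>w x - w y\<bar>\<^sup>2 / norm (x - y) powr (3 + 2 * s)) \<partial>lborel) * indicator \<Omega> x"
      by (simp add: indicator_def)
  qed
  ultimately show ?thesis by (simp add: Hs_ext_norm_sq_def)
qed

text \<open>A null set in phase space has null position sections for almost every velocity, which is
  all that the norm sees.\<close>

lemma L2Hs_ext_norm_sq_cong:
  assumes "AE p in lborel. fst p \<in> \<Omega> \<longrightarrow> f (fst p) (snd p) = g (fst p) (snd p)"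
  shows "L2Hs_ext_norm_sq \<Omega> s \<alpha> \<beta> f = L2Hs_ext_norm_sq \<Omega> s \<alpha> \<beta> g"
proof -
  obtain N where N: "{p. \<not> (fst p \<in> \<Omega> \<longrightarrow> f (fst p) (snd p) = g (fst p) (snd p))} \<subseteq> N" "N \<in> null_sets lborel"
    using assms by (auto elim!: AE_E simp: null_sets_def)
  show ?thesis
    unfolding L2Hs_ext_norm_sq_def nn_integral_completion
  proof (rule nn_integral_cong_AE, use AE_sections_notin_null(2)[OF N(2)] in eventually_elim)
    fix v assume "AE x in lborel. (x, v) \<notin> N"
    then have "AE x in lborel. x \<in> \<Omega> \<longrightarrow> f x v = g x v"
    proof eventually_elim
      case (elim x)
      then have "(x, v) \<notin> {p. \<not> (fst p \<in> \<Omega> \<longrightarrow> f (fst p) (snd p) = g (fst p) (snd p))}" using N(1) by blast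
      then show ?case by simp
    qed
    then show "Hs_ext_norm_sq \<Omega> s (\<lambda>x. f x v) * ennreal (exp (2 * \<alpha> * (norm v)\<^sup>2) * (1 + norm v) powr (2 * \<beta>)) =
        Hs_ext_norm_sq \<Omega> s (\<lambda>x. g x v) * ennreal (exp (2 * \<alpha> * (norm v)\<^sup>2) * (1 + norm v) powr (2 * \<beta>))"
      by (simp add: Hs_ext_norm_sq_cong)
  qed
qed

text \<open>A squared weighted L^2 norm in velocity; \<open>e\<close> is the full exponent of the
  polynomial weight in the squared norm.\<close>

definition L2w :: "real \<Rightarrow> real \<Rightarrow> (R3 \<Rightarrow> real) \<Rightarrow> ennreal" where
  "L2w \<alpha> e f = (\<integral>\<^sup>+v. (wabs \<alpha> f v)\<^sup>2 * ennreal ((1 + norm v) powr e) \<partial>lborel)"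

lemma wabs_sq: "(wabs \<alpha> f v)\<^sup>2 = ennreal (exp (2 * \<alpha> * (norm v)\<^sup>2) * (f v)\<^sup>2)"
  by (simp add: wabs_def ennreal_power power_mult_distrib flip: exp_double)

text \<open>Tonelli moves the velocity integral innermost. The norm then consists of velocity norms
  of f x and of differences f x - f y, integrated with nonnegative kernels in position, so an
  estimate in velocity for fixed \<open>x\<close> and \<open>y\<close> is sufficient.\<close>

lemma L2Hs_ext_norm_sq_eq:
  fixes f :: "R3 \<Rightarrow> R3 \<Rightarrow> real"
  assumes \<Omega>: "open \<Omega>" and f: "case_prod f \<in> borel_measurable borel"
  shows "L2Hs_ext_norm_sq \<Omega> s \<alpha> \<beta> f = (\<integral>\<^sup>+x\<in>\<Omega>. L2w \<alpha> (2 * \<beta>) (f x) \<partial>lborel) +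
    (\<integral>\<^sup>+x\<in>\<Omega>. (\<integral>\<^sup>+y\<in>\<Omega>. ennreal (1 / norm (x - y) powr (3 + 2 * s)) * L2w \<alpha> (2 * \<beta>) (\<lambda>v. f x v - f y v) \<partial>lborel) \<partial>lborel)"
proof -
  have [measurable]: "\<Omega> \<in> sets borel" using \<Omega> by simp
  have hm[measurable]: "(\<lambda>t. f (a t) (g t)) \<in> borel_measurable M"
    if [measurable]: "a \<in> borel_measurable M" "g \<in> borel_measurable M" for a g and M :: "'c measure"
    using measurable_compose[OF borel_measurable_Pair[OF that] f] by simp
  define W where "W = (\<lambda>v::R3. ennreal (exp (2 * \<alpha> * (norm v)\<^sup>2) * (1 + norm v) powr (2 * \<beta>)))"
  have [measurable]: "W \<in> borel_measurable borel" unfolding W_def by measurable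
  define k where "k = (\<lambda>x y::R3. ennreal (1 / norm (x - y) powr (3 + 2 * s)))"
  have [measurable]: "(\<lambda>t. k (a t) (g t)) \<in> borel_measurable M"
    if [measurable]: "a \<in> borel_measurable M" "g \<in> borel_measurable M" for a g and M :: "'c measure"
    unfolding k_def by measurable
  have Lw: "L2w \<alpha> (2 * \<beta>) u = (\<integral>\<^sup>+v. ennreal ((u v)\<^sup>2) * W v \<partial>lborel)" for u
    unfolding L2w_def wabs_sq W_def by (intro nn_integral_cong) (simp add: ennreal_mult mult_ac)
  define H1 where "H1 = (\<lambda>v. \<integral>\<^sup>+x\<in>\<Omega>. ennreal ((f x v)\<^sup>2) \<partial>lborel)"
  define H2 where "H2 = (\<lambda>v. \<integral>\<^sup>+x\<in>\<Omega>. (\<integral>\<^sup>+y\<in>\<Omega>. k x y * ennreal ((f x v - f y v)\<^sup>2) \<partial>lborel) \<partial>lborel)"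
  have [measurable]: "H1 \<in> borel_measurable borel" "H2 \<in> borel_measurable borel"
    unfolding H1_def H2_def by measurable
  have "L2Hs_ext_norm_sq \<Omega> s \<alpha> \<beta> f = (\<integral>\<^sup>+v. (H1 v + H2 v) * W v \<partial>lborel)"
    unfolding L2Hs_ext_norm_sq_def Hs_ext_norm_sq_def nn_integral_completion H1_def H2_def W_def k_def
    by (simp add: ennreal_mult[symmetric])
  also have "\<dots> = (\<integral>\<^sup>+v. H1 v * W v \<partial>lborel) + (\<integral>\<^sup>+v. H2 v * W v \<partial>lborel)"
    by (simp add: distrib_right nn_integral_add)
  also have "(\<integral>\<^sup>+v. H1 v * W v \<partial>lborel) = (\<integral>\<^sup>+v. \<integral>\<^sup>+x. ennreal ((f x v)\<^sup>2) * W v * indicator \<Omega> x \<partial>lborel \<partial>lborel)"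
    unfolding H1_def by (intro nn_integral_cong, subst nn_integral_multc[symmetric], measurable) (simp add: mult_ac)
  also have "\<dots> = (\<integral>\<^sup>+x. \<integral>\<^sup>+v. ennreal ((f x v)\<^sup>2) * W v * indicator \<Omega> x \<partial>lborel \<partial>lborel)"
    by (rule lborel_pair.Fubini') measurable
  also have "\<dots> = (\<integral>\<^sup>+x\<in>\<Omega>. L2w \<alpha> (2 * \<beta>) (f x) \<partial>lborel)"
    unfolding Lw by (intro nn_integral_cong nn_integral_multc) measurable
  also have "(\<integral>\<^sup>+v. H2 v * W v \<partial>lborel) = (\<integral>\<^sup>+v. \<integral>\<^sup>+x. (\<integral>\<^sup>+y\<in>\<Omega>. k x y * ennreal ((f x v - f y v)\<^sup>2) \<partial>lborel) * indicator \<Omega> x * W v \<partial>lborel \<partial>lborel)"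
    unfolding H2_def by (intro nn_integral_cong nn_integral_multc[symmetric]) measurable
  also have "\<dots> = (\<integral>\<^sup>+x. \<integral>\<^sup>+v. (\<integral>\<^sup>+y\<in>\<Omega>. k x y * ennreal ((f x v - f y v)\<^sup>2) \<partial>lborel) * indicator \<Omega> x * W v \<partial>lborel \<partial>lborel)"
    by (rule lborel_pair.Fubini') measurable
  also have "\<dots> = (\<integral>\<^sup>+x\<in>\<Omega>. (\<integral>\<^sup>+y\<in>\<Omega>. k x y * L2w \<alpha> (2 * \<beta>) (\<lambda>v. f x v - f y v) \<partial>lborel) \<partial>lborel)"
  proof (rule nn_integral_cong)
    fix x :: R3
    have "(\<integral>\<^sup>+v. (\<integral>\<^sup>+y\<in>\<Omega>. k x y * ennreal ((f x v - f y v)\<^sup>2) \<partial>lborel) * indicator \<Omega> x * W v \<partial>lborel)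
      = (\<integral>\<^sup>+v. (\<integral>\<^sup>+y. k x y * ennreal ((f x v - f y v)\<^sup>2) * indicator \<Omega> y * W v \<partial>lborel) * indicator \<Omega> x \<partial>lborel)"
    proof (rule nn_integral_cong)
      fix v
      have "(\<integral>\<^sup>+y. k x y * ennreal ((f x v - f y v)\<^sup>2) * indicator \<Omega> y * W v \<partial>lborel) = (\<integral>\<^sup>+y. k x y * ennreal ((f x v - f y v)\<^sup>2) * indicator \<Omega> y \<partial>lborel) * W v"
        by (rule nn_integral_multc) measurable
      then show "(\<integral>\<^sup>+y\<in>\<Omega>. k x y * ennreal ((f x v - f y v)\<^sup>2) \<partial>lborel) * indicator \<Omega> x * W v
        = (\<integral>\<^sup>+y. k x y * ennreal ((f x v - f y v)\<^sup>2) * indicator \<Omega> y * W v \<partial>lborel) * indicator \<Omega> x"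
        by (simp add: mult_ac)
    qed
    also have "\<dots> = (\<integral>\<^sup>+v. (\<integral>\<^sup>+y. k x y * ennreal ((f x v - f y v)\<^sup>2) * indicator \<Omega> y * W v \<partial>lborel) \<partial>lborel) * indicator \<Omega> x"
      by (rule nn_integral_multc) measurable
    also have "(\<integral>\<^sup>+v. (\<integral>\<^sup>+y. k x y * ennreal ((f x v - f y v)\<^sup>2) * indicator \<Omega> y * W v \<partial>lborel) \<partial>lborel)
      = (\<integral>\<^sup>+y. (\<integral>\<^sup>+v. k x y * ennreal ((f x v - f y v)\<^sup>2) * indicator \<Omega> y * W v \<partial>lborel) \<partial>lborel)"
      by (rule lborel_pair.Fubini') measurable
    also have "\<dots> = (\<integral>\<^sup>+y\<in>\<Omega>. k x y * L2w \<alpha> (2 * \<beta>) (\<lambda>v. f x v - f y v) \<partial>lborel)"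
    proof (rule nn_integral_cong)
      fix y
      have "(\<integral>\<^sup>+v. k x y * ennreal ((f x v - f y v)\<^sup>2) * indicator \<Omega> y * W v \<partial>lborel)
        = (\<integral>\<^sup>+v. (k x y * indicator \<Omega> y) * (ennreal ((f x v - f y v)\<^sup>2) * W v) \<partial>lborel)"
        by (simp add: mult_ac)
      also have "\<dots> = (k x y * indicator \<Omega> y) * (\<integral>\<^sup>+v. ennreal ((f x v - f y v)\<^sup>2) * W v \<partial>lborel)"
        by (rule nn_integral_cmult) measurable
      finally show "(\<integral>\<^sup>+v. k x y * ennreal ((f x v - f y v)\<^sup>2) * indicator \<Omega> y * W v \<partial>lborel)
        = k x y * L2w \<alpha> (2 * \<beta>) (\<lambda>v. f x v - f y v) * indicator \<Omega> y" unfolding Lw by (simp add: mult_ac)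
    qed
    finally show "(\<integral>\<^sup>+v. (\<integral>\<^sup>+y\<in>\<Omega>. k x y * ennreal ((f x v - f y v)\<^sup>2) \<partial>lborel) * indicator \<Omega> x * W v \<partial>lborel)
      = (\<integral>\<^sup>+y\<in>\<Omega>. k x y * L2w \<alpha> (2 * \<beta>) (\<lambda>v. f x v - f y v) \<partial>lborel) * indicator \<Omega> x" .
  qed
  finally show ?thesis unfolding k_def .
qed

text \<open>The two versions of the angular kernel agree only for almost every angle, whereas the
  collision integral runs over triples; with \<theta> outermost, a null set of angles contributes
  0.\<close>

lemma AE_lborel_angle:
  assumes "AE \<theta> in lborel. P \<theta>"
  shows "AE z in (lborel :: (R3 \<times> real \<times> real) measure). P (snd (snd z))"
proof -
  obtain N where N: "{\<theta>. \<not> P \<theta>} \<subseteq> N" "N \<in> null_sets lborel"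
    using assms by (auto elim!: AE_E simp: null_sets_def)
  have [measurable]: "N \<in> sets borel" using null_setsD2[OF N(2)] by (simp only: sets_lborel)
  have m: "(\<lambda>z::R3 \<times> real \<times> real. indicator N (snd (snd z)) :: ennreal) \<in> borel_measurable borel"
    unfolding borel_prod[symmetric] by measurable
  have "(\<integral>\<^sup>+z. indicator N (snd (snd z)) \<partial>(lborel :: (R3 \<times> real \<times> real) measure))
     = (\<integral>\<^sup>+\<theta>. \<integral>\<^sup>+u. \<integral>\<^sup>+\<phi>. indicator N \<theta> \<partial>(lborel :: real measure) \<partial>(lborel :: R3 measure) \<partial>lborel)"
    by (subst nn_integral_lborel_triple[OF m]) simp
  also have "\<dots> = (\<integral>\<^sup>+\<theta>. 0 \<partial>(lborel :: real measure))"
    by (rule nn_integral_cong_AE, use AE_not_in[OF N(2)] in eventually_elim) simp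
  finally have "(\<integral>\<^sup>+z. indicator N (snd (snd z)) \<partial>(lborel :: (R3 \<times> real \<times> real) measure)) = 0" by simp
  then have "AE z in (lborel :: (R3 \<times> real \<times> real) measure). (indicator N (snd (snd z)) :: ennreal) = 0"
    using m by (subst (asm) nn_integral_0_iff_AE) simp_all
  then show ?thesis
  proof eventually_elim
    case (elim z)
    then have "snd (snd z) \<notin> N" by (simp add: indicator_def split: if_splits)
    then show ?case using N(1) by blast
  qed
qed

section \<open>Weighted estimates for \<open>Gam\<close>\<close>

lemma wabs_leI:
  "wabs \<alpha> f v \<le> ennreal (A * (1 + norm v) powr (- \<beta>))"
  if "\<bar>f v\<bar> * exp (\<alpha> * (norm v)\<^sup>2) * (1 + norm v) powr \<beta> \<le> A"
proof -
  have "1 + norm v \<noteq> 0" using norm_ge_zero[of v] by linarith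
  then have "0 < (1 + norm v) powr \<beta>" by simp
  then have "exp (\<alpha> * (norm v)\<^sup>2) * \<bar>f v\<bar> \<le> A * (1 + norm v) powr (- \<beta>)"
    using that by (simp add: powr_minus field_simps)
  then show ?thesis unfolding wabs_def by (rule ennreal_leI)
qed

lemma coll_sum_measurable:
  assumes fr: "collision_frame e2 e3" and "F \<in> borel_measurable borel" "G \<in> borel_measurable borel"
  shows "coll_sum e2 e3 \<gamma> F G \<in> borel_measurable borel"
proof -
  have sf: "sigma_finite_measure (lborel :: (R3 \<times> real \<times> real) measure)" by standard
  have "(fst :: R3 \<times> real \<times> real \<Rightarrow> R3) \<in> borel_measurable borel"
    by (auto intro!: borel_measurable_continuous_onI continuous_on_fst continuous_on_id)
  then have "coll_op lborel (coll_weight \<gamma>) (gain_shift e2 e3) (gain_coshift e2 e3) F G \<in> borel_measurable borel"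
    "coll_op lborel (coll_weight \<gamma>) (\<lambda>z. 0) fst F G \<in> borel_measurable borel"
    using gain_shift_measurable[OF fr] assms by (intro coll_op_measurable[OF sf]; simp)+
  then show ?thesis unfolding coll_sum_def[abs_def] by simp
qed

text \<open>The pointwise bound is the difference estimate against zero functions. In the L^2 bound
  the splitting produces one term with bounded second factor \<open>k2\<close> and one with bounded
  first factor \<open>j1\<close>, which decides which of the two bounds of
  \<open>coll_sum_bounds\<close> applies to each and why A2 multiplies the difference in the first
  argument and A1 that in the second.\<close>

lemma Gam_bounds:
  fixes \<gamma> \<beta> \<alpha> Cb :: real
  assumes fr: "collision_frame e2 e3" and \<gamma>: "-3 < \<gamma>" and \<beta>: "2 * \<beta> > 3 + \<gamma>" and \<alpha>: "\<alpha> \<ge> 0"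
    and b: "\<And>\<theta>. 0 < \<theta> \<Longrightarrow> \<theta> < pi/2 \<Longrightarrow> 0 \<le> b (cos \<theta>) \<and> b (cos \<theta>) \<le> Cb * cos \<theta>" and Cb: "Cb > 0"
    and bm: "b \<in> borel_measurable borel"
  obtains C where "C > 0"
    "\<And>k1 k2 A1 A2 v. k1 \<in> borel_measurable borel \<Longrightarrow> k2 \<in> borel_measurable borel \<Longrightarrow> A1 \<ge> 0 \<Longrightarrow> A2 \<ge> 0 \<Longrightarrow>
       (\<And>v. wabs \<alpha> k1 v \<le> ennreal (A1 * (1 + norm v) powr (- \<beta>))) \<Longrightarrow> (\<And>v. wabs \<alpha> k2 v \<le> ennreal (A2 * (1 + norm v) powr (- \<beta>))) \<Longrightarrow>
       integrable lborel (\<lambda>z. indicator collision_domain z *\<^sub>R (Gam_integrand \<gamma> b e2 e3 k1 k2 v z))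
       \<and> wabs \<alpha> (Gam \<gamma> b e2 e3 k1 k2) v \<le> ennreal (C * A1 * A2 * (1 + norm v) powr (\<gamma> - \<beta>))"
    "\<And>k1 k2 j1 j2 A1 A2. k1 \<in> borel_measurable borel \<Longrightarrow> k2 \<in> borel_measurable borel \<Longrightarrow> j1 \<in> borel_measurable borel \<Longrightarrow> j2 \<in> borel_measurable borel \<Longrightarrow>
       A1 \<ge> 0 \<Longrightarrow> A2 \<ge> 0 \<Longrightarrow>
       (\<And>v. wabs \<alpha> k1 v \<le> ennreal (A1 * (1 + norm v) powr (- \<beta>))) \<Longrightarrow> (\<And>v. wabs \<alpha> k2 v \<le> ennreal (A2 * (1 + norm v) powr (- \<beta>))) \<Longrightarrow>
       (\<And>v. wabs \<alpha> j1 v \<le> ennreal (A1 * (1 + norm v) powr (- \<beta>))) \<Longrightarrow> (\<And>v. wabs \<alpha> j2 v \<le> ennreal (A2 * (1 + norm v) powr (- \<beta>))) \<Longrightarrow>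
       L2w \<alpha> (- \<gamma>) (\<lambda>v. Gam \<gamma> b e2 e3 k1 k2 v - Gam \<gamma> b e2 e3 j1 j2 v) \<le>
         ennreal (C * A2\<^sup>2) * L2w \<alpha> \<gamma> (\<lambda>v. k1 v - j1 v) + ennreal (C * A1\<^sup>2) * L2w \<alpha> \<gamma> (\<lambda>v. k2 v - j2 v)"
proof -
  obtain C where C: "C > 0"
    and inf: "\<And>F G f g v. (\<forall>v. F v \<le> ennreal (f * (1 + norm v) powr (- \<beta>))) \<Longrightarrow> (\<forall>v. G v \<le> ennreal (g * (1 + norm v) powr (- \<beta>)))
       \<Longrightarrow> f \<ge> 0 \<Longrightarrow> g \<ge> 0 \<Longrightarrow> coll_sum e2 e3 \<gamma> F G v \<le> ennreal (C * f * g * (1 + norm v) powr (\<gamma> - \<beta>))"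
    and l1: "\<And>F G g. F \<in> borel_measurable borel \<Longrightarrow> G \<in> borel_measurable borel \<Longrightarrow> (\<forall>v. G v \<le> ennreal (g * (1 + norm v) powr (- \<beta>))) \<Longrightarrow> g \<ge> 0
       \<Longrightarrow> (\<integral>\<^sup>+v. ennreal ((1 + norm v) powr (- \<gamma>)) * (coll_sum e2 e3 \<gamma> F G v)\<^sup>2 \<partial>lborel)
          \<le> ennreal (C * g\<^sup>2) * (\<integral>\<^sup>+p. (F p)\<^sup>2 * ennreal ((1 + norm p) powr \<gamma>) \<partial>lborel)"
    and l2: "\<And>F G f. F \<in> borel_measurable borel \<Longrightarrow> G \<in> borel_measurable borel \<Longrightarrow> (\<forall>v. F v \<le> ennreal (f * (1 + norm v) powr (- \<beta>))) \<Longrightarrow> f \<ge> 0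
       \<Longrightarrow> (\<integral>\<^sup>+v. ennreal ((1 + norm v) powr (- \<gamma>)) * (coll_sum e2 e3 \<gamma> F G v)\<^sup>2 \<partial>lborel)
          \<le> ennreal (C * f\<^sup>2) * (\<integral>\<^sup>+p. (G p)\<^sup>2 * ennreal ((1 + norm p) powr \<gamma>) \<partial>lborel)"
    using coll_sum_bounds[OF fr \<gamma> \<beta>] by (elim exE conjE) (rule that; blast)
  define K where "K = pi powr (-3/4) * Cb"
  have K: "K > 0" using Cb by (simp add: K_def)
  have Cb0: "Cb \<ge> 0" using Cb by simp
  \<comment> \<open>The summand K C serves the pointwise bound; 2 K^2 C comes from squaring K (S1 +
    S2).\<close>
  define D where "D = K * C + 2 * K\<^sup>2 * C"
  have D: "D > 0" "K * C \<le> D" "2 * K\<^sup>2 * C \<le> D" using K C by (auto simp: D_def add_pos_pos)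
  have w0: "wabs \<alpha> (\<lambda>_. 0) = (\<lambda>_. 0)" by (simp add: wabs_def fun_eq_iff)
  have fin: "coll_sum e2 e3 \<gamma> (wabs \<alpha> k1) (wabs \<alpha> k2) v < \<infinity>"
    if "A1 \<ge> 0" "A2 \<ge> 0" "\<And>v. wabs \<alpha> k1 v \<le> ennreal (A1 * (1 + norm v) powr (- \<beta>))" "\<And>v. wabs \<alpha> k2 v \<le> ennreal (A2 * (1 + norm v) powr (- \<beta>))"
    for k1 k2 A1 A2 v
    using inf[of "wabs \<alpha> k1" A1 "wabs \<alpha> k2" A2 v] that by (auto intro: le_less_trans)
  have G0: "Gam \<gamma> b e2 e3 (\<lambda>_. 0) (\<lambda>_. 0) v = 0" for v
    by (simp add: Gam_def collision_integrand_def Let_def case_prod_beta)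
  show ?thesis
  proof (rule that[OF D(1)], goal_cases)
    case (1 k1 k2 A1 A2 v)
    note f1 = fin[OF 1(3-6), of v]
    have f0: "coll_sum e2 e3 \<gamma> (wabs \<alpha> (\<lambda>_. 0)) (wabs \<alpha> (\<lambda>_. 0)) v < \<infinity>" by (simp add: w0 coll_sum_zero)
    have z: "(\<lambda>_::R3. 0::real) \<in> borel_measurable borel" by simp
    note r = Gam_diff_le[OF fr \<alpha> b Cb0 bm 1(1,2) z z f1 f0]
    have "wabs \<alpha> (Gam \<gamma> b e2 e3 k1 k2) v \<le> ennreal K * coll_sum e2 e3 \<gamma> (wabs \<alpha> k1) (wabs \<alpha> k2) v"
      using r(2) by (simp add: wabs_def[of _ "Gam \<gamma> b e2 e3 k1 k2"] G0 w0 coll_sum_zero K_def)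
    also have "\<dots> \<le> ennreal K * ennreal (C * A1 * A2 * (1 + norm v) powr (\<gamma> - \<beta>))"
      using 1 by (intro mult_left_mono inf) auto
    also have "\<dots> = ennreal (K * C * (A1 * A2 * (1 + norm v) powr (\<gamma> - \<beta>)))"
      using K by (simp add: ennreal_mult'[symmetric] mult.assoc)
    also have "\<dots> \<le> ennreal (D * (A1 * A2 * (1 + norm v) powr (\<gamma> - \<beta>)))"
      using D 1 by (intro ennreal_leI mult_right_mono) auto
    finally show ?case using r(1) by (simp add: mult.assoc)
  next
    case (2 k1 k2 j1 j2 A1 A2)
    note m = 2(1-4)
    define F where "F = wabs \<alpha> (\<lambda>w. k1 w - j1 w)"
    define G where "G = wabs \<alpha> (\<lambda>w. k2 w - j2 w)"
    have [measurable]: "F \<in> borel_measurable borel" "G \<in> borel_measurable borel" "wabs \<alpha> k2 \<in> borel_measurable borel" "wabs \<alpha> j1 \<in> borel_measurable borel"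
      unfolding F_def G_def using m by measurable
    define S1 where "S1 = coll_sum e2 e3 \<gamma> F (wabs \<alpha> k2)"
    define S2 where "S2 = coll_sum e2 e3 \<gamma> (wabs \<alpha> j1) G"
    have [measurable]: "S1 \<in> borel_measurable borel" "S2 \<in> borel_measurable borel"
      unfolding S1_def S2_def by (intro coll_sum_measurable fr; measurable)+
    define w where "w = (\<lambda>v::R3. ennreal ((1 + norm v) powr (- \<gamma>)))"
    have [measurable]: "w \<in> borel_measurable borel" unfolding w_def by measurable
    have "L2w \<alpha> (- \<gamma>) (\<lambda>v. Gam \<gamma> b e2 e3 k1 k2 v - Gam \<gamma> b e2 e3 j1 j2 v) \<le>
       (\<integral>\<^sup>+v. ennreal (2 * K\<^sup>2) * (w v * (S1 v)\<^sup>2) + ennreal (2 * K\<^sup>2) * (w v * (S2 v)\<^sup>2) \<partial>lborel)"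
      unfolding L2w_def
    proof (rule nn_integral_mono)
      fix v
      have "wabs \<alpha> (\<lambda>v. Gam \<gamma> b e2 e3 k1 k2 v - Gam \<gamma> b e2 e3 j1 j2 v) v \<le> ennreal K * (S1 v + S2 v)"
        unfolding wabs_def K_def S1_def S2_def F_def G_def
        by (rule Gam_diff_le(2)[OF fr \<alpha> b Cb0 bm m, unfolded wabs_def]) (use fin[unfolded wabs_def] 2 in \<open>auto simp: wabs_def\<close>)
      then have "(wabs \<alpha> (\<lambda>v. Gam \<gamma> b e2 e3 k1 k2 v - Gam \<gamma> b e2 e3 j1 j2 v) v)\<^sup>2 \<le> (ennreal K * (S1 v + S2 v))\<^sup>2"
        by (rule power_mono) simp
      also have "\<dots> = ennreal (K\<^sup>2) * (S1 v + S2 v)\<^sup>2" using K by (simp add: power_mult_distrib ennreal_power)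
      also have "\<dots> \<le> ennreal (K\<^sup>2) * (2 * (S1 v)\<^sup>2 + 2 * (S2 v)\<^sup>2)"
        by (rule mult_left_mono[OF ennreal_sum_squared_le]) simp
      also have "\<dots> = ennreal (2 * K\<^sup>2) * (S1 v)\<^sup>2 + ennreal (2 * K\<^sup>2) * (S2 v)\<^sup>2"
        by (simp add: ennreal_mult distrib_left mult_ac)
      finally have "(wabs \<alpha> (\<lambda>v. Gam \<gamma> b e2 e3 k1 k2 v - Gam \<gamma> b e2 e3 j1 j2 v) v)\<^sup>2 * w v \<le> (ennreal (2 * K\<^sup>2) * (S1 v)\<^sup>2 + ennreal (2 * K\<^sup>2) * (S2 v)\<^sup>2) * w v"
        by (rule mult_right_mono) simp
      then show "(wabs \<alpha> (\<lambda>v. Gam \<gamma> b e2 e3 k1 k2 v - Gam \<gamma> b e2 e3 j1 j2 v) v)\<^sup>2 * ennreal ((1 + norm v) powr (- \<gamma>))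
        \<le> ennreal (2 * K\<^sup>2) * (w v * (S1 v)\<^sup>2) + ennreal (2 * K\<^sup>2) * (w v * (S2 v)\<^sup>2)"
        by (simp add: w_def distrib_left distrib_right mult_ac)
    qed
    also have "\<dots> = ennreal (2 * K\<^sup>2) * (\<integral>\<^sup>+v. w v * (S1 v)\<^sup>2 \<partial>lborel) + ennreal (2 * K\<^sup>2) * (\<integral>\<^sup>+v. w v * (S2 v)\<^sup>2 \<partial>lborel)"
      by (simp add: nn_integral_add nn_integral_cmult)
    also have "\<dots> \<le> ennreal (2 * K\<^sup>2) * (ennreal (C * A2\<^sup>2) * L2w \<alpha> \<gamma> (\<lambda>v. k1 v - j1 v)) + ennreal (2 * K\<^sup>2) * (ennreal (C * A1\<^sup>2) * L2w \<alpha> \<gamma> (\<lambda>v. k2 v - j2 v))"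
    proof (intro add_mono mult_left_mono)
      show "(\<integral>\<^sup>+v. w v * (S1 v)\<^sup>2 \<partial>lborel) \<le> ennreal (C * A2\<^sup>2) * L2w \<alpha> \<gamma> (\<lambda>v. k1 v - j1 v)"
        unfolding w_def S1_def L2w_def F_def[symmetric] by (rule l1) (use 2 in auto)
      show "(\<integral>\<^sup>+v. w v * (S2 v)\<^sup>2 \<partial>lborel) \<le> ennreal (C * A1\<^sup>2) * L2w \<alpha> \<gamma> (\<lambda>v. k2 v - j2 v)"
        unfolding w_def S2_def L2w_def G_def[symmetric] by (rule l2) (use 2 in auto)
    qed simp_all
    also have "\<dots> = ennreal (2 * K\<^sup>2 * C * A2\<^sup>2) * L2w \<alpha> \<gamma> (\<lambda>v. k1 v - j1 v) + ennreal (2 * K\<^sup>2 * C * A1\<^sup>2) * L2w \<alpha> \<gamma> (\<lambda>v. k2 v - j2 v)"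
      using C by (simp add: ennreal_mult mult.assoc)
    also have "\<dots> \<le> ennreal (D * A2\<^sup>2) * L2w \<alpha> \<gamma> (\<lambda>v. k1 v - j1 v) + ennreal (D * A1\<^sup>2) * L2w \<alpha> \<gamma> (\<lambda>v. k2 v - j2 v)"
      using D by (intro add_mono mult_right_mono ennreal_leI) auto
    finally show ?case .
  qed
qed

lemma Gam_measurable:
  fixes h1 h2 :: "R3 \<Rightarrow> R3 \<Rightarrow> real"
  assumes fr: "collision_frame e2 e3" and bm: "b \<in> borel_measurable borel"
    and h: "case_prod h1 \<in> borel_measurable borel" "case_prod h2 \<in> borel_measurable borel"
  shows "case_prod (\<lambda>x. Gam \<gamma> b e2 e3 (h1 x) (h2 x)) \<in> borel_measurable borel"
proof -
  note cm = collision_integrand_measurable[OF fr bm h, of \<gamma>]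
  have [measurable]: "(\<lambda>t. collision_integrand \<gamma> b e2 e3 (mw (h1 (fst (fst t))))
      (mw (h2 (fst (fst t)))) (snd (fst t)) (snd t))
    \<in> borel_measurable ((borel \<Otimes>\<^sub>M borel) \<Otimes>\<^sub>M borel)"
    unfolding borel_prod by (rule cm)
  have [measurable]: "Maxwellian \<in> borel_measurable borel" unfolding Maxwellian_def[abs_def] by measurable
  have "(\<lambda>t. indicator collision_domain (snd t) *\<^sub>R (Gam_integrand \<gamma> b e2 e3 (h1 (fst (fst t))) (h2 (fst (fst t))) (snd (fst t)) (snd t))) \<in> borel_measurable ((borel \<Otimes>\<^sub>M borel) \<Otimes>\<^sub>M lborel)"
    by measurable
  then have "(\<lambda>p. \<integral>z. indicator collision_domain z *\<^sub>R (Gam_integrand \<gamma> b e2 e3 (h1 (fst p)) (h2 (fst p)) (snd p) z) \<partial>lborel) \<in> borel_measurable (borel \<Otimes>\<^sub>M borel)"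
    by (intro lborel.borel_measurable_lebesgue_integral) (simp add: case_prod_beta)
  then show ?thesis unfolding borel_prod by (simp add: Gam_def case_prod_beta')
qed

text \<open>Both hypotheses are linear in squared velocity norms with constants independent of
  position, so they integrate over \<Omega>, and over pairs of points against the Gagliardo kernel,
  term by term.\<close>

lemma L2Hs_Gam_le:
  fixes h1 h2 :: "R3 \<Rightarrow> R3 \<Rightarrow> real"
  assumes \<Omega>: "open \<Omega>" and gm: "case_prod g \<in> borel_measurable borel"
    and h: "case_prod h1 \<in> borel_measurable borel" "case_prod h2 \<in> borel_measurable borel"
    and l0: "\<And>x. L2w \<alpha> (- \<gamma>) (g x) \<le> c2 * L2w \<alpha> \<gamma> (h1 x) + c1 * L2w \<alpha> \<gamma> (h2 x)"
    and l1: "\<And>x y. L2w \<alpha> (- \<gamma>) (\<lambda>v. g x v - g y v) \<le> c2 * L2w \<alpha> \<gamma> (\<lambda>v. h1 x v - h1 y v) + c1 * L2w \<alpha> \<gamma> (\<lambda>v. h2 x v - h2 y v)"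
  shows "L2Hs_ext_norm_sq \<Omega> s \<alpha> (- \<gamma> / 2) g \<le> c2 * L2Hs_ext_norm_sq \<Omega> s \<alpha> (\<gamma> / 2) h1 + c1 * L2Hs_ext_norm_sq \<Omega> s \<alpha> (\<gamma> / 2) h2"
proof -
  have [measurable]: "\<Omega> \<in> sets borel" using \<Omega> by simp
  define k where "k = (\<lambda>x y::R3. ennreal (1 / norm (x - y) powr (3 + 2 * s)))"
  have km[measurable]: "(\<lambda>t. k (a t) (g t)) \<in> borel_measurable M"
    if [measurable]: "a \<in> borel_measurable M" "g \<in> borel_measurable M" for a g and M :: "'c measure"
    unfolding k_def by measurable
  define P where "P = (\<lambda>f. \<integral>\<^sup>+x\<in>\<Omega>. L2w \<alpha> \<gamma> (f x) \<partial>lborel)"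
  define R where "R = (\<lambda>f. \<integral>\<^sup>+x\<in>\<Omega>. (\<integral>\<^sup>+y\<in>\<Omega>. k x y * L2w \<alpha> \<gamma> (\<lambda>v. f x v - f y v) \<partial>lborel) \<partial>lborel)"
  have PR: "L2Hs_ext_norm_sq \<Omega> s \<alpha> (\<gamma> / 2) f = P f + R f" if "case_prod f \<in> borel_measurable borel" for f :: "R3 \<Rightarrow> R3 \<Rightarrow> real"
    using L2Hs_ext_norm_sq_eq[OF \<Omega> that, of s \<alpha> "\<gamma> / 2"] by (simp add: P_def R_def k_def)
  have lm: "(\<lambda>x. L2w \<alpha> \<gamma> (f x)) \<in> borel_measurable borel"
    "(\<lambda>t. L2w \<alpha> \<gamma> (\<lambda>v. f (fst t) v - f (snd t) v)) \<in> borel_measurable (borel \<Otimes>\<^sub>M borel)"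
    if f: "case_prod f \<in> borel_measurable borel" for f :: "R3 \<Rightarrow> R3 \<Rightarrow> real"
  proof -
    have [measurable]: "(\<lambda>t. f (a t) (g t)) \<in> borel_measurable M"
      if "a \<in> borel_measurable M" "g \<in> borel_measurable M" for a g and M :: "'d measure"
      using measurable_compose[OF borel_measurable_Pair[OF that] f] by simp
    show "(\<lambda>x. L2w \<alpha> \<gamma> (f x)) \<in> borel_measurable borel"
      unfolding L2w_def wabs_def by measurable
    show "(\<lambda>t. L2w \<alpha> \<gamma> (\<lambda>v. f (fst t) v - f (snd t) v)) \<in> borel_measurable (borel \<Otimes>\<^sub>M borel)"
      unfolding L2w_def wabs_def by measurable
  qed
  have lxy: "(\<lambda>y. L2w \<alpha> \<gamma> (\<lambda>v. f x v - f y v)) \<in> borel_measurable borel" if f: "case_prod f \<in> borel_measurable borel" for f :: "R3 \<Rightarrow> R3 \<Rightarrow> real" and x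
    using measurable_compose[OF _ lm(2)[OF f], of "\<lambda>y. (x, y)"] by simp
  note [measurable] = lm(1)[OF h(1)] lm(1)[OF h(2)] lm(2)[OF h(1)] lm(2)[OF h(2)] lxy[OF h(1)] lxy[OF h(2)]
  have "(\<integral>\<^sup>+x\<in>\<Omega>. L2w \<alpha> (- \<gamma>) (g x) \<partial>lborel) \<le> (\<integral>\<^sup>+x. c2 * (L2w \<alpha> \<gamma> (h1 x) * indicator \<Omega> x) + c1 * (L2w \<alpha> \<gamma> (h2 x) * indicator \<Omega> x) \<partial>lborel)"
    by (intro nn_integral_mono) (use l0 in \<open>simp split: split_indicator\<close>)
  also have "\<dots> = c2 * P h1 + c1 * P h2"
    unfolding P_def by (simp add: nn_integral_add nn_integral_cmult)
  finally have 1: "(\<integral>\<^sup>+x\<in>\<Omega>. L2w \<alpha> (- \<gamma>) (g x) \<partial>lborel) \<le> c2 * P h1 + c1 * P h2" .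
  define J where "J = (\<lambda>f x. \<integral>\<^sup>+y\<in>\<Omega>. k x y * L2w \<alpha> \<gamma> (\<lambda>v. f x v - f y v) \<partial>lborel)"
  have Jm: "J f \<in> borel_measurable borel" if f: "case_prod f \<in> borel_measurable borel" for f :: "R3 \<Rightarrow> R3 \<Rightarrow> real"
  proof -
    note [measurable] = lm(2)[OF f]
    have "(\<lambda>t. k (fst t) (snd t) * L2w \<alpha> \<gamma> (\<lambda>v. f (fst t) v - f (snd t) v) * indicator \<Omega> (snd t)) \<in> borel_measurable (borel \<Otimes>\<^sub>M lborel)"
      by measurable
    then show ?thesis unfolding J_def by (intro lborel.borel_measurable_nn_integral) (simp add: case_prod_beta)
  qed
  note [measurable] = Jm[OF h(1)] Jm[OF h(2)]
  have J: "(\<integral>\<^sup>+y\<in>\<Omega>. k x y * L2w \<alpha> (- \<gamma>) (\<lambda>v. g x v - g y v) \<partial>lborel) \<le> c2 * J h1 x + c1 * J h2 x" for x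
  proof -
    have "(\<integral>\<^sup>+y\<in>\<Omega>. k x y * L2w \<alpha> (- \<gamma>) (\<lambda>v. g x v - g y v) \<partial>lborel)
      \<le> (\<integral>\<^sup>+y. c2 * (k x y * L2w \<alpha> \<gamma> (\<lambda>v. h1 x v - h1 y v) * indicator \<Omega> y) + c1 * (k x y * L2w \<alpha> \<gamma> (\<lambda>v. h2 x v - h2 y v) * indicator \<Omega> y) \<partial>lborel)"
    proof (rule nn_integral_mono)
      fix y
      have "k x y * L2w \<alpha> (- \<gamma>) (\<lambda>v. g x v - g y v) \<le> k x y * (c2 * L2w \<alpha> \<gamma> (\<lambda>v. h1 x v - h1 y v) + c1 * L2w \<alpha> \<gamma> (\<lambda>v. h2 x v - h2 y v))"
        by (rule mult_left_mono[OF l1]) simp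
      then show "k x y * L2w \<alpha> (- \<gamma>) (\<lambda>v. g x v - g y v) * indicator \<Omega> y
        \<le> c2 * (k x y * L2w \<alpha> \<gamma> (\<lambda>v. h1 x v - h1 y v) * indicator \<Omega> y) + c1 * (k x y * L2w \<alpha> \<gamma> (\<lambda>v. h2 x v - h2 y v) * indicator \<Omega> y)"
        by (simp add: distrib_left mult_ac split: split_indicator)
    qed
    also have "\<dots> = c2 * J h1 x + c1 * J h2 x"
      unfolding J_def by (simp add: nn_integral_add nn_integral_cmult)
    finally show ?thesis .
  qed
  have "(\<integral>\<^sup>+x\<in>\<Omega>. (\<integral>\<^sup>+y\<in>\<Omega>. k x y * L2w \<alpha> (- \<gamma>) (\<lambda>v. g x v - g y v) \<partial>lborel) \<partial>lborel)
    \<le> (\<integral>\<^sup>+x. c2 * (J h1 x * indicator \<Omega> x) + c1 * (J h2 x * indicator \<Omega> x) \<partial>lborel)"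
    by (intro nn_integral_mono) (use J in \<open>simp split: split_indicator\<close>)
  also have "\<dots> = c2 * R h1 + c1 * R h2"
    by (simp add: nn_integral_add nn_integral_cmult) (simp add: R_def J_def)
  finally have 2: "(\<integral>\<^sup>+x\<in>\<Omega>. (\<integral>\<^sup>+y\<in>\<Omega>. k x y * L2w \<alpha> (- \<gamma>) (\<lambda>v. g x v - g y v) \<partial>lborel) \<partial>lborel) \<le> c2 * R h1 + c1 * R h2" .
  have "L2Hs_ext_norm_sq \<Omega> s \<alpha> (- \<gamma> / 2) g \<le> (c2 * P h1 + c1 * P h2) + (c2 * R h1 + c1 * R h2)"
    using add_mono[OF 1 2] L2Hs_ext_norm_sq_eq[OF \<Omega> gm, of s \<alpha> "- \<gamma> / 2"] by (simp add: k_def)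
  also have "\<dots> = c2 * (P h1 + R h1) + c1 * (P h2 + R h2)" by (simp add: distrib_left add_ac)
  finally show ?thesis by (simp add: PR h)
qed

section \<open>Return from Borel representatives to \<Gamma>\<close>

text \<open>The integrand of \<Gamma> evaluates its arguments at \<open>v\<close>,
  \<open>v\<^sub>*\<close>, \<open>v'\<close> and \<open>v\<^sub>*'\<close>. Outside a null set of
  phase points, the point at \<open>v\<close> avoids the exceptional set \<open>N\<close>, and for
  almost every collision so do the other three. The integrands then agree almost everywhere, and
  convergence and value pass from one to the other.\<close>

lemma Gamma_AE_eq_Gam:
  fixes h1 h2 h1' h2' :: "R3 \<Rightarrow> R3 \<Rightarrow> real"
  assumes fr: "collision_frame e2 e3" and bm: "b' \<in> borel_measurable borel"
    and bb: "AE \<theta> in lborel. 0 < \<theta> \<and> \<theta> < pi / 2 \<longrightarrow> b (cos \<theta>) = b' (cos \<theta>)"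
    and h1: "AE p in lborel. fst p \<in> \<Omega> \<longrightarrow> h1 (fst p) (snd p) = h1' (fst p) (snd p)"
    and h2: "AE p in lborel. fst p \<in> \<Omega> \<longrightarrow> h2 (fst p) (snd p) = h2' (fst p) (snd p)"
    and int: "\<And>x v. integrable lborel (\<lambda>z. indicator collision_domain z *\<^sub>R (Gam_integrand \<gamma> b' e2 e3 (h1' x) (h2' x) v z))"
  shows "AE p in lborel. fst p \<in> \<Omega> \<longrightarrow> \<Gamma>_converges \<gamma> b e2 e3 h1 h2 (fst p) (snd p) \<and>
    \<Gamma> \<gamma> b e2 e3 h1 h2 (fst p) (snd p) = Gam \<gamma> b' e2 e3 (h1' (fst p)) (h2' (fst p)) (snd p)"
proof -
  have "AE p in lborel. fst p \<in> \<Omega> \<longrightarrow> h1 (fst p) (snd p) = h1' (fst p) (snd p) \<and> h2 (fst p) (snd p) = h2' (fst p) (snd p)"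
    using h1 h2 by eventually_elim auto
  then obtain N where N: "{p. \<not> (fst p \<in> \<Omega> \<longrightarrow> h1 (fst p) (snd p) = h1' (fst p) (snd p) \<and> h2 (fst p) (snd p) = h2' (fst p) (snd p))} \<subseteq> N"
    "N \<in> null_sets lborel"
    by (auto elim!: AE_E simp: null_sets_def)
  have eq: "h1 x v = h1' x v \<and> h2 x v = h2' x v" if "x \<in> \<Omega>" "(x, v) \<notin> N" for x v
  proof -
    have "(x, v) \<notin> {p. \<not> (fst p \<in> \<Omega> \<longrightarrow> h1 (fst p) (snd p) = h1' (fst p) (snd p) \<and> h2 (fst p) (snd p) = h2' (fst p) (snd p))}"
      using N(1) that(2) by blast
    then show ?thesis using that(1) by simp
  qed
  have fm: "(fst :: R3 \<times> real \<times> real \<Rightarrow> R3) \<in> borel_measurable borel"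
    by (auto intro!: borel_measurable_continuous_onI continuous_on_fst continuous_on_id)
  show ?thesis
    using AE_not_in[OF N(2)] AE_shifted_notin_null[OF N(2) fm]
      AE_shifted_notin_null[OF N(2) gain_shift_measurable(1)[OF fr]] AE_shifted_notin_null[OF N(2) gain_shift_measurable(2)[OF fr]]
  proof eventually_elim
    case (elim p)
    define x where "x = fst p"
    define v where "v = snd p"
    define f where "f = (\<lambda>z. indicator collision_domain z *\<^sub>R collision_integrand \<gamma> b e2 e3 (mw (h1 x)) (mw (h2 x)) v z)"
    define g where "g = (\<lambda>z. indicator collision_domain z *\<^sub>R collision_integrand \<gamma> b' e2 e3 (mw (h1' x)) (mw (h2' x)) v z)"
    \<comment> \<open>The integrability hypothesis includes the Maxwellian prefactor, which is
      nonzero and may be cancelled.\<close>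
    have mg: "(\<lambda>z. Maxwellian v powr (-1/2) * g z) = (\<lambda>z. indicator collision_domain z *\<^sub>R (Gam_integrand \<gamma> b' e2 e3 (h1' x) (h2' x) v z))"
      by (simp add: g_def mult_ac)
    have mi: "integrable lborel (\<lambda>z. Maxwellian v powr (-1/2) * g z)" unfolding mg by (rule int)
    have "Maxwellian v \<noteq> 0" by (simp add: Maxwellian_def)
    then have gi: "integrable lborel g" using mi by simp
    show ?case
    proof (intro impI)
      assume "fst p \<in> \<Omega>"
      then have x: "x \<in> \<Omega>" by (simp add: x_def)
      have p: "(x, v) \<notin> N" using elim(1) by (simp add: x_def v_def)
      have fg: "AE z in lborel. g z = f z"
        using elim(2-4) AE_lborel_angle[OF bb]
      proof eventually_elim
        case (elim z)
        obtain vs \<phi> \<theta> where z: "z = (vs, \<phi>, \<theta>)" by (cases z) auto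
        have 1: "h1 x (v + A) = h1' x (v + A) \<and> h2 x (v + A) = h2' x (v + A)" if "(x, v + A) \<notin> N" for A
          by (rule eq[OF x that])
        have vs: "vs = v + (vs - v)" by simp
        have "z - (snd p, 0) = (vs - v, \<phi>, \<theta>)" by (simp add: z v_def zero_prod_def)
        note e = elim[unfolded this, folded x_def v_def]
        have "post_v (collision_dir e2 e3 (vs - v) \<phi> \<theta>) v vs = v + gain_shift e2 e3 (vs - v, \<phi>, \<theta>)"
          "post_vs (collision_dir e2 e3 (vs - v) \<phi> \<theta>) v vs = v + gain_coshift e2 e3 (vs - v, \<phi>, \<theta>)"
          using post_v_eq[OF fr, of "vs - v" \<phi> \<theta> v] post_vs_eq[OF fr, of "vs - v" \<phi> \<theta> v] by simp_all
        then show "g z = f z"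
          using 1[OF e(1)] 1[OF e(2)] 1[OF e(3)] eq[OF x p] e(4)
          by (auto simp: f_def g_def z collision_integrand_def Let_def collision_kernel_def collision_domain_def split: split_indicator)
      qed
      have gm: "g \<in> borel_measurable lborel" using gi by simp
      \<comment> \<open>\<open>f\<close> is built from Lebesgue measurable data and need not be
        Borel, so it inherits measurability from \<open>g\<close> in the completion, and the
        comparison of integrals is done there.\<close>
      have flm: "f \<in> borel_measurable lebesgue" by (rule borel_measurable_completion_AE[OF gm fg])
      have glm: "g \<in> borel_measurable lebesgue" using gm by (rule measurable_completion)
      have gli: "integrable lebesgue g" using gi gm by (simp add: integrable_completion)
      have fg': "AE z in lebesgue. f z = g z" using AE_completion[OF fg] by eventually_elim simp
      have fli: "integrable lebesgue f" using gli integrable_cong_AE[OF flm glm fg'] by simp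
      have "integral\<^sup>L lebesgue f = integral\<^sup>L lebesgue g" by (rule integral_cong_AE[OF flm glm fg'])
      also have "\<dots> = integral\<^sup>L lborel g" using gm by (rule integral_completion)
      finally have "Maxwellian v powr (-1/2) * integral\<^sup>L lebesgue f = (\<integral>z. Maxwellian v powr (-1/2) * g z \<partial>lborel)" by simp
      then have "\<Gamma> \<gamma> b e2 e3 h1 h2 x v = Gam \<gamma> b' e2 e3 (h1' x) (h2' x) v"
        unfolding mg by (simp add: \<Gamma>_def Q_def set_lebesgue_integral_def Gam_def f_def)
      moreover have "\<Gamma>_converges \<gamma> b e2 e3 h1 h2 x v"
        using fli by (simp add: \<Gamma>_converges_def Q_converges_def set_integrable_def f_def)
      ultimately show "\<Gamma>_converges \<gamma> b e2 e3 h1 h2 (fst p) (snd p) \<and>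
        \<Gamma> \<gamma> b e2 e3 h1 h2 (fst p) (snd p) = Gam \<gamma> b' e2 e3 (h1' (fst p)) (h2' (fst p)) (snd p)"
        by (simp add: x_def v_def)
    qed
  qed
qed

lemma phase_measurable_AE:
  assumes \<Omega>: "open \<Omega>" and g: "case_prod g \<in> borel_measurable borel"
    and ae: "AE p in lborel. fst p \<in> \<Omega> \<longrightarrow> f (fst p) (snd p) = g (fst p) (snd p)"
  shows "phase_measurable \<Omega> f"
proof -
  have S: "\<Omega> \<times> (UNIV :: R3 set) \<in> sets borel" using \<Omega> by (simp add: open_Times borel_open)
  have "(\<lambda>p. if p \<in> \<Omega> \<times> UNIV then case_prod g p else 0) \<in> borel_measurable lborel"
    using g S by simp
  moreover have "AE p in lborel. (if p \<in> \<Omega> \<times> UNIV then case_prod g p else 0) = (if p \<in> \<Omega> \<times> UNIV then case_prod f p else 0)"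
    using ae by eventually_elim (auto simp: case_prod_beta)
  ultimately have "(\<lambda>p. if p \<in> \<Omega> \<times> UNIV then case_prod f p else 0) \<in> borel_measurable lebesgue"
    by (rule borel_measurable_completion_AE)
  then show ?thesis unfolding phase_measurable_def by (rule borel_measurable_if_D)
qed

lemma AE_lebesgue_on_phase_iff:
  assumes "open \<Omega>"
  shows "(AE p in lebesgue_on (\<Omega> \<times> (UNIV :: R3 set)). P p) \<longleftrightarrow> (AE p in lborel. fst p \<in> \<Omega> \<longrightarrow> P p)"
proof -
  have "\<Omega> \<times> (UNIV :: R3 set) \<inter> space lebesgue \<in> sets lebesgue" using assms by (simp add: open_Times borel_open)
  then show ?thesis
    by (subst AE_restrict_space_iff) (auto simp: AE_completion_iff mem_Times_iff)
qed

lemma Linf_ext_norm_le: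
  assumes \<Omega>: "open \<Omega>" and f: "phase_measurable \<Omega> f"
    and ae: "AE p in lborel. fst p \<in> \<Omega> \<longrightarrow> wabs \<alpha> (f (fst p)) (snd p) \<le> ennreal (A * (1 + norm (snd p)) powr (- \<beta>))"
    and A: "A \<ge> 0"
  shows "Linf_ext_norm \<Omega> \<alpha> \<beta> f \<le> ennreal A"
  unfolding Linf_ext_norm_def
proof (rule esssup_I)
  have fm: "(\<lambda>p. f (fst p) (snd p)) \<in> borel_measurable (lebesgue_on (\<Omega> \<times> UNIV))"
    using f by (simp add: phase_measurable_def case_prod_beta')
  have "(\<lambda>p::R3 \<times> R3. exp (\<alpha> * (norm (snd p))\<^sup>2) * (1 + norm (snd p)) powr \<beta>) \<in> borel_measurable borel"
    unfolding borel_prod[symmetric] by measurable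
  then have "(\<lambda>p::R3 \<times> R3. exp (\<alpha> * (norm (snd p))\<^sup>2) * (1 + norm (snd p)) powr \<beta>) \<in> borel_measurable (lebesgue_on (\<Omega> \<times> UNIV))"
    by (intro measurable_restrict_space1 measurable_completion) simp
  with fm have "(\<lambda>p. ennreal (\<bar>f (fst p) (snd p)\<bar> * (exp (\<alpha> * (norm (snd p))\<^sup>2) * (1 + norm (snd p)) powr \<beta>))) \<in> borel_measurable (lebesgue_on (\<Omega> \<times> UNIV))"
    by measurable
  then show "(\<lambda>(x, v). ennreal (\<bar>f x v\<bar> * exp (\<alpha> * (norm v)\<^sup>2) * (1 + norm v) powr \<beta>)) \<in> borel_measurable (lebesgue_on (\<Omega> \<times> UNIV))"
    by (simp add: case_prod_beta' mult.assoc)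
  have le: "ennreal (\<bar>f x v\<bar> * exp (\<alpha> * (norm v)\<^sup>2) * (1 + norm v) powr \<beta>) \<le> ennreal A"
    if "wabs \<alpha> (f x) v \<le> ennreal (A * (1 + norm v) powr (- \<beta>))" for x v
  proof (rule ennreal_leI)
    have nz: "1 + norm v \<noteq> 0" using norm_ge_zero[of v] by linarith
    have "exp (\<alpha> * (norm v)\<^sup>2) * \<bar>f x v\<bar> \<le> A * (1 + norm v) powr (- \<beta>)"
      using that A by (simp add: wabs_def ennreal_le_iff)
    then have "exp (\<alpha> * (norm v)\<^sup>2) * \<bar>f x v\<bar> * (1 + norm v) powr \<beta> \<le> A * (1 + norm v) powr (- \<beta>) * (1 + norm v) powr \<beta>"
      by (rule mult_right_mono) simp
    then show "\<bar>f x v\<bar> * exp (\<alpha> * (norm v)\<^sup>2) * (1 + norm v) powr \<beta> \<le> A"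
      using nz by (simp add: mult.assoc mult.commute mult.left_commute flip: powr_add)
  qed
  show "AE p in lebesgue_on (\<Omega> \<times> UNIV). (case p of (x, v) \<Rightarrow> ennreal (\<bar>f x v\<bar> * exp (\<alpha> * (norm v)\<^sup>2) * (1 + norm v) powr \<beta>)) \<le> ennreal A"
    unfolding AE_lebesgue_on_phase_iff[OF \<Omega>]
    using ae by eventually_elim (use le in \<open>auto simp: case_prod_beta\<close>)
qed

section \<open>The estimate between the X and Y norms\<close>

theorem lemma1p6:
  fixes b :: "real \<Rightarrow> real" and C\<^sub>b :: real
    and e2 e3 :: "R3 \<Rightarrow> R3"
    and \<Omega> :: "R3 set" and \<alpha> \<beta> \<gamma> s :: real
  assumes b_measurable: "b \<in> borel_measurable (lebesgue_on {0<..<1})"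
    and C\<^sub>b_pos: "C\<^sub>b > 0"
    and b_bounds: "\<And>\<theta>. 0 < \<theta> \<Longrightarrow> \<theta> < pi / 2 \<Longrightarrow> 0 < b (cos \<theta>) \<and> b (cos \<theta>) \<le> C\<^sub>b * cos \<theta>"
    and frame: "collision_frame e2 e3"
    and domain: "bounded_convex_C1_domain \<Omega>"
    and \<alpha>: "0 \<le> \<alpha>" "\<alpha> < 1/2"
    and \<gamma>: "-3 < \<gamma>" "\<gamma> \<le> 1"
    and \<beta>: "\<beta> > (3 + \<gamma>) / 2"
    and s: "0 < s" "s < 1"
  shows "(\<forall>h1 \<in> X_space \<Omega> s \<alpha> \<beta> \<gamma>. \<forall>h2 \<in> X_space \<Omega> s \<alpha> \<beta> \<gamma>.
            (AE (x, v) in lebesgue_on (\<Omega> \<times> UNIV). \<Gamma>_converges \<gamma> b e2 e3 h1 h2 x v) \<and>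
            \<Gamma> \<gamma> b e2 e3 h1 h2 \<in> Y_space \<Omega> s \<alpha> \<beta> \<gamma>) \<and>
         (\<exists>C\<^sub>4 > 0. \<forall>h1 \<in> X_space \<Omega> s \<alpha> \<beta> \<gamma>. \<forall>h2 \<in> X_space \<Omega> s \<alpha> \<beta> \<gamma>.
            Y_norm \<Omega> s \<alpha> \<beta> \<gamma> (\<Gamma> \<gamma> b e2 e3 h1 h2)
              \<le> C\<^sub>4 * X_norm \<Omega> s \<alpha> \<beta> \<gamma> h1 * X_norm \<Omega> s \<alpha> \<beta> \<gamma> h2)"
proof -
  have \<Omega>: "open \<Omega>" using domain by (simp add: bounded_convex_C1_domain_def)
  have \<beta>2: "2 * \<beta> > 3 + \<gamma>" using \<beta> by simp
  obtain b' where bm: "b' \<in> borel_measurable borel"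
    and b': "\<And>\<theta>. 0 < \<theta> \<Longrightarrow> \<theta> < pi / 2 \<Longrightarrow> 0 \<le> b' (cos \<theta>) \<and> b' (cos \<theta>) \<le> C\<^sub>b * cos \<theta>"
    and bb: "AE \<theta> in lborel. 0 < \<theta> \<and> \<theta> < pi / 2 \<longrightarrow> b (cos \<theta>) = b' (cos \<theta>)"
    using ex_borel_angular_kernel[OF b_measurable C\<^sub>b_pos b_bounds] by blast
  obtain C where C: "C > 0" and
    inf: "\<And>k1 k2 A1 A2 v. k1 \<in> borel_measurable borel \<Longrightarrow> k2 \<in> borel_measurable borel \<Longrightarrow> A1 \<ge> 0 \<Longrightarrow> A2 \<ge> 0 \<Longrightarrow>
       (\<And>v. wabs \<alpha> k1 v \<le> ennreal (A1 * (1 + norm v) powr (- \<beta>))) \<Longrightarrow> (\<And>v. wabs \<alpha> k2 v \<le> ennreal (A2 * (1 + norm v) powr (- \<beta>))) \<Longrightarrow>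
       integrable lborel (\<lambda>z. indicator collision_domain z *\<^sub>R (Gam_integrand \<gamma> b' e2 e3 k1 k2 v z))
       \<and> wabs \<alpha> (Gam \<gamma> b' e2 e3 k1 k2) v \<le> ennreal (C * A1 * A2 * (1 + norm v) powr (\<gamma> - \<beta>))" and
    l2: "\<And>k1 k2 j1 j2 A1 A2. k1 \<in> borel_measurable borel \<Longrightarrow> k2 \<in> borel_measurable borel \<Longrightarrow> j1 \<in> borel_measurable borel \<Longrightarrow> j2 \<in> borel_measurable borel \<Longrightarrow>
       A1 \<ge> 0 \<Longrightarrow> A2 \<ge> 0 \<Longrightarrow>
       (\<And>v. wabs \<alpha> k1 v \<le> ennreal (A1 * (1 + norm v) powr (- \<beta>))) \<Longrightarrow> (\<And>v. wabs \<alpha> k2 v \<le> ennreal (A2 * (1 + norm v) powr (- \<beta>))) \<Longrightarrow>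
       (\<And>v. wabs \<alpha> j1 v \<le> ennreal (A1 * (1 + norm v) powr (- \<beta>))) \<Longrightarrow> (\<And>v. wabs \<alpha> j2 v \<le> ennreal (A2 * (1 + norm v) powr (- \<beta>))) \<Longrightarrow>
       L2w \<alpha> (- \<gamma>) (\<lambda>v. Gam \<gamma> b' e2 e3 k1 k2 v - Gam \<gamma> b' e2 e3 j1 j2 v) \<le>
         ennreal (C * A2\<^sup>2) * L2w \<alpha> \<gamma> (\<lambda>v. k1 v - j1 v) + ennreal (C * A1\<^sup>2) * L2w \<alpha> \<gamma> (\<lambda>v. k2 v - j2 v)"
    using Gam_bounds[OF frame \<gamma>(1) \<beta>2 \<alpha>(1) b' C\<^sub>b_pos bm] by blast
  define Li where "Li = Linf_norm \<Omega> \<alpha> \<beta>"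
  define L where "L = L2Hs_norm \<Omega> s \<alpha> (\<gamma> / 2)"
  \<comment> \<open>The bounds are stated for the extended norms: \<open>enn2real\<close> sends
    \<infinity> to 0, so a bound for the real norms alone would not give membership in the Y
    space.\<close>
  have main: "(AE (x, v) in lebesgue_on (\<Omega> \<times> UNIV). \<Gamma>_converges \<gamma> b e2 e3 h1 h2 x v) \<and>
      phase_measurable \<Omega> (\<Gamma> \<gamma> b e2 e3 h1 h2) \<and>
      Linf_ext_norm \<Omega> \<alpha> (\<beta> - \<gamma>) (\<Gamma> \<gamma> b e2 e3 h1 h2) \<le> ennreal (C * Li h1 * Li h2) \<and>
      L2Hs_ext_norm_sq \<Omega> s \<alpha> (- \<gamma> / 2) (\<Gamma> \<gamma> b e2 e3 h1 h2) \<le> ennreal (C * (Li h2 * L h1)\<^sup>2 + C * (Li h1 * L h2)\<^sup>2)"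
    if h1: "h1 \<in> X_space \<Omega> s \<alpha> \<beta> \<gamma>" and h2: "h2 \<in> X_space \<Omega> s \<alpha> \<beta> \<gamma>" for h1 h2
  proof -
    have X: "phase_measurable \<Omega> h" "Linf_ext_norm \<Omega> \<alpha> \<beta> h < \<infinity>" "L2Hs_ext_norm_sq \<Omega> s \<alpha> (\<gamma> / 2) h = ennreal ((L h)\<^sup>2)"
      if "h \<in> X_space \<Omega> s \<alpha> \<beta> \<gamma>" for h
      using that by (auto simp: X_space_def Linf_space_def L2Hs_space_def L_def L2Hs_norm_def)
    obtain k1 where k1m: "case_prod k1 \<in> borel_measurable borel"
      and k1b: "\<And>x v. \<bar>k1 x v\<bar> * exp (\<alpha> * (norm v)\<^sup>2) * (1 + norm v) powr \<beta> \<le> Li h1"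
      and k1e: "AE p in lborel. fst p \<in> \<Omega> \<longrightarrow> h1 (fst p) (snd p) = k1 (fst p) (snd p)"
      using ex_borel_version[OF \<Omega> X(1,2)[OF h1]] unfolding Li_def by blast
    obtain k2 where k2m: "case_prod k2 \<in> borel_measurable borel"
      and k2b: "\<And>x v. \<bar>k2 x v\<bar> * exp (\<alpha> * (norm v)\<^sup>2) * (1 + norm v) powr \<beta> \<le> Li h2"
      and k2e: "AE p in lborel. fst p \<in> \<Omega> \<longrightarrow> h2 (fst p) (snd p) = k2 (fst p) (snd p)"
      using ex_borel_version[OF \<Omega> X(1,2)[OF h2]] unfolding Li_def by blast
    have A: "Li h1 \<ge> 0" "Li h2 \<ge> 0" by (auto simp: Li_def Linf_norm_def)
    have sm: "k1 x \<in> borel_measurable borel" "k2 x \<in> borel_measurable borel" for x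
      using measurable_compose[OF borel_measurable_Pair[OF measurable_const[of x] measurable_ident] k1m]
        measurable_compose[OF borel_measurable_Pair[OF measurable_const[of x] measurable_ident] k2m] by simp_all
    have w1: "wabs \<alpha> (k1 x) v \<le> ennreal (Li h1 * (1 + norm v) powr (- \<beta>))" for x v by (rule wabs_leI[OF k1b])
    have w2: "wabs \<alpha> (k2 x) v \<le> ennreal (Li h2 * (1 + norm v) powr (- \<beta>))" for x v by (rule wabs_leI[OF k2b])
    define g where "g = (\<lambda>x. Gam \<gamma> b' e2 e3 (k1 x) (k2 x))"
    have gm: "case_prod g \<in> borel_measurable borel" unfolding g_def by (rule Gam_measurable[OF frame bm k1m k2m])
    note I = inf[OF sm A w1 w2]
    have ae: "AE p in lborel. fst p \<in> \<Omega> \<longrightarrow> \<Gamma>_converges \<gamma> b e2 e3 h1 h2 (fst p) (snd p) \<and>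
      \<Gamma> \<gamma> b e2 e3 h1 h2 (fst p) (snd p) = g (fst p) (snd p)"
      unfolding g_def by (rule Gamma_AE_eq_Gam[OF frame bm bb k1e k2e I[THEN conjunct1]])
    have aeg: "AE p in lborel. fst p \<in> \<Omega> \<longrightarrow> \<Gamma> \<gamma> b e2 e3 h1 h2 (fst p) (snd p) = g (fst p) (snd p)"
      using ae by eventually_elim auto
    have pm: "phase_measurable \<Omega> (\<Gamma> \<gamma> b e2 e3 h1 h2)" by (rule phase_measurable_AE[OF \<Omega> gm aeg])
    have 1: "AE (x, v) in lebesgue_on (\<Omega> \<times> UNIV). \<Gamma>_converges \<gamma> b e2 e3 h1 h2 x v"
      unfolding AE_lebesgue_on_phase_iff[OF \<Omega>] using ae by eventually_elim (auto simp: case_prod_beta)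
    have 2: "Linf_ext_norm \<Omega> \<alpha> (\<beta> - \<gamma>) (\<Gamma> \<gamma> b e2 e3 h1 h2) \<le> ennreal (C * Li h1 * Li h2)"
    proof (rule Linf_ext_norm_le[OF \<Omega> pm])
      show "AE p in lborel. fst p \<in> \<Omega> \<longrightarrow> wabs \<alpha> (\<Gamma> \<gamma> b e2 e3 h1 h2 (fst p)) (snd p) \<le> ennreal (C * Li h1 * Li h2 * (1 + norm (snd p)) powr - (\<beta> - \<gamma>))"
        using aeg
      proof eventually_elim
        case (elim p)
        then show ?case using I[THEN conjunct2, of "fst p" "fst p" "snd p"] by (simp add: wabs_def g_def)
      qed
    qed (use A C in simp)
    \<comment> \<open>Against zero functions the difference estimate \<open>l2\<close> becomes the
      estimate for g x itself, which the L^2 part of the Sobolev norm requires.\<close>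
    have z: "(\<lambda>_::R3. 0::real) \<in> borel_measurable borel" by simp
    have G0: "Gam \<gamma> b' e2 e3 (\<lambda>_. 0) (\<lambda>_. 0) v = 0" for v
      by (simp add: Gam_def collision_integrand_def Let_def case_prod_beta)
    have "L2Hs_ext_norm_sq \<Omega> s \<alpha> (- \<gamma> / 2) g \<le> ennreal (C * (Li h2)\<^sup>2) * L2Hs_ext_norm_sq \<Omega> s \<alpha> (\<gamma> / 2) k1 + ennreal (C * (Li h1)\<^sup>2) * L2Hs_ext_norm_sq \<Omega> s \<alpha> (\<gamma> / 2) k2"
    proof (rule L2Hs_Gam_le[OF \<Omega> gm k1m k2m])
      show "L2w \<alpha> (- \<gamma>) (g x) \<le> ennreal (C * (Li h2)\<^sup>2) * L2w \<alpha> \<gamma> (k1 x) + ennreal (C * (Li h1)\<^sup>2) * L2w \<alpha> \<gamma> (k2 x)" for x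
        using l2[OF sm z z A w1 w2, of x x] A by (simp add: g_def G0 wabs_def)
      show "L2w \<alpha> (- \<gamma>) (\<lambda>v. g x v - g y v) \<le> ennreal (C * (Li h2)\<^sup>2) * L2w \<alpha> \<gamma> (\<lambda>v. k1 x v - k1 y v) + ennreal (C * (Li h1)\<^sup>2) * L2w \<alpha> \<gamma> (\<lambda>v. k2 x v - k2 y v)" for x y
        unfolding g_def by (rule l2[OF sm sm A w1 w2 w1 w2])
    qed
    also have "L2Hs_ext_norm_sq \<Omega> s \<alpha> (\<gamma> / 2) k1 = ennreal ((L h1)\<^sup>2)"
      using L2Hs_ext_norm_sq_cong[OF k1e, of s \<alpha> "\<gamma> / 2"] X(3)[OF h1] by simp
    also have "L2Hs_ext_norm_sq \<Omega> s \<alpha> (\<gamma> / 2) k2 = ennreal ((L h2)\<^sup>2)"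
      using L2Hs_ext_norm_sq_cong[OF k2e, of s \<alpha> "\<gamma> / 2"] X(3)[OF h2] by simp
    also have "ennreal (C * (Li h2)\<^sup>2) * ennreal ((L h1)\<^sup>2) + ennreal (C * (Li h1)\<^sup>2) * ennreal ((L h2)\<^sup>2) = ennreal (C * (Li h2 * L h1)\<^sup>2 + C * (Li h1 * L h2)\<^sup>2)"
      using C by (simp add: ennreal_mult[symmetric] ennreal_plus[symmetric] power_mult_distrib mult.assoc del: ennreal_plus)
    finally have 3: "L2Hs_ext_norm_sq \<Omega> s \<alpha> (- \<gamma> / 2) (\<Gamma> \<gamma> b e2 e3 h1 h2) \<le> ennreal (C * (Li h2 * L h1)\<^sup>2 + C * (Li h1 * L h2)\<^sup>2)"
      using L2Hs_ext_norm_sq_cong[OF aeg, of s \<alpha> "- \<gamma> / 2"] by simp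
    show ?thesis using 1 pm 2 3 by blast
  qed
  \<comment> \<open>In the constant, \<open>C\<close> comes from the supremum norm, which is bounded
    directly, and \<open>sqrt C\<close> from the Sobolev part, which is bounded through its
    square.\<close>
  have bound: "Y_norm \<Omega> s \<alpha> \<beta> \<gamma> (\<Gamma> \<gamma> b e2 e3 h1 h2) \<le> (C + sqrt C) * X_norm \<Omega> s \<alpha> \<beta> \<gamma> h1 * X_norm \<Omega> s \<alpha> \<beta> \<gamma> h2"
    if h1: "h1 \<in> X_space \<Omega> s \<alpha> \<beta> \<gamma>" and h2: "h2 \<in> X_space \<Omega> s \<alpha> \<beta> \<gamma>" for h1 h2
  proof -
    note m = main[OF h1 h2]
    have A: "Li h1 \<ge> 0" "Li h2 \<ge> 0" "L h1 \<ge> 0" "L h2 \<ge> 0" by (auto simp: Li_def Linf_norm_def L_def L2Hs_norm_def)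
    have 1: "Linf_norm \<Omega> \<alpha> (\<beta> - \<gamma>) (\<Gamma> \<gamma> b e2 e3 h1 h2) \<le> C * (Li h1 * Li h2)"
      unfolding Linf_norm_def using m A C by (intro enn2real_leI) (auto simp: mult.assoc)
    define P where "P = Li h2 * L h1"
    define R where "R = Li h1 * L h2"
    have PR: "P \<ge> 0" "R \<ge> 0" using A by (auto simp: P_def R_def)
    have "enn2real (L2Hs_ext_norm_sq \<Omega> s \<alpha> (- \<gamma> / 2) (\<Gamma> \<gamma> b e2 e3 h1 h2)) \<le> C * P\<^sup>2 + C * R\<^sup>2"
      using m C by (intro enn2real_leI) (auto simp: P_def R_def)
    also have "\<dots> \<le> (sqrt C * (P + R))\<^sup>2"
      using C PR by (simp add: power_mult_distrib power2_sum algebra_simps)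
    finally have "L2Hs_norm \<Omega> s \<alpha> (- \<gamma> / 2) (\<Gamma> \<gamma> b e2 e3 h1 h2) \<le> sqrt C * (P + R)"
      unfolding L2Hs_norm_def using C PR by (intro real_le_lsqrt) auto
    then have "Y_norm \<Omega> s \<alpha> \<beta> \<gamma> (\<Gamma> \<gamma> b e2 e3 h1 h2) \<le> C * (Li h1 * Li h2) + sqrt C * (P + R)"
      unfolding Y_norm_def using 1 by simp
    \<comment> \<open>The three products of norms on the left are among the four nonnegative terms
      of the expanded product of the X norms.\<close>
    also have "\<dots> \<le> C * ((Li h1 + L h1) * (Li h2 + L h2)) + sqrt C * ((Li h1 + L h1) * (Li h2 + L h2))"
      using C A by (intro add_mono mult_left_mono) (auto simp: P_def R_def algebra_simps)
    also have "\<dots> = (C + sqrt C) * (Li h1 + L h1) * (Li h2 + L h2)" by (simp add: algebra_simps)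
    finally show ?thesis by (simp add: X_norm_def Li_def L_def)
  qed
  show ?thesis
  proof (intro conjI exI[of _ "C + sqrt C"] ballI)
    fix h1 h2 assume h: "h1 \<in> X_space \<Omega> s \<alpha> \<beta> \<gamma>" "h2 \<in> X_space \<Omega> s \<alpha> \<beta> \<gamma>"
    note m = main[OF h]
    show "AE (x, v) in lebesgue_on (\<Omega> \<times> UNIV). \<Gamma>_converges \<gamma> b e2 e3 h1 h2 x v" using m by blast
    show "\<Gamma> \<gamma> b e2 e3 h1 h2 \<in> Y_space \<Omega> s \<alpha> \<beta> \<gamma>"
      using m by (auto simp: Y_space_def Linf_space_def L2Hs_space_def intro: le_less_trans)
    show "Y_norm \<Omega> s \<alpha> \<beta> \<gamma> (\<Gamma> \<gamma> b e2 e3 h1 h2) \<le> (C + sqrt C) * X_norm \<Omega> s \<alpha> \<beta> \<gamma> h1 * X_norm \<Omega> s \<alpha> \<beta> \<gamma> h2"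
      by (rule bound[OF h])
  qed (use C in \<open>simp add: add_pos_pos\<close>)
qed

end
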